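(* Let $\mathcal{A}$ be an abelian category and let $\mathcal{C}$ be a subcategory of $\mathcal{A}$ such that $\mathcal{C}\perp\mathcal{C}$ and $\mathcal{P}(\mathcal{A})$ is a generator for $\mathcal{C}$. Assume that $\mathcal{C}$ is a generator for $\mathcal{G}(\mathcal{C})^{\perp_1}$. Then: (1) $\mathcal{G}(\mathcal{C})^{\perp_1}\cup\mathcal{G}(\mathcal{C})\subseteq\mathrm{SPC}(\mathcal{G}(\mathcal{C}))$, and $\mathrm{SPC}(\mathcal{G}(\mathcal{C}))$ is closed under extensions and $\mathcal{C}$-stable direct summands. (2) $\mathrm{SPC}(\mathcal{G}(\mathcal{C}))$ is the minimal subcategory of $\mathcal{A}$ with the property in (1); that is, if $\mathcal{X}$ is any subcategory of $\mathcal{A}$ with $\mathcal{G}(\mathcal{C})^{\perp_1}\cup\mathcal{G}(\mathcal{C})\subseteq\mathcal{X}$ which is closed under extensions and $\mathcal{C}$-stable direct summands, then $\mathrm{SPC}(\mathcal{G}(\mathcal{C}))\subseteq\mathcal{X}$.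
   Context: All subcategories of the abelian category $\mathcal{A}$ are full, additive and closed under isomorphisms. $\mathcal{P}(\mathcal{A})$ is the subcategory of projective objects of $\mathcal{A}$. For subcategories $\mathcal{X},\mathcal{Y}$ of $\mathcal{A}$, $\mathcal{X}\perp\mathcal{Y}$ means $\mathrm{Ext}^{i}_{\mathcal{A}}(X,Y)=0$ for all $i\geq 1$, $X\in\mathcal{X}$, $Y\in\mathcal{Y}$. For subcategories $\mathcal{X}\subseteq\mathcal{T}$ of $\mathcal{A}$, $\mathcal{X}$ is a generator for $\mathcal{T}$ if for every $T\in\mathcal{T}$ there is an exact sequence $0\to T'\to X\to T\to 0$ in $\mathcal{A}$ with $X\in\mathcal{X}$ and $T'\in\mathcal{T}$ (in particular, $\mathcal{P}(\mathcal{A})$ being a generator for $\mathcal{C}$ includes $\mathcal{P}(\mathcal{A})\subseteq\mathcal{C}$). A sequence in $\mathcal{A}$ is $\mathrm{Hom}_{\mathcal{A}}(\mathcal{X},-)$-exact (resp. $\mathrm{Hom}_{\mathcal{A}}(-,\mathcal{X})$-exact) if it is exact after applying $\mathrm{Hom}_{\mathcal{A}}(X,-)$ (resp. $\mathrm{Hom}_{\mathcal{A}}(-,X)$) for every $X\in\mathcal{X}$. The Gorenstein subcategory $\mathcal{G}(\mathcal{C})$ consists of the objects $M$ of $\mathcal{A}$ for which there is an exact sequence $\cdots\to C_1\to C_0\to C^0\to C^1\to\cdots$ in $\mathcal{A}$ with all terms in $\mathcal{C}$, which is both $\mathrm{Hom}_{\mathcal{A}}(\mathcal{C},-)$-exact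 and $\mathrm{Hom}_{\mathcal{A}}(-,\mathcal{C})$-exact, such that $M\cong\mathrm{Im}(C_0\to C^0)$. $\mathcal{X}^{\perp_1}:=\{M\in\mathcal{A}\mid \mathrm{Ext}^1_{\mathcal{A}}(X,M)=0 \text{ for all } X\in\mathcal{X}\}$. A morphism $f:X\to Y$ with $X\in\mathcal{X}$ is an $\mathcal{X}$-precover of $Y$ if $\mathrm{Hom}_{\mathcal{A}}(X',f)$ is surjective for all $X'\in\mathcal{X}$; it is special if moreover $f$ is an epimorphism and $\mathrm{Ker}\,f\in\mathcal{X}^{\perp_1}$. $\mathrm{SPC}(\mathcal{G}(\mathcal{C}))$ is the subcategory of $\mathcal{A}$ consisting of the objects admitting a special $\mathcal{G}(\mathcal{C})$-precover. A subcategory $\mathcal{X}$ of $\mathcal{A}$ is closed under $\mathcal{C}$-stable direct summands if $X\oplus C\in\mathcal{X}$ with $C\in\mathcal{C}$ implies $X\in\mathcal{X}$. *)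

theory Defs
  imports "HOL-Algebra.Group"
begin

section \<open>Abelian categories\<close>

text \<open>
  Composition is written in the usual order: \<open>g \<odot> f\<close> is \<open>f\<close> followed by \<open>g\<close>.
  The values of the operations outside of \<open>Ob\<close>, \<open>Mor\<close> and composable or parallel pairs
  are irrelevant.
\<close>

record ('o, 'm) preadd =
  Ob :: "'o set"
  Mor :: "'m set"
  Dom :: "'m \<Rightarrow> 'o"
  Cod :: "'m \<Rightarrow> 'o"
  Id :: "'o \<Rightarrow> 'm"
  Comp :: "'m \<Rightarrow> 'm \<Rightarrow> 'm" (infixr "\<odot>\<index>" 70)
  Add :: "'m \<Rightarrow> 'm \<Rightarrow> 'm" (infixl "\<boxplus>\<index>" 65)
  Zero :: "'o \<Rightarrow> 'o \<Rightarrow> 'm"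

definition Hom :: "('o, 'm, 'z) preadd_scheme \<Rightarrow> 'o \<Rightarrow> 'o \<Rightarrow> 'm set" where
  "Hom \<A> X Y = {f \<in> Mor \<A>. Dom \<A> f = X \<and> Cod \<A> f = Y}"

locale category =
  fixes \<A> :: "('o, 'm, 'z) preadd_scheme" (structure)
  assumes Dom_Ob: "f \<in> Mor \<A> \<Longrightarrow> Dom \<A> f \<in> Ob \<A>"
    and Cod_Ob: "f \<in> Mor \<A> \<Longrightarrow> Cod \<A> f \<in> Ob \<A>"
    and Id_Hom: "X \<in> Ob \<A> \<Longrightarrow> Id \<A> X \<in> Hom \<A> X X"
    and Comp_Hom: "\<lbrakk>f \<in> Hom \<A> X Y; g \<in> Hom \<A> Y Z\<rbrakk> \<Longrightarrow> g \<odot> f \<in> Hom \<A> X Z"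
    and Comp_Id_left: "f \<in> Hom \<A> X Y \<Longrightarrow> Id \<A> Y \<odot> f = f"
    and Comp_Id_right: "f \<in> Hom \<A> X Y \<Longrightarrow> f \<odot> Id \<A> X = f"
    and Comp_assoc:
      "\<lbrakk>f \<in> Hom \<A> W X; g \<in> Hom \<A> X Y; h \<in> Hom \<A> Y Z\<rbrakk> \<Longrightarrow> (h \<odot> g) \<odot> f = h \<odot> (g \<odot> f)"

definition hom_group :: "('o, 'm, 'z) preadd_scheme \<Rightarrow> 'o \<Rightarrow> 'o \<Rightarrow> 'm monoid" where
  "hom_group \<A> X Y = \<lparr>carrier = Hom \<A> X Y, mult = Add \<A>, one = Zero \<A> X Y\<rparr>"

locale preadditive_category = category +
  assumes hom_comm_group: "\<lbrakk>X \<in> Ob \<A>; Y \<in> Ob \<A>\<rbrakk> \<Longrightarrow> comm_group (hom_group \<A> X Y)"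
    and Comp_Add_left:
      "\<lbrakk>f \<in> Hom \<A> X Y; g \<in> Hom \<A> Y Z; h \<in> Hom \<A> Y Z\<rbrakk> \<Longrightarrow> (g \<boxplus> h) \<odot> f = (g \<odot> f) \<boxplus> (h \<odot> f)"
    and Comp_Add_right:
      "\<lbrakk>f \<in> Hom \<A> X Y; g \<in> Hom \<A> X Y; h \<in> Hom \<A> Y Z\<rbrakk> \<Longrightarrow> h \<odot> (f \<boxplus> g) = (h \<odot> f) \<boxplus> (h \<odot> g)"

definition monic :: "('o, 'm, 'z) preadd_scheme \<Rightarrow> 'm \<Rightarrow> bool" where
  "monic \<A> f \<longleftrightarrow> f \<in> Mor \<A> \<and>
     (\<forall>W. \<forall>g\<in>Hom \<A> W (Dom \<A> f). \<forall>h\<in>Hom \<A> W (Dom \<A> f).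
        f \<odot>\<^bsub>\<A>\<^esub> g = f \<odot>\<^bsub>\<A>\<^esub> h \<longrightarrow> g = h)"

definition epic :: "('o, 'm, 'z) preadd_scheme \<Rightarrow> 'm \<Rightarrow> bool" where
  "epic \<A> f \<longleftrightarrow> f \<in> Mor \<A> \<and>
     (\<forall>W. \<forall>g\<in>Hom \<A> (Cod \<A> f) W. \<forall>h\<in>Hom \<A> (Cod \<A> f) W.
        g \<odot>\<^bsub>\<A>\<^esub> f = h \<odot>\<^bsub>\<A>\<^esub> f \<longrightarrow> g = h)"

definition isomorphic :: "('o, 'm, 'z) preadd_scheme \<Rightarrow> 'o \<Rightarrow> 'o \<Rightarrow> bool" where
  "isomorphic \<A> X Y \<longleftrightarrow>
     (\<exists>f\<in>Hom \<A> X Y. \<exists>g\<in>Hom \<A> Y X. g \<odot>\<^bsub>\<A>\<^esub> f = Id \<A> X \<and> f \<odot>\<^bsub>\<A>\<^esub> g = Id \<A> Y)"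

definition is_zero_object :: "('o, 'm, 'z) preadd_scheme \<Rightarrow> 'o \<Rightarrow> bool" where
  "is_zero_object \<A> Z \<longleftrightarrow> Z \<in> Ob \<A> \<and>
     (\<forall>X\<in>Ob \<A>. (\<exists>!f. f \<in> Hom \<A> X Z) \<and> (\<exists>!f. f \<in> Hom \<A> Z X))"

definition is_kernel :: "('o, 'm, 'z) preadd_scheme \<Rightarrow> 'm \<Rightarrow> 'm \<Rightarrow> bool" where
  "is_kernel \<A> k f \<longleftrightarrow> k \<in> Mor \<A> \<and> f \<in> Mor \<A> \<and> Cod \<A> k = Dom \<A> f \<and>
     f \<odot>\<^bsub>\<A>\<^esub> k = Zero \<A> (Dom \<A> k) (Cod \<A> f) \<and>
     (\<forall>W. \<forall>h\<in>Hom \<A> W (Dom \<A> f). f \<odot>\<^bsub>\<A>\<^esub> h = Zero \<A> W (Cod \<A> f) \<longrightarrow>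
        (\<exists>!u. u \<in> Hom \<A> W (Dom \<A> k) \<and> k \<odot>\<^bsub>\<A>\<^esub> u = h))"

definition is_cokernel :: "('o, 'm, 'z) preadd_scheme \<Rightarrow> 'm \<Rightarrow> 'm \<Rightarrow> bool" where
  "is_cokernel \<A> c f \<longleftrightarrow> c \<in> Mor \<A> \<and> f \<in> Mor \<A> \<and> Dom \<A> c = Cod \<A> f \<and>
     c \<odot>\<^bsub>\<A>\<^esub> f = Zero \<A> (Dom \<A> f) (Cod \<A> c) \<and>
     (\<forall>W. \<forall>h\<in>Hom \<A> (Cod \<A> f) W. h \<odot>\<^bsub>\<A>\<^esub> f = Zero \<A> (Dom \<A> f) W \<longrightarrow>
        (\<exists>!u. u \<in> Hom \<A> (Cod \<A> c) W \<and> u \<odot>\<^bsub>\<A>\<^esub> c = h))"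

definition is_biproduct ::
    "('o, 'm, 'z) preadd_scheme \<Rightarrow> 'o \<Rightarrow> 'o \<Rightarrow> 'o \<Rightarrow> 'm \<Rightarrow> 'm \<Rightarrow> 'm \<Rightarrow> 'm \<Rightarrow> bool" where
  "is_biproduct \<A> X Y S i j p q \<longleftrightarrow>
     i \<in> Hom \<A> X S \<and> j \<in> Hom \<A> Y S \<and> p \<in> Hom \<A> S X \<and> q \<in> Hom \<A> S Y \<and>
     p \<odot>\<^bsub>\<A>\<^esub> i = Id \<A> X \<and> q \<odot>\<^bsub>\<A>\<^esub> j = Id \<A> Y \<and>
     (i \<odot>\<^bsub>\<A>\<^esub> p) \<boxplus>\<^bsub>\<A>\<^esub> (j \<odot>\<^bsub>\<A>\<^esub> q) = Id \<A> S"

definition is_direct_sum :: "('o, 'm, 'z) preadd_scheme \<Rightarrow> 'o \<Rightarrow> 'o \<Rightarrow> 'o \<Rightarrow> bool" where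
  "is_direct_sum \<A> X Y S \<longleftrightarrow> (\<exists>i j p q. is_biproduct \<A> X Y S i j p q)"

locale abelian_category = preadditive_category +
  assumes ex_zero_object: "\<exists>Z. is_zero_object \<A> Z"
    and ex_direct_sum: "\<lbrakk>X \<in> Ob \<A>; Y \<in> Ob \<A>\<rbrakk> \<Longrightarrow> \<exists>S. is_direct_sum \<A> X Y S"
    and ex_kernel: "f \<in> Mor \<A> \<Longrightarrow> \<exists>k. is_kernel \<A> k f"
    and ex_cokernel: "f \<in> Mor \<A> \<Longrightarrow> \<exists>c. is_cokernel \<A> c f"
    and monic_normal: "monic \<A> f \<Longrightarrow> \<exists>g. is_kernel \<A> f g"
    and epic_normal: "epic \<A> f \<Longrightarrow> \<exists>g. is_cokernel \<A> f g"


section \<open>Exact sequences and subcategories\<close>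

text \<open>The image of \<open>f\<close>, as a subobject of its codomain, is the kernel of the cokernel of \<open>f\<close>.\<close>

definition is_image :: "('o, 'm, 'z) preadd_scheme \<Rightarrow> 'm \<Rightarrow> 'm \<Rightarrow> bool" where
  "is_image \<A> m f \<longleftrightarrow> (\<exists>c. is_cokernel \<A> c f \<and> is_kernel \<A> m c)"

text \<open>
  Images and kernels are determined only up to isomorphism, so equality of the subobjects
  \<open>Im f\<close> and \<open>Ker g\<close> says that some monomorphism represents both.
\<close>

definition exact_at :: "('o, 'm, 'z) preadd_scheme \<Rightarrow> 'm \<Rightarrow> 'm \<Rightarrow> bool" where
  "exact_at \<A> f g \<longleftrightarrow> f \<in> Mor \<A> \<and> g \<in> Mor \<A> \<and> Cod \<A> f = Dom \<A> g \<and>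
     (\<exists>m. is_image \<A> m f \<and> is_kernel \<A> m g)"

definition short_exact ::
    "('o, 'm, 'z) preadd_scheme \<Rightarrow> 'o \<Rightarrow> 'm \<Rightarrow> 'o \<Rightarrow> 'm \<Rightarrow> 'o \<Rightarrow> bool" where
  "short_exact \<A> X f Y g Z \<longleftrightarrow>
     f \<in> Hom \<A> X Y \<and> g \<in> Hom \<A> Y Z \<and> monic \<A> f \<and> exact_at \<A> f g \<and> epic \<A> g"

text \<open>A full subcategory is given by its objects; it is additive and closed under isomorphisms.\<close>

definition subcategory :: "('o, 'm, 'z) preadd_scheme \<Rightarrow> 'o set \<Rightarrow> bool" where
  "subcategory \<A> \<X> \<longleftrightarrow> \<X> \<subseteq> Ob \<A> \<and>
     (\<forall>X\<in>\<X>. \<forall>Y\<in>Ob \<A>. isomorphic \<A> X Y \<longrightarrow> Y \<in> \<X>) \<and>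
     (\<exists>Z\<in>\<X>. is_zero_object \<A> Z) \<and>
     (\<forall>X\<in>\<X>. \<forall>Y\<in>\<X>. \<forall>S. is_direct_sum \<A> X Y S \<longrightarrow> S \<in> \<X>)"

definition projectives :: "('o, 'm, 'z) preadd_scheme \<Rightarrow> 'o set" where
  "projectives \<A> = {P \<in> Ob \<A>. \<forall>g. epic \<A> g \<longrightarrow>
     (\<forall>f\<in>Hom \<A> P (Cod \<A> g). \<exists>h\<in>Hom \<A> P (Dom \<A> g). g \<odot>\<^bsub>\<A>\<^esub> h = f)}"

definition generator_for :: "('o, 'm, 'z) preadd_scheme \<Rightarrow> 'o set \<Rightarrow> 'o set \<Rightarrow> bool" where
  "generator_for \<A> \<X> \<T> \<longleftrightarrow> \<X> \<subseteq> \<T> \<and>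
     (\<forall>T\<in>\<T>. \<exists>T'\<in>\<T>. \<exists>X\<in>\<X>. \<exists>f g. short_exact \<A> T' f X g T)"

definition extension_closed :: "('o, 'm, 'z) preadd_scheme \<Rightarrow> 'o set \<Rightarrow> bool" where
  "extension_closed \<A> \<X> \<longleftrightarrow>
     (\<forall>X\<in>\<X>. \<forall>Z\<in>\<X>. \<forall>Y f g. short_exact \<A> X f Y g Z \<longrightarrow> Y \<in> \<X>)"

definition stable_summand_closed ::
    "('o, 'm, 'z) preadd_scheme \<Rightarrow> 'o set \<Rightarrow> 'o set \<Rightarrow> bool" where
  "stable_summand_closed \<A> \<C> \<X> \<longleftrightarrow>
     (\<forall>X\<in>Ob \<A>. \<forall>C\<in>\<C>. \<forall>S\<in>\<X>. is_direct_sum \<A> X C S \<longrightarrow> X \<in> \<X>)"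


section \<open>Yoneda Ext\<close>

text \<open>
  An \<open>n\<close>-extension \<open>0 \<rightarrow> Y \<rightarrow> E\<^sub>1 \<rightarrow> \<dots> \<rightarrow> E\<^sub>n \<rightarrow> X \<rightarrow> 0\<close> is represented by the list of its
  \<open>n + 1\<close> morphisms from \<open>Y\<close> to \<open>X\<close>; this is used for \<open>n \<ge> 1\<close> only.
\<close>

definition extensions :: "('o, 'm, 'z) preadd_scheme \<Rightarrow> nat \<Rightarrow> 'o \<Rightarrow> 'o \<Rightarrow> 'm list set" where
  "extensions \<A> n X Y = {E. length E = Suc n \<and> set E \<subseteq> Mor \<A> \<and>
     Dom \<A> (E ! 0) = Y \<and> Cod \<A> (E ! n) = X \<and>
     monic \<A> (E ! 0) \<and> (\<forall>i<n. exact_at \<A> (E ! i) (E ! Suc i)) \<and> epic \<A> (E ! n)}"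

text \<open>
  A pair \<open>(E, E')\<close> is in the following relation iff there is a morphism of extensions
  \<open>E \<rightarrow> E'\<close> that is the identity on both ends. Its components are \<open>\<phi> 0, \<dots>, \<phi> (n + 1)\<close>,
  where \<open>\<phi> (i + 1)\<close> goes from the codomain of the \<open>i\<close>-th morphism of \<open>E\<close> to that of \<open>E'\<close>.
\<close>

definition extension_morphs ::
    "('o, 'm, 'z) preadd_scheme \<Rightarrow> nat \<Rightarrow> 'o \<Rightarrow> 'o \<Rightarrow> ('m list \<times> 'm list) set" where
  "extension_morphs \<A> n X Y = {(E, E'). E \<in> extensions \<A> n X Y \<and> E' \<in> extensions \<A> n X Y \<and>
     (\<exists>\<phi>. \<phi> 0 = Id \<A> Y \<and> \<phi> (Suc n) = Id \<A> X \<and>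
        (\<forall>i\<le>n. \<phi> (Suc i) \<in> Hom \<A> (Cod \<A> (E ! i)) (Cod \<A> (E' ! i)) \<and>
               \<phi> (Suc i) \<odot>\<^bsub>\<A>\<^esub> E ! i = E' ! i \<odot>\<^bsub>\<A>\<^esub> \<phi> i))}"

definition Ext :: "('o, 'm, 'z) preadd_scheme \<Rightarrow> nat \<Rightarrow> 'o \<Rightarrow> 'o \<Rightarrow> 'm list set set" where
  "Ext \<A> n X Y =
     extensions \<A> n X Y // (extension_morphs \<A> n X Y \<union> (extension_morphs \<A> n X Y)\<inverse>)\<^sup>*"

text \<open>
  The group \<open>Ext\<^sup>n(X, Y)\<close> is zero iff it has only one element, so its addition (the Baer sum)
  is not needed.
\<close>

definition Ext_zero :: "('o, 'm, 'z) preadd_scheme \<Rightarrow> nat \<Rightarrow> 'o \<Rightarrow> 'o \<Rightarrow> bool" where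
  "Ext_zero \<A> n X Y \<longleftrightarrow> is_singleton (Ext \<A> n X Y)"

definition Ext_orthogonal :: "('o, 'm, 'z) preadd_scheme \<Rightarrow> 'o set \<Rightarrow> 'o set \<Rightarrow> bool" where
  "Ext_orthogonal \<A> \<X> \<Y> \<longleftrightarrow> (\<forall>i\<ge>1. \<forall>X\<in>\<X>. \<forall>Y\<in>\<Y>. Ext_zero \<A> i X Y)"

definition right_perp1 :: "('o, 'm, 'z) preadd_scheme \<Rightarrow> 'o set \<Rightarrow> 'o set" where
  "right_perp1 \<A> \<X> = {M \<in> Ob \<A>. \<forall>X\<in>\<X>. Ext_zero \<A> 1 X M}"


section \<open>The Gorenstein subcategory and special precovers\<close>

text \<open>
  A sequence is a family \<open>d\<close> of morphisms indexed by the integers, \<open>d n\<close> going from the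
  \<open>n\<close>-th to the \<open>(n + 1)\<close>-st term. In the notation
  \<open>\<dots> \<rightarrow> C\<^sub>1 \<rightarrow> C\<^sub>0 \<rightarrow> C\<^sup>0 \<rightarrow> C\<^sup>1 \<rightarrow> \<dots>\<close>, the \<open>n\<close>-th term is \<open>C\<^sup>n\<close> for \<open>n \<ge> 0\<close> and
  \<open>C\<^sub>-\<^sub>n\<^sub>-\<^sub>1\<close> for \<open>n < 0\<close>, so \<open>C\<^sub>0 \<rightarrow> C\<^sup>0\<close> is \<open>d (-1)\<close>.
\<close>

definition exact_sequence :: "('o, 'm, 'z) preadd_scheme \<Rightarrow> (int \<Rightarrow> 'm) \<Rightarrow> bool" where
  "exact_sequence \<A> d \<longleftrightarrow> (\<forall>n. exact_at \<A> (d n) (d (n + 1)))"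

definition Hom_left_exact :: "('o, 'm, 'z) preadd_scheme \<Rightarrow> 'o set \<Rightarrow> (int \<Rightarrow> 'm) \<Rightarrow> bool" where
  "Hom_left_exact \<A> \<X> d \<longleftrightarrow> (\<forall>X\<in>\<X>. \<forall>n.
     (\<lambda>h. d n \<odot>\<^bsub>\<A>\<^esub> h) ` Hom \<A> X (Dom \<A> (d n)) =
     {h \<in> Hom \<A> X (Dom \<A> (d (n + 1))).
        d (n + 1) \<odot>\<^bsub>\<A>\<^esub> h = Zero \<A> X (Cod \<A> (d (n + 1)))})"

definition Hom_right_exact :: "('o, 'm, 'z) preadd_scheme \<Rightarrow> 'o set \<Rightarrow> (int \<Rightarrow> 'm) \<Rightarrow> bool" where
  "Hom_right_exact \<A> \<X> d \<longleftrightarrow> (\<forall>X\<in>\<X>. \<forall>n.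
     (\<lambda>h. h \<odot>\<^bsub>\<A>\<^esub> d (n + 1)) ` Hom \<A> (Cod \<A> (d (n + 1))) X =
     {h \<in> Hom \<A> (Cod \<A> (d n)) X. h \<odot>\<^bsub>\<A>\<^esub> d n = Zero \<A> (Dom \<A> (d n)) X})"

definition Gorenstein :: "('o, 'm, 'z) preadd_scheme \<Rightarrow> 'o set \<Rightarrow> 'o set" where
  "Gorenstein \<A> \<C> = {M \<in> Ob \<A>. \<exists>d.
     exact_sequence \<A> d \<and> (\<forall>n. Dom \<A> (d n) \<in> \<C>) \<and>
     Hom_left_exact \<A> \<C> d \<and> Hom_right_exact \<A> \<C> d \<and>
     (\<exists>m. is_image \<A> m (d (-1)) \<and> isomorphic \<A> M (Dom \<A> m))}"

definition is_precover :: "('o, 'm, 'z) preadd_scheme \<Rightarrow> 'o set \<Rightarrow> 'm \<Rightarrow> 'o \<Rightarrow> bool" where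
  "is_precover \<A> \<X> f Y \<longleftrightarrow> f \<in> Mor \<A> \<and> Dom \<A> f \<in> \<X> \<and> Cod \<A> f = Y \<and>
     (\<forall>X'\<in>\<X>. (\<lambda>h. f \<odot>\<^bsub>\<A>\<^esub> h) ` Hom \<A> X' (Dom \<A> f) = Hom \<A> X' Y)"

definition is_special_precover ::
    "('o, 'm, 'z) preadd_scheme \<Rightarrow> 'o set \<Rightarrow> 'm \<Rightarrow> 'o \<Rightarrow> bool" where
  "is_special_precover \<A> \<X> f Y \<longleftrightarrow> is_precover \<A> \<X> f Y \<and> epic \<A> f \<and>
     (\<exists>k. is_kernel \<A> k f \<and> Dom \<A> k \<in> right_perp1 \<A> \<X>)"

definition SPC :: "('o, 'm, 'z) preadd_scheme \<Rightarrow> 'o set \<Rightarrow> 'o set" where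
  "SPC \<A> \<X> = {M \<in> Ob \<A>. \<exists>f. is_special_precover \<A> \<X> f M}"

end

theory Submission
  imports Defs
begin

text \<open>
  Only first extension groups matter, and their vanishing means that short exact sequences split.
  Writing \<open>\<G>\<close> for the Gorenstein objects, \<open>\<G>\<close> is the largest class of objects \<open>M\<close> orthogonal to \<open>\<C>\<close> on both
  sides that are kernel and cokernel in short exact sequences \<open>M \<rightarrow> C \<rightarrow> N\<close> and \<open>N' \<rightarrow> C' \<rightarrow> M\<close> with
  \<open>C, C' \<in> \<C>\<close> and \<open>N, N'\<close> in the class again. By this coinductive, self-dual description and the horseshoe
  construction, \<open>\<G>\<close> is closed under extensions and \<open>\<C>\<close>-stable summands, and every \<open>G \<in> \<G>\<close> has a projective
  presentation \<open>G' \<rightarrow> P \<rightarrow> G\<close> with \<open>G' \<in> \<G>\<close>, which replaces arguments with second extension groups.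

  For the minimality, let \<open>K \<rightarrow> G \<rightarrow> M\<close> be given by a special precover and \<open>G \<rightarrow> C \<rightarrow> G'\<close> be exact.
  The cokernel \<open>Q\<close> of \<open>K \<rightarrow> C\<close> lies in \<open>\<G>\<^sup>\<bottom>\<close> and \<open>M \<rightarrow> Q \<rightarrow> G'\<close> is exact; its pullback along an epimorphism
  \<open>P \<rightarrow> G'\<close> with kernel \<open>G'' \<in> \<G>\<close> is \<open>M \<oplus> P\<close>, which is an extension of \<open>Q\<close> by \<open>G''\<close>.
\<close>

section \<open>Morphisms in additive categories\<close>

text \<open>The category is not assumed to have enough projectives, so there is no derived functor
  machinery to appeal to. Two places would normally need \<open>Ext^2\<close>: that the right
  orthogonal class is closed under cokernels of its monomorphisms, and that an extension of a
  Gorenstein object by \<open>X\<close> lifts along a special precover of \<open>X\<close>. Both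
  obstructions lie in \<open>Ext^2(G, K)\<close> with \<open>G\<close> Gorenstein and
  \<open>K\<close> orthogonal to all Gorenstein objects. A projective presentation of
  \<open>G\<close> with Gorenstein kernel \<open>G'\<close> shifts this group to
  \<open>Ext^1(G', K) = 0\<close>, and the proofs carry out the shift by hand, as a chase of lifts.
  The coinductive view of Gorenstein objects avoids manipulating doubly infinite complexes: an
  infinitely iterated horseshoe becomes a single step on one side, and the other side is the same
  step in the opposite category.\<close>

context category
begin

lemma HomD [dest]:
  assumes "f \<in> Hom \<A> X Y"
  shows "f \<in> Mor \<A>" "Dom \<A> f = X" "Cod \<A> f = Y" "X \<in> Ob \<A>" "Y \<in> Ob \<A>"
  using assms Dom_Ob Cod_Ob by (auto simp: Hom_def)

lemma Dom_Cod_Ob [simp]: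
  "f \<in> Mor \<A> \<Longrightarrow> Dom \<A> f \<in> Ob \<A>" "f \<in> Mor \<A> \<Longrightarrow> Cod \<A> f \<in> Ob \<A>"
  using Dom_Ob Cod_Ob by auto

lemma Comp_simps [simp]:
  assumes "f \<in> Mor \<A>" "g \<in> Mor \<A>" "Dom \<A> g = Cod \<A> f"
  shows "g \<odot> f \<in> Mor \<A>" "Dom \<A> (g \<odot> f) = Dom \<A> f" "Cod \<A> (g \<odot> f) = Cod \<A> g"
  using assms Comp_Hom[of f "Dom \<A> f" "Cod \<A> f" g "Cod \<A> g"] by (auto simp: Hom_def)

lemma Id_simps [simp]:
  assumes "X \<in> Ob \<A>"
  shows "Id \<A> X \<in> Mor \<A>" "Dom \<A> (Id \<A> X) = X" "Cod \<A> (Id \<A> X) = X"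
  using Id_Hom[OF assms] by (auto simp: Hom_def)

lemma Comp_Id_simps [simp]:
  "f \<in> Mor \<A> \<Longrightarrow> Cod \<A> f = Y \<Longrightarrow> Id \<A> Y \<odot> f = f"
  "f \<in> Mor \<A> \<Longrightarrow> Dom \<A> f = X \<Longrightarrow> f \<odot> Id \<A> X = f"
  using Comp_Id_left Comp_Id_right by (auto simp: Hom_def)

lemma Comp_assoc_simp [simp]:
  "\<lbrakk>f \<in> Mor \<A>; g \<in> Mor \<A>; h \<in> Mor \<A>; Dom \<A> g = Cod \<A> f; Dom \<A> h = Cod \<A> g\<rbrakk>
   \<Longrightarrow> (h \<odot> g) \<odot> f = h \<odot> (g \<odot> f)"
  using Comp_assoc by (auto simp: Hom_def)

text \<open>Simplification nests composites to the right, which hides the redex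
  \<open>h \<odot> g\<close>; this form lets an equation about two morphisms be used at the head of
  a longer composite.\<close>

lemma Comp_reassoc:
  "\<lbrakk>h \<odot> g = k; f \<in> Mor \<A>; g \<in> Mor \<A>; h \<in> Mor \<A>; Cod \<A> f = Dom \<A> g; Dom \<A> h = Cod \<A> g\<rbrakk>
   \<Longrightarrow> h \<odot> (g \<odot> f) = k \<odot> f"
  by (metis Comp_assoc_simp)

lemma monicD:
  "\<lbrakk>monic \<A> f; f \<odot> g = f \<odot> h; g \<in> Mor \<A>; h \<in> Mor \<A>; Cod \<A> g = Dom \<A> f; Cod \<A> h = Dom \<A> f;
    Dom \<A> g = Dom \<A> h\<rbrakk> \<Longrightarrow> g = h"
  by (auto simp: monic_def Hom_def)

lemma epicD:
  "\<lbrakk>epic \<A> f; g \<odot> f = h \<odot> f; g \<in> Mor \<A>; h \<in> Mor \<A>; Dom \<A> g = Cod \<A> f; Dom \<A> h = Cod \<A> f;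
    Cod \<A> g = Cod \<A> h\<rbrakk> \<Longrightarrow> g = h"
  by (auto simp: epic_def Hom_def)

lemma monic_Comp:
  assumes "monic \<A> f" "monic \<A> g" "Dom \<A> g = Cod \<A> f"
  shows "monic \<A> (g \<odot> f)"
proof -
  have t: "f \<in> Mor \<A>" "g \<in> Mor \<A>" using assms by (auto simp: monic_def)
  show ?thesis unfolding monic_def
  proof (intro conjI allI ballI impI)
    fix W x y assume x: "x \<in> Hom \<A> W (Dom \<A> (g \<odot> f))" "y \<in> Hom \<A> W (Dom \<A> (g \<odot> f))"
      and e: "(g \<odot> f) \<odot> x = (g \<odot> f) \<odot> y"
    have t': "x \<in> Mor \<A>" "y \<in> Mor \<A>" "Dom \<A> x = W" "Dom \<A> y = W" "Cod \<A> x = Dom \<A> f" "Cod \<A> y = Dom \<A> f"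
      using x t assms(3) by (auto simp: Hom_def)
    have "f \<odot> x = f \<odot> y"
      by (rule monicD[OF assms(2)]) (use e t t' assms(3) in auto)
    then show "x = y" by (rule monicD[OF assms(1)]) (use t' in auto)
  qed (use t assms(3) in auto)
qed

end

text \<open>The record offers addition but no negation, so the inverse is taken in the Hom group of
  \<open>g\<close>; the value is meaningful for parallel \<open>f\<close> and
  \<open>g\<close>.\<close>

definition (in preadditive_category) Sub :: "'b \<Rightarrow> 'b \<Rightarrow> 'b" where
  "Sub f g = f \<boxplus> m_inv (hom_group \<A> (Dom \<A> g) (Cod \<A> g)) g"

context preadditive_category
begin

lemma Zero_simps [simp]:
  assumes "X \<in> Ob \<A>" "Y \<in> Ob \<A>"
  shows "Zero \<A> X Y \<in> Mor \<A>" "Dom \<A> (Zero \<A> X Y) = X" "Cod \<A> (Zero \<A> X Y) = Y"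
proof -
  interpret comm_group "hom_group \<A> X Y" using hom_comm_group[OF assms] .
  have "Zero \<A> X Y \<in> Hom \<A> X Y" using one_closed by (simp add: hom_group_def)
  then show "Zero \<A> X Y \<in> Mor \<A>" "Dom \<A> (Zero \<A> X Y) = X" "Cod \<A> (Zero \<A> X Y) = Y"
    by (auto simp: Hom_def)
qed

lemma Add_simps [simp]:
  assumes "f \<in> Mor \<A>" "g \<in> Mor \<A>" "Dom \<A> g = Dom \<A> f" "Cod \<A> g = Cod \<A> f"
  shows "f \<boxplus> g \<in> Mor \<A>" "Dom \<A> (f \<boxplus> g) = Dom \<A> f" "Cod \<A> (f \<boxplus> g) = Cod \<A> f"
proof -
  interpret comm_group "hom_group \<A> (Dom \<A> f) (Cod \<A> f)" using hom_comm_group assms by simp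
  have "f \<boxplus> g \<in> Hom \<A> (Dom \<A> f) (Cod \<A> f)"
    using m_closed[of f g] assms by (simp add: hom_group_def Hom_def)
  then show "f \<boxplus> g \<in> Mor \<A>" "Dom \<A> (f \<boxplus> g) = Dom \<A> f" "Cod \<A> (f \<boxplus> g) = Cod \<A> f"
    by (auto simp: Hom_def)
qed

lemma Add_left_cancel:
  assumes "f \<boxplus> g = f \<boxplus> h" "f \<in> Mor \<A>" "g \<in> Mor \<A>" "h \<in> Mor \<A>"
    "Dom \<A> g = Dom \<A> f" "Cod \<A> g = Cod \<A> f" "Dom \<A> h = Dom \<A> f" "Cod \<A> h = Cod \<A> f"
  shows "g = h"
proof -
  interpret comm_group "hom_group \<A> (Dom \<A> f) (Cod \<A> f)" using hom_comm_group assms by simp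
  show ?thesis using Units_l_cancel[unfolded Units_eq, of f g h] assms by (simp add: hom_group_def Hom_def)
qed

lemma Add_Zero [simp]:
  assumes "f \<in> Mor \<A>" "Dom \<A> f = X" "Cod \<A> f = Y"
  shows "f \<boxplus> Zero \<A> X Y = f" "Zero \<A> X Y \<boxplus> f = f"
proof -
  interpret comm_group "hom_group \<A> X Y" using hom_comm_group assms by auto
  show "f \<boxplus> Zero \<A> X Y = f" "Zero \<A> X Y \<boxplus> f = f"
    using l_one[of f] r_one[of f] assms by (simp_all add: hom_group_def Hom_def)
qed

lemma Add_commute:
  assumes "f \<in> Mor \<A>" "g \<in> Mor \<A>" "Dom \<A> g = Dom \<A> f" "Cod \<A> g = Cod \<A> f"
  shows "f \<boxplus> g = g \<boxplus> f"
proof -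
  interpret comm_group "hom_group \<A> (Dom \<A> f) (Cod \<A> f)" using hom_comm_group assms by auto
  show ?thesis using m_comm[of f g] assms by (simp_all add: hom_group_def Hom_def)
qed

lemma Comp_Add [simp]:
  "\<lbrakk>f \<in> Mor \<A>; g \<in> Mor \<A>; h \<in> Mor \<A>; Dom \<A> g = Cod \<A> f; Dom \<A> h = Cod \<A> f; Cod \<A> g = Cod \<A> h\<rbrakk>
    \<Longrightarrow> (g \<boxplus> h) \<odot> f = (g \<odot> f) \<boxplus> (h \<odot> f)"
  "\<lbrakk>f \<in> Mor \<A>; g \<in> Mor \<A>; h \<in> Mor \<A>; Cod \<A> f = Dom \<A> h; Cod \<A> g = Dom \<A> h; Dom \<A> f = Dom \<A> g\<rbrakk>
    \<Longrightarrow> h \<odot> (f \<boxplus> g) = (h \<odot> f) \<boxplus> (h \<odot> g)"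
  by (intro Comp_Add_left Comp_Add_right; simp add: Hom_def)+

text \<open>A consequence of bilinearity: \<open>z = z \<boxplus> z\<close> makes the composite an
  idempotent of a group, hence zero.\<close>

lemma Comp_Zero [simp]:
  assumes "f \<in> Mor \<A>" "X \<in> Ob \<A>"
  shows "Dom \<A> f = Y \<Longrightarrow> f \<odot> Zero \<A> X Y = Zero \<A> X (Cod \<A> f)"
    and "Cod \<A> f = Y \<Longrightarrow> Zero \<A> Y X \<odot> f = Zero \<A> (Dom \<A> f) X"
proof -
  assume Y: "Dom \<A> f = Y"
  let ?z = "Zero \<A> X Y"
  have Yo: "Y \<in> Ob \<A>" using Y assms by auto
  have "?z \<boxplus> ?z = ?z" using Yo assms by simp
  moreover have "f \<odot> (?z \<boxplus> ?z) = (f \<odot> ?z) \<boxplus> (f \<odot> ?z)"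
    by (rule Comp_Add(2)) (use Y Yo assms in auto)
  ultimately have "(f \<odot> ?z) \<boxplus> (f \<odot> ?z) = f \<odot> ?z" by simp
  then show "f \<odot> ?z = Zero \<A> X (Cod \<A> f)"
    by (intro Add_left_cancel[of "f \<odot> ?z" "f \<odot> ?z" "Zero \<A> X (Cod \<A> f)"]) (use Y Yo assms in auto)
next
  assume Y: "Cod \<A> f = Y"
  let ?z = "Zero \<A> Y X"
  have Yo: "Y \<in> Ob \<A>" using Y assms by auto
  have "?z \<boxplus> ?z = ?z" using Yo assms by simp
  moreover have "(?z \<boxplus> ?z) \<odot> f = (?z \<odot> f) \<boxplus> (?z \<odot> f)"
    by (rule Comp_Add(1)) (use Y Yo assms in auto)
  ultimately have "(?z \<odot> f) \<boxplus> (?z \<odot> f) = ?z \<odot> f" by simp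
  then show "?z \<odot> f = Zero \<A> (Dom \<A> f) X"
    by (intro Add_left_cancel[of "?z \<odot> f" "?z \<odot> f" "Zero \<A> (Dom \<A> f) X"]) (use Y Yo assms in auto)
qed

lemma
  assumes "f \<in> Mor \<A>" "g \<in> Mor \<A>" "Dom \<A> g = Dom \<A> f" "Cod \<A> g = Cod \<A> f"
  shows Sub_simps [simp]:
      "Sub f g \<in> Mor \<A>" "Dom \<A> (Sub f g) = Dom \<A> f" "Cod \<A> (Sub f g) = Cod \<A> f"
    and Add_Sub [simp]: "g \<boxplus> Sub f g = f"
proof -
  let ?G = "hom_group \<A> (Dom \<A> f) (Cod \<A> f)"
  interpret comm_group ?G using hom_comm_group assms by auto
  have c: "carrier ?G = Hom \<A> (Dom \<A> f) (Cod \<A> f)" and m: "mult ?G = Add \<A>"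
    by (simp_all add: hom_group_def)
  have e: "Sub f g = f \<otimes>\<^bsub>?G\<^esub> inv\<^bsub>?G\<^esub> g" using assms by (simp add: Sub_def m)
  have fg: "f \<in> carrier ?G" "g \<in> carrier ?G" using assms c by (auto simp: Hom_def)
  then have "Sub f g \<in> carrier ?G" by (simp add: e)
  then show "Sub f g \<in> Mor \<A>" "Dom \<A> (Sub f g) = Dom \<A> f" "Cod \<A> (Sub f g) = Cod \<A> f"
    unfolding c by (auto simp: Hom_def)
  have "g \<otimes>\<^bsub>?G\<^esub> (f \<otimes>\<^bsub>?G\<^esub> inv\<^bsub>?G\<^esub> g) = f"
    using fg by (simp add: m_lcomm[of g f])
  then show "g \<boxplus> Sub f g = f" using e m by metis
qed

lemma Sub_unique:
  assumes "g \<boxplus> h = f" "g \<in> Mor \<A>" "h \<in> Mor \<A>" "Dom \<A> h = Dom \<A> g" "Cod \<A> h = Cod \<A> g"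
  shows "Sub f g = h"
  by (rule Add_left_cancel[of g]) (use assms in \<open>auto\<close>)

lemma Sub_Zero [simp]:
  assumes "f \<in> Mor \<A>" "Dom \<A> f = X" "Cod \<A> f = Y"
  shows "Sub f (Zero \<A> X Y) = f"
  by (rule Sub_unique) (use assms in auto)

lemma Sub_eq_Zero_iff [simp]:
  assumes "f \<in> Mor \<A>" "g \<in> Mor \<A>" "Dom \<A> g = Dom \<A> f" "Cod \<A> g = Cod \<A> f"
    "Dom \<A> f = X" "Cod \<A> f = Y"
  shows "Sub f g = Zero \<A> X Y \<longleftrightarrow> f = g"
proof
  assume "Sub f g = Zero \<A> X Y"
  then have "g \<boxplus> Zero \<A> X Y = f" using Add_Sub[of f g] assms by simp
  then show "f = g" using assms by simp
next
  assume "f = g"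
  then show "Sub f g = Zero \<A> X Y" by (intro Sub_unique) (use assms in auto)
qed

lemma Comp_Sub [simp]:
  "\<lbrakk>f \<in> Mor \<A>; g \<in> Mor \<A>; h \<in> Mor \<A>; Dom \<A> g = Cod \<A> f; Dom \<A> h = Cod \<A> f; Cod \<A> h = Cod \<A> g\<rbrakk>
    \<Longrightarrow> Sub g h \<odot> f = Sub (g \<odot> f) (h \<odot> f)"
  "\<lbrakk>f \<in> Mor \<A>; g \<in> Mor \<A>; h \<in> Mor \<A>; Cod \<A> f = Dom \<A> h; Cod \<A> g = Dom \<A> h; Dom \<A> g = Dom \<A> f\<rbrakk>
    \<Longrightarrow> h \<odot> Sub f g = Sub (h \<odot> f) (h \<odot> g)"
proof -
  assume a: "f \<in> Mor \<A>" "g \<in> Mor \<A>" "h \<in> Mor \<A>" "Dom \<A> g = Cod \<A> f" "Dom \<A> h = Cod \<A> f" "Cod \<A> h = Cod \<A> g"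
  have "(h \<odot> f) \<boxplus> (Sub g h \<odot> f) = (h \<boxplus> Sub g h) \<odot> f"
    by (subst Comp_Add) (use a in auto)
  also have "\<dots> = g \<odot> f" using a by simp
  finally show "Sub g h \<odot> f = Sub (g \<odot> f) (h \<odot> f)"
    by (intro Sub_unique[symmetric]) (use a in auto)
next
  assume a: "f \<in> Mor \<A>" "g \<in> Mor \<A>" "h \<in> Mor \<A>" "Cod \<A> f = Dom \<A> h" "Cod \<A> g = Dom \<A> h" "Dom \<A> g = Dom \<A> f"
  have "(h \<odot> g) \<boxplus> (h \<odot> Sub f g) = h \<odot> (g \<boxplus> Sub f g)"
    by (subst Comp_Add) (use a in auto)
  also have "\<dots> = h \<odot> f" using a by simp
  finally show "h \<odot> Sub f g = Sub (h \<odot> f) (h \<odot> g)"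
    by (intro Sub_unique[symmetric]) (use a in auto)
qed

lemma monicI:
  assumes "f \<in> Mor \<A>"
    and "\<And>x. \<lbrakk>x \<in> Mor \<A>; Cod \<A> x = Dom \<A> f; f \<odot> x = Zero \<A> (Dom \<A> x) (Cod \<A> f)\<rbrakk>
      \<Longrightarrow> x = Zero \<A> (Dom \<A> x) (Dom \<A> f)"
  shows "monic \<A> f"
  unfolding monic_def
proof (intro conjI allI ballI impI assms(1))
  fix W g h assume gh: "g \<in> Hom \<A> W (Dom \<A> f)" "h \<in> Hom \<A> W (Dom \<A> f)" and e: "f \<odot> g = f \<odot> h"
  then have t: "g \<in> Mor \<A>" "h \<in> Mor \<A>" "Dom \<A> g = W" "Dom \<A> h = W" "Cod \<A> g = Dom \<A> f" "Cod \<A> h = Dom \<A> f"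
    by (auto simp: Hom_def)
  have "Sub g h = Zero \<A> W (Dom \<A> f)"
    using assms(2)[of "Sub g h"] assms(1) t e by simp
  then show "g = h" using t by simp
qed

lemma epicI:
  assumes "f \<in> Mor \<A>"
    and "\<And>x. \<lbrakk>x \<in> Mor \<A>; Dom \<A> x = Cod \<A> f; x \<odot> f = Zero \<A> (Dom \<A> f) (Cod \<A> x)\<rbrakk>
      \<Longrightarrow> x = Zero \<A> (Cod \<A> f) (Cod \<A> x)"
  shows "epic \<A> f"
  unfolding epic_def
proof (intro conjI allI ballI impI assms(1))
  fix W g h assume gh: "g \<in> Hom \<A> (Cod \<A> f) W" "h \<in> Hom \<A> (Cod \<A> f) W" and e: "g \<odot> f = h \<odot> f"
  then have t: "g \<in> Mor \<A>" "h \<in> Mor \<A>" "Cod \<A> g = W" "Cod \<A> h = W" "Dom \<A> g = Cod \<A> f" "Dom \<A> h = Cod \<A> f"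
    by (auto simp: Hom_def)
  have "Sub g h = Zero \<A> (Cod \<A> f) W"
    using assms(2)[of "Sub g h"] assms(1) t e by simp
  then show "g = h" using t by simp
qed

lemma monic_Zero:
  assumes "monic \<A> f" "f \<odot> x = Zero \<A> X Y" "x \<in> Mor \<A>" "Cod \<A> x = Dom \<A> f" "Dom \<A> x = X" "Cod \<A> f = Y"
  shows "x = Zero \<A> X (Dom \<A> f)"
  by (rule monicD[OF assms(1)]) (use assms in \<open>auto simp: monic_def\<close>)

lemma epic_Zero:
  assumes "epic \<A> f" "x \<odot> f = Zero \<A> X Y" "x \<in> Mor \<A>" "Dom \<A> x = Cod \<A> f" "Cod \<A> x = Y" "Dom \<A> f = X"
  shows "x = Zero \<A> (Cod \<A> f) Y"
  by (rule epicD[OF assms(1)]) (use assms in \<open>auto simp: epic_def\<close>)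

text \<open>Only the last two equations, the vanishing cross terms, have to be derived. Composing
  the decomposition of the identity with \<open>i\<close> leaves
  \<open>j \<odot> (q \<odot> i)\<close> equal to zero, and \<open>q\<close> cancels
  \<open>j\<close>; the other term is symmetric.\<close>

lemma is_biproductD:
  assumes "is_biproduct \<A> X Y S i j p q"
  shows "i \<in> Mor \<A>" "Dom \<A> i = X" "Cod \<A> i = S" "j \<in> Mor \<A>" "Dom \<A> j = Y" "Cod \<A> j = S"
    "p \<in> Mor \<A>" "Dom \<A> p = S" "Cod \<A> p = X" "q \<in> Mor \<A>" "Dom \<A> q = S" "Cod \<A> q = Y"
    "X \<in> Ob \<A>" "Y \<in> Ob \<A>" "S \<in> Ob \<A>"
    "p \<odot> i = Id \<A> X" "q \<odot> j = Id \<A> Y" "(i \<odot> p) \<boxplus> (j \<odot> q) = Id \<A> S"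
    "q \<odot> i = Zero \<A> X Y" "p \<odot> j = Zero \<A> Y X"
proof -
  show t: "i \<in> Mor \<A>" "Dom \<A> i = X" "Cod \<A> i = S" "j \<in> Mor \<A>" "Dom \<A> j = Y" "Cod \<A> j = S"
    "p \<in> Mor \<A>" "Dom \<A> p = S" "Cod \<A> p = X" "q \<in> Mor \<A>" "Dom \<A> q = S" "Cod \<A> q = Y"
    "X \<in> Ob \<A>" "Y \<in> Ob \<A>" "S \<in> Ob \<A>"
    and e: "p \<odot> i = Id \<A> X" "q \<odot> j = Id \<A> Y" "(i \<odot> p) \<boxplus> (j \<odot> q) = Id \<A> S"
    using assms by (auto simp: is_biproduct_def dest: HomD)
  note r = e(1,2)[THEN Comp_reassoc]
  have "(i \<odot> (p \<odot> i)) \<boxplus> (j \<odot> (q \<odot> i)) = ((i \<odot> p) \<boxplus> (j \<odot> q)) \<odot> i"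
    by (subst Comp_Add) (use t in auto)
  then have *: "i \<boxplus> (j \<odot> (q \<odot> i)) = i" using t e by simp
  have "j \<odot> (q \<odot> i) = Zero \<A> X S"
    by (rule Add_left_cancel[of i]) (use t * in auto)
  then have "q \<odot> (j \<odot> (q \<odot> i)) = Zero \<A> X Y" using t by simp
  then show "q \<odot> i = Zero \<A> X Y" using t r by simp
  have "(i \<odot> (p \<odot> j)) \<boxplus> (j \<odot> (q \<odot> j)) = ((i \<odot> p) \<boxplus> (j \<odot> q)) \<odot> j"
    by (subst Comp_Add) (use t in auto)
  then have *: "j \<boxplus> (i \<odot> (p \<odot> j)) = j" using t e by (simp add: Add_commute)
  have "i \<odot> (p \<odot> j) = Zero \<A> Y S"
    by (rule Add_left_cancel[of j]) (use t * in auto)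
  then have "p \<odot> (i \<odot> (p \<odot> j)) = Zero \<A> Y X" using t by simp
  then show "p \<odot> j = Zero \<A> Y X" using t r by simp
qed

lemma is_biproduct_expand:
  assumes B: "is_biproduct \<A> X Y S i j p q" and c: "c \<in> Mor \<A>"
  shows "Cod \<A> c = S \<Longrightarrow> (i \<odot> (p \<odot> c)) \<boxplus> (j \<odot> (q \<odot> c)) = c"
    and "Dom \<A> c = S \<Longrightarrow> (c \<odot> (i \<odot> p)) \<boxplus> (c \<odot> (j \<odot> q)) = c"
proof -
  note b = is_biproductD[OF B]
  assume "Cod \<A> c = S"
  then have "(i \<odot> (p \<odot> c)) \<boxplus> (j \<odot> (q \<odot> c)) = ((i \<odot> p) \<boxplus> (j \<odot> q)) \<odot> c"
    by (subst Comp_Add) (use b c in auto)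
  then show "(i \<odot> (p \<odot> c)) \<boxplus> (j \<odot> (q \<odot> c)) = c" using b(18) c \<open>Cod \<A> c = S\<close> by simp
next
  note b = is_biproductD[OF B]
  assume "Dom \<A> c = S"
  then have "(c \<odot> (i \<odot> p)) \<boxplus> (c \<odot> (j \<odot> q)) = c \<odot> ((i \<odot> p) \<boxplus> (j \<odot> q))"
    by (subst Comp_Add) (use b c in auto)
  then show "(c \<odot> (i \<odot> p)) \<boxplus> (c \<odot> (j \<odot> q)) = c" using b(18) c \<open>Dom \<A> c = S\<close> by simp
qed

end

section \<open>Duality\<close>

text \<open>A record update keeps the type and the extension fields, so results about \<A> can be
  instantiated at the opposite category, and \<open>opp\<close> is strictly involutive. The
  arguments of \<open>Zero\<close> are exchanged because its first one is the source.\<close>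

definition opp :: "('o, 'm, 'z) preadd_scheme \<Rightarrow> ('o, 'm, 'z) preadd_scheme" where
  "opp \<A> = \<A>\<lparr>Dom := Cod \<A>, Cod := Dom \<A>, Comp := (\<lambda>g f. f \<odot>\<^bsub>\<A>\<^esub> g), Zero := (\<lambda>X Y. Zero \<A> Y X)\<rparr>"

lemma opp_simps [simp]:
  "Ob (opp \<A>) = Ob \<A>" "Mor (opp \<A>) = Mor \<A>" "Dom (opp \<A>) = Cod \<A>" "Cod (opp \<A>) = Dom \<A>"
  "Id (opp \<A>) = Id \<A>" "g \<odot>\<^bsub>opp \<A>\<^esub> f = f \<odot>\<^bsub>\<A>\<^esub> g" "Add (opp \<A>) = Add \<A>"
  "Zero (opp \<A>) X Y = Zero \<A> Y X"
  by (simp_all add: opp_def)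

lemma Hom_opp [simp]: "Hom (opp \<A>) X Y = Hom \<A> Y X"
  by (auto simp: Hom_def)

lemma monic_opp [simp]: "monic (opp \<A>) f = epic \<A> f"
  and epic_opp [simp]: "epic (opp \<A>) f = monic \<A> f"
  by (simp_all add: monic_def epic_def)

lemma is_kernel_opp [simp]: "is_kernel (opp \<A>) k f = is_cokernel \<A> k f"
  and is_cokernel_opp [simp]: "is_cokernel (opp \<A>) k f = is_kernel \<A> k f"
  by (auto simp: is_kernel_def is_cokernel_def)

lemma is_zero_object_opp [simp]: "is_zero_object (opp \<A>) Z = is_zero_object \<A> Z"
  by (auto simp: is_zero_object_def)

lemma is_biproduct_opp [simp]: "is_biproduct (opp \<A>) X Y S i j p q = is_biproduct \<A> X Y S p q i j"
  by (auto simp: is_biproduct_def)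

lemma is_direct_sum_opp [simp]: "is_direct_sum (opp \<A>) X Y S = is_direct_sum \<A> X Y S"
  by (auto simp: is_direct_sum_def)

lemma isomorphic_opp [simp]: "isomorphic (opp \<A>) X Y = isomorphic \<A> X Y"
  by (auto simp: isomorphic_def)

lemma subcategory_opp [simp]: "subcategory (opp \<A>) \<X> = subcategory \<A> \<X>"
  by (simp add: subcategory_def)

lemma (in abelian_category) abelian_opp: "abelian_category (opp \<A>)"
proof (intro abelian_category.intro preadditive_category.intro category.intro
    abelian_category_axioms.intro preadditive_category_axioms.intro)
  fix X Y assume "X \<in> Ob (opp \<A>)" "Y \<in> Ob (opp \<A>)"
  moreover have "hom_group (opp \<A>) X Y = hom_group \<A> Y X" by (simp add: hom_group_def)
  ultimately show "comm_group (hom_group (opp \<A>) X Y)" using hom_comm_group by simp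
qed (use Id_Hom Comp_Hom Comp_assoc Comp_Id_left Comp_Id_right ex_zero_object ex_direct_sum ex_kernel
   ex_cokernel monic_normal epic_normal in \<open>simp_all add: Comp_Add_left Comp_Add_right\<close>)

section \<open>Exact sequences\<close>

context abelian_category
begin

lemma epic_Comp:
  assumes "epic \<A> f" "epic \<A> g" "Dom \<A> g = Cod \<A> f"
  shows "epic \<A> (g \<odot> f)"
  using category.monic_Comp[OF preadditive_category.axioms(1)[OF abelian_category.axioms(1)[OF abelian_opp]],
      of g f] assms by simp

lemma is_kernelD:
  assumes "is_kernel \<A> k f"
  shows "k \<in> Mor \<A>" "f \<in> Mor \<A>" "Cod \<A> k = Dom \<A> f" "f \<odot> k = Zero \<A> (Dom \<A> k) (Cod \<A> f)" "monic \<A> k"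
    and "\<lbrakk>h \<in> Mor \<A>; Cod \<A> h = Dom \<A> f; f \<odot> h = Zero \<A> (Dom \<A> h) (Cod \<A> f)\<rbrakk>
      \<Longrightarrow> \<exists>u. u \<in> Mor \<A> \<and> Dom \<A> u = Dom \<A> h \<and> Cod \<A> u = Dom \<A> k \<and> k \<odot> u = h"
proof -
  show t: "k \<in> Mor \<A>" "f \<in> Mor \<A>" "Cod \<A> k = Dom \<A> f" "f \<odot> k = Zero \<A> (Dom \<A> k) (Cod \<A> f)"
    using assms by (auto simp: is_kernel_def)
  have ex1: "\<And>W h. h \<in> Hom \<A> W (Dom \<A> f) \<Longrightarrow> f \<odot> h = Zero \<A> W (Cod \<A> f) \<Longrightarrow>
     \<exists>!u. u \<in> Hom \<A> W (Dom \<A> k) \<and> k \<odot> u = h"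
    using assms by (auto simp: is_kernel_def)
  show "\<lbrakk>h \<in> Mor \<A>; Cod \<A> h = Dom \<A> f; f \<odot> h = Zero \<A> (Dom \<A> h) (Cod \<A> f)\<rbrakk>
      \<Longrightarrow> \<exists>u. u \<in> Mor \<A> \<and> Dom \<A> u = Dom \<A> h \<and> Cod \<A> u = Dom \<A> k \<and> k \<odot> u = h"
    using ex1[of h "Dom \<A> h"] by (auto simp: Hom_def)
  show "monic \<A> k" unfolding monic_def
  proof (intro conjI allI ballI impI t(1))
    fix W g h assume gh: "g \<in> Hom \<A> W (Dom \<A> k)" "h \<in> Hom \<A> W (Dom \<A> k)" and e: "k \<odot> g = k \<odot> h"
    then have g: "g \<in> Mor \<A>" "Dom \<A> g = W" "Cod \<A> g = Dom \<A> k" "W \<in> Ob \<A>" by auto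
    have "f \<odot> (k \<odot> g) = Zero \<A> W (Cod \<A> f)" using t g by (simp add: Comp_reassoc[OF t(4)])
    then show "g = h" using ex1[of "k \<odot> g" W] gh e t g by (auto simp: Hom_def)
  qed
qed

lemma is_kernelI:
  assumes "monic \<A> k" "f \<in> Mor \<A>" "Cod \<A> k = Dom \<A> f" "f \<odot> k = Zero \<A> (Dom \<A> k) (Cod \<A> f)"
    and "\<And>h. \<lbrakk>h \<in> Mor \<A>; Cod \<A> h = Dom \<A> f; f \<odot> h = Zero \<A> (Dom \<A> h) (Cod \<A> f)\<rbrakk>
      \<Longrightarrow> \<exists>u. u \<in> Mor \<A> \<and> Dom \<A> u = Dom \<A> h \<and> Cod \<A> u = Dom \<A> k \<and> k \<odot> u = h"
  shows "is_kernel \<A> k f"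
  unfolding is_kernel_def
proof (intro conjI allI ballI impI)
  fix W h assume "h \<in> Hom \<A> W (Dom \<A> f)" "f \<odot> h = Zero \<A> W (Cod \<A> f)"
  then obtain u where u: "u \<in> Mor \<A>" "Dom \<A> u = W" "Cod \<A> u = Dom \<A> k" "k \<odot> u = h"
    using assms(5)[of h] by (auto simp: Hom_def)
  show "\<exists>!u. u \<in> Hom \<A> W (Dom \<A> k) \<and> k \<odot> u = h"
    using u assms(1) by (intro ex1I[of _ u]) (auto simp: Hom_def intro: monicD)
qed (use assms in \<open>auto simp: monic_def\<close>)

lemma is_kernel_unique:
  assumes "is_kernel \<A> k f" "is_kernel \<A> l f"
  shows "\<exists>u. u \<in> Mor \<A> \<and> Dom \<A> u = Dom \<A> k \<and> Cod \<A> u = Dom \<A> l \<and> l \<odot> u = k"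
  using is_kernelD(6)[OF assms(2), of k] is_kernelD[OF assms(1)] by auto

text \<open>Two kernels of the same \<open>f\<close> factor through each other. This moves the
  kernel property to a chosen representative, as \<open>exact_at\<close> provides only some
  monomorphism that is both an image and a kernel.\<close>

lemma is_kernel_transfer:
  assumes "is_kernel \<A> k f" "is_kernel \<A> l f" "is_kernel \<A> l g"
  shows "is_kernel \<A> k g"
proof -
  note k = is_kernelD[OF assms(1)] and l = is_kernelD[OF assms(2)] and l' = is_kernelD[OF assms(3)]
  obtain u where u: "u \<in> Mor \<A>" "Dom \<A> u = Dom \<A> k" "Cod \<A> u = Dom \<A> l" "l \<odot> u = k"
    using is_kernel_unique assms by blast
  obtain v where v: "v \<in> Mor \<A>" "Dom \<A> v = Dom \<A> l" "Cod \<A> v = Dom \<A> k" "k \<odot> v = l"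
    using is_kernel_unique assms by blast
  show ?thesis
  proof (rule is_kernelI)
    have "g \<odot> (l \<odot> u) = Zero \<A> (Dom \<A> k) (Cod \<A> g)"
      by (subst Comp_reassoc[OF l'(4)]) (use u l'(1-3) in auto)
    then show "g \<odot> k = Zero \<A> (Dom \<A> k) (Cod \<A> g)" using u by simp
    fix h assume h: "h \<in> Mor \<A>" "Cod \<A> h = Dom \<A> g" "g \<odot> h = Zero \<A> (Dom \<A> h) (Cod \<A> g)"
    then obtain w where "w \<in> Mor \<A>" "Dom \<A> w = Dom \<A> h" "Cod \<A> w = Dom \<A> l" "l \<odot> w = h"
      using l'(6) by blast
    then show "\<exists>w. w \<in> Mor \<A> \<and> Dom \<A> w = Dom \<A> h \<and> Cod \<A> w = Dom \<A> k \<and> k \<odot> w = h"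
      using v k(1) by (intro exI[of _ "v \<odot> w"]) (simp add: Comp_reassoc[OF v(4)])
  qed (use k l l' in auto)
qed

text \<open>By normality \<open>f\<close> is the kernel of some \<open>g\<close>, and
  \<open>g\<close> factors through the cokernel \<open>c\<close>; whatever \<open>c\<close> kills is
  therefore killed by \<open>g\<close> and factors through \<open>f\<close>.\<close>

lemma monic_is_kernel:
  assumes "monic \<A> f" "is_cokernel \<A> c f"
  shows "is_kernel \<A> f c"
proof -
  obtain g where g: "is_kernel \<A> f g" using monic_normal[OF assms(1)] by blast
  note k = is_kernelD[OF g]
  note c = abelian_category.is_kernelD[OF abelian_opp, of c f, simplified, OF assms(2)]
  obtain u where u: "u \<in> Mor \<A>" "Cod \<A> u = Cod \<A> g" "Dom \<A> u = Cod \<A> c" "u \<odot> c = g"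
    using c(6)[of g] k by auto
  show ?thesis
  proof (rule is_kernelI)
    fix h assume h: "h \<in> Mor \<A>" "Cod \<A> h = Dom \<A> c" "c \<odot> h = Zero \<A> (Dom \<A> h) (Cod \<A> c)"
    have "g \<odot> h = u \<odot> (c \<odot> h)" using u c(1) h by (metis Comp_reassoc)
    then have "g \<odot> h = Zero \<A> (Dom \<A> h) (Cod \<A> g)" using u h by simp
    then show "\<exists>u. u \<in> Mor \<A> \<and> Dom \<A> u = Dom \<A> h \<and> Cod \<A> u = Dom \<A> f \<and> f \<odot> u = h"
      using k(3) c(3) h by (intro k(6)) auto
  qed (use assms c in auto)
qed

text \<open>Replaces the existential over images by a kernel-cokernel pair, which is visibly
  self-dual; this is what makes short exactness pass to \<open>opp\<close>.\<close>

lemma short_exact_iff: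
  "short_exact \<A> X f Y g Z \<longleftrightarrow>
     f \<in> Hom \<A> X Y \<and> g \<in> Hom \<A> Y Z \<and> is_kernel \<A> f g \<and> is_cokernel \<A> g f"
proof
  assume s: "short_exact \<A> X f Y g Z"
  then obtain m c where m: "is_cokernel \<A> c f" "is_kernel \<A> m c" "is_kernel \<A> m g"
    by (auto simp: short_exact_def exact_at_def is_image_def)
  have t: "monic \<A> f" "epic \<A> g" using s by (simp_all add: short_exact_def)
  have "is_kernel \<A> f g"
    using is_kernel_transfer[OF monic_is_kernel[OF t(1) m(1)] m(2,3)] .
  moreover from this have "is_cokernel \<A> g f"
    using t(2) abelian_category.monic_is_kernel[OF abelian_opp, of g f] by simp
  ultimately show "f \<in> Hom \<A> X Y \<and> g \<in> Hom \<A> Y Z \<and> is_kernel \<A> f g \<and> is_cokernel \<A> g f"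
    using s by (simp add: short_exact_def)
next
  assume s: "f \<in> Hom \<A> X Y \<and> g \<in> Hom \<A> Y Z \<and> is_kernel \<A> f g \<and> is_cokernel \<A> g f"
  then have "monic \<A> f" "epic \<A> g" "f \<in> Mor \<A>" "g \<in> Mor \<A>" "Cod \<A> f = Dom \<A> g"
    using is_kernelD(1-3,5)[of f g] abelian_category.is_kernelD(5)[OF abelian_opp, of g f] by auto
  with s show "short_exact \<A> X f Y g Z"
    unfolding short_exact_def exact_at_def is_image_def by blast
qed

lemma short_exact_opp [simp]: "short_exact (opp \<A>) Z g Y f X = short_exact \<A> X f Y g Z"
  unfolding short_exact_iff abelian_category.short_exact_iff[OF abelian_opp] by simp blast

lemma short_exactI:
  assumes "is_kernel \<A> f g" "epic \<A> g"
  shows "short_exact \<A> (Dom \<A> f) f (Dom \<A> g) g (Cod \<A> g)"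
  using abelian_category.monic_is_kernel[OF abelian_opp, of g f] assms is_kernelD(1-3)[OF assms(1)]
  unfolding short_exact_iff by (simp add: Hom_def)

lemma short_exactD:
  assumes "short_exact \<A> X f Y g Z"
  shows "f \<in> Mor \<A>" "Dom \<A> f = X" "Cod \<A> f = Y" "g \<in> Mor \<A>" "Dom \<A> g = Y" "Cod \<A> g = Z"
    "X \<in> Ob \<A>" "Y \<in> Ob \<A>" "Z \<in> Ob \<A>" "g \<odot> f = Zero \<A> X Z"
    "monic \<A> f" "epic \<A> g" "is_kernel \<A> f g" "is_cokernel \<A> g f"
proof -
  show *: "is_kernel \<A> f g" "is_cokernel \<A> g f" using assms by (auto simp: short_exact_iff)
  show t: "f \<in> Mor \<A>" "Dom \<A> f = X" "Cod \<A> f = Y" "g \<in> Mor \<A>" "Dom \<A> g = Y" "Cod \<A> g = Z"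
    "monic \<A> f" "epic \<A> g"
    using assms by (simp_all add: short_exact_def Hom_def)
  show "X \<in> Ob \<A>" "Y \<in> Ob \<A>" "Z \<in> Ob \<A>" "g \<odot> f = Zero \<A> X Z"
    using t is_kernelD(4)[OF *(1)] by auto
qed

section \<open>Pullbacks and pushouts of short exact sequences\<close>

lemma short_exact_lift:
  assumes "short_exact \<A> X f Y g Z" "h \<in> Mor \<A>" "Dom \<A> h = W" "Cod \<A> h = Y" "g \<odot> h = Zero \<A> W Z"
  obtains u where "u \<in> Mor \<A>" "Dom \<A> u = W" "Cod \<A> u = X" "f \<odot> u = h"
  using is_kernelD(6)[OF short_exactD(13)[OF assms(1)], of h] short_exactD[OF assms(1)] assms by auto

lemma short_exact_desc:
  assumes "short_exact \<A> X f Y g Z" "h \<in> Mor \<A>" "Dom \<A> h = Y" "Cod \<A> h = W" "h \<odot> f = Zero \<A> X W"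
  obtains u where "u \<in> Mor \<A>" "Dom \<A> u = Z" "Cod \<A> u = W" "u \<odot> g = h"
  using abelian_category.short_exact_lift[OF abelian_opp, of Z g Y f X h W] assms by auto

text \<open>The fibre product is the kernel of the difference \<open>D\<close> of
  \<open>g \<odot> p\<close> and \<open>h \<odot> q\<close> on \<open>Y \<oplus> W\<close>. Its
  universal property is part of the conclusion because later arguments need maps into it and
  equality tests on it.\<close>

lemma short_exact_pullback:
  assumes "short_exact \<A> X f Y g Z" "h \<in> Hom \<A> W Z"
  obtains f' Y' g' h' where "short_exact \<A> X f' Y' g' W" "h' \<in> Hom \<A> Y' Y"
    "g \<odot> h' = h \<odot> g'" "h' \<odot> f' = f"
    "\<And>a b T. \<lbrakk>a \<in> Hom \<A> T Y; b \<in> Hom \<A> T W; g \<odot> a = h \<odot> b\<rbrakk>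
      \<Longrightarrow> \<exists>u. u \<in> Hom \<A> T Y' \<and> h' \<odot> u = a \<and> g' \<odot> u = b"
    "\<And>u v T. \<lbrakk>u \<in> Hom \<A> T Y'; v \<in> Hom \<A> T Y'; h' \<odot> u = h' \<odot> v; g' \<odot> u = g' \<odot> v\<rbrakk> \<Longrightarrow> u = v"
proof -
  note s = short_exactD[OF assms(1)]
  note hh = HomD[OF assms(2)]
  obtain S i j p q where B: "is_biproduct \<A> Y W S i j p q"
    using ex_direct_sum[of Y W] s hh by (auto simp: is_direct_sum_def)
  note b = is_biproductD[OF B]
  note br = b(16,17,19,20)[THEN Comp_reassoc]
  define D where "D = Sub (g \<odot> p) (h \<odot> q)"
  have D: "D \<in> Mor \<A>" "Dom \<A> D = S" "Cod \<A> D = Z" using b s hh by (simp_all add: D_def)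
  have Dc: "D \<odot> c = Sub (g \<odot> (p \<odot> c)) (h \<odot> (q \<odot> c))" if "c \<in> Mor \<A>" "Cod \<A> c = S" for c
    unfolding D_def using that b s hh by simp
  have Di: "D \<odot> i = g" using Dc[of i] b s hh by simp
  have eD: "epic \<A> D"
  proof (rule epicI[OF D(1)])
    fix x assume x: "x \<in> Mor \<A>" "Dom \<A> x = Cod \<A> D" "x \<odot> D = Zero \<A> (Dom \<A> D) (Cod \<A> x)"
    have "x \<odot> (D \<odot> i) = Zero \<A> Y (Cod \<A> x)"
      by (subst Comp_reassoc[OF x(3)]) (use x D b in auto)
    then have "x = Zero \<A> Z (Cod \<A> x)"
      using epic_Zero[OF s(12), of x Y] x s D Di by auto
    then show "x = Zero \<A> (Cod \<A> D) (Cod \<A> x)" using D by simp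
  qed
  obtain k where k: "is_kernel \<A> k D" using ex_kernel D by blast
  define P where "P = Dom \<A> k"
  have sk: "short_exact \<A> P k S D Z" using short_exactI[OF k eD] D P_def by simp
  note t = short_exactD[OF sk]
  define h' where "h' = p \<odot> k"
  define g' where "g' = q \<odot> k"
  have h': "h' \<in> Mor \<A>" "Dom \<A> h' = P" "Cod \<A> h' = Y" using t b by (simp_all add: h'_def)
  have g': "g' \<in> Mor \<A>" "Dom \<A> g' = P" "Cod \<A> g' = W" using t b by (simp_all add: g'_def)
  have sq: "g \<odot> h' = h \<odot> g'"
  proof -
    have "Sub (g \<odot> h') (h \<odot> g') = Zero \<A> P Z" using Dc[of k] t by (simp add: h'_def g'_def)
    then show ?thesis using h' g' s hh by simp
  qed
  have jm: "u = v" if uv: "u \<in> Hom \<A> T P" "v \<in> Hom \<A> T P" "h' \<odot> u = h' \<odot> v" "g' \<odot> u = g' \<odot> v" for u v T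
  proof -
    have *: "k \<odot> w = (i \<odot> (h' \<odot> w)) \<boxplus> (j \<odot> (g' \<odot> w))" if "w \<in> Hom \<A> T P" for w
      using is_biproduct_expand(1)[OF B, of "k \<odot> w"] HomD[OF that] t b by (simp add: h'_def g'_def)
    have "k \<odot> u = k \<odot> v" using *[OF uv(1)] *[OF uv(2)] uv by simp
    then show ?thesis using monicD[OF t(11)] HomD[OF uv(1)] HomD[OF uv(2)] t by auto
  qed
  have up: "\<exists>u. u \<in> Hom \<A> T P \<and> h' \<odot> u = a \<and> g' \<odot> u = b"
    if ab: "a \<in> Hom \<A> T Y" "b \<in> Hom \<A> T W" "g \<odot> a = h \<odot> b" for a b T
  proof -
    note ab' = HomD[OF ab(1)] HomD[OF ab(2)]
    define c where "c = (i \<odot> a) \<boxplus> (j \<odot> b)"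
    have c: "c \<in> Mor \<A>" "Dom \<A> c = T" "Cod \<A> c = S" using b ab' by (simp_all add: c_def)
    have pc: "p \<odot> c = a" "q \<odot> c = b" unfolding c_def using b ab' br by simp_all
    have "D \<odot> c = Zero \<A> T Z" using Dc[OF c(1,3)] pc ab(3) ab' s hh by simp
    then obtain u where u: "u \<in> Mor \<A>" "Dom \<A> u = T" "Cod \<A> u = P" "k \<odot> u = c"
      using short_exact_lift[OF sk c] by metis
    then show ?thesis using pc t b by (intro exI[of _ u]) (auto simp: Hom_def h'_def g'_def)
  qed
  \<comment> \<open>The kernel of \<open>g\<close> sits in the fibre product with components
    \<open>f\<close> and zero.\<close>
  obtain f' where f': "f' \<in> Mor \<A>" "Dom \<A> f' = X" "Cod \<A> f' = P" "h' \<odot> f' = f" "g' \<odot> f' = Zero \<A> X W"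
    using up[of f X "Zero \<A> X W"] s hh by (auto simp: Hom_def)
  note r = f'(4,5)[THEN Comp_reassoc]
  have "monic \<A> f'"
  proof (rule monicI[OF f'(1)])
    fix x assume x: "x \<in> Mor \<A>" "Cod \<A> x = Dom \<A> f'" "f' \<odot> x = Zero \<A> (Dom \<A> x) (Cod \<A> f')"
    have "f \<odot> x = h' \<odot> (f' \<odot> x)"
      by (rule Comp_reassoc[OF f'(4), symmetric]) (use x f' h' in auto)
    also have "\<dots> = Zero \<A> (Dom \<A> x) Y" using x f' h' by simp
    finally have "f \<odot> x = Zero \<A> (Dom \<A> x) Y" .
    then show "x = Zero \<A> (Dom \<A> x) (Dom \<A> f')"
      using monic_Zero[OF s(11), of x] x f' s by simp
  qed
  moreover have "\<exists>y. y \<in> Mor \<A> \<and> Dom \<A> y = Dom \<A> u \<and> Cod \<A> y = Dom \<A> f' \<and> f' \<odot> y = u"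
    if u: "u \<in> Mor \<A>" "Cod \<A> u = P" "g' \<odot> u = Zero \<A> (Dom \<A> u) W" for u
  proof -
    have "g \<odot> (h' \<odot> u) = h \<odot> (g' \<odot> u)"
      by (subst Comp_reassoc[OF sq]) (use u s hh h' g' in auto)
    then have "g \<odot> (h' \<odot> u) = Zero \<A> (Dom \<A> u) Z" using u hh by simp
    then obtain y where y: "y \<in> Mor \<A>" "Dom \<A> y = Dom \<A> u" "Cod \<A> y = X" "f \<odot> y = h' \<odot> u"
      using short_exact_lift[OF assms(1), of "h' \<odot> u" "Dom \<A> u"] u h' by auto
    have "f' \<odot> y = u"
      by (rule jm[of _ "Dom \<A> u"]) (use y u f' h' g' r s hh in \<open>auto simp: Hom_def\<close>)
    then show ?thesis using y f' by auto
  qed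
  ultimately have ker: "is_kernel \<A> f' g'"
    by (intro is_kernelI) (use f' g' in auto)
  \<comment> \<open>Epimorphisms survive pullback because \<open>D\<close> is the cokernel of
    \<open>k\<close>: \<open>x \<odot> q\<close> kills \<open>k\<close>, so it equals
    \<open>y \<odot> D\<close>, and restriction to the summand \<open>Y\<close> shows that
    \<open>y \<odot> g\<close> is zero, hence \<open>y\<close> is.\<close>
  have "epic \<A> g'"
  proof (rule epicI[OF g'(1)])
    fix x assume x: "x \<in> Mor \<A>" "Dom \<A> x = Cod \<A> g'" "x \<odot> g' = Zero \<A> (Dom \<A> g') (Cod \<A> x)"
    have "(x \<odot> q) \<odot> k = Zero \<A> P (Cod \<A> x)" using x g' b t by (simp add: g'_def)
    then obtain y where y: "y \<in> Mor \<A>" "Dom \<A> y = Z" "Cod \<A> y = Cod \<A> x" "y \<odot> D = x \<odot> q"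
      using short_exact_desc[OF sk, of "x \<odot> q" "Cod \<A> x"] x g' b by auto
    have "y \<odot> (D \<odot> i) = Zero \<A> Y (Cod \<A> x)"
      by (subst Comp_reassoc[OF y(4)]) (use x y D b g' in auto)
    then have "y = Zero \<A> Z (Cod \<A> x)" using epic_Zero[OF s(12), of y Y] y s Di by simp
    then have "x \<odot> q = Zero \<A> S (Cod \<A> x)" using y D x by simp
    then have "x \<odot> (q \<odot> j) = Zero \<A> W (Cod \<A> x)"
      by (subst Comp_reassoc) (use x b g' in auto)
    then show "x = Zero \<A> (Cod \<A> g') (Cod \<A> x)" using x g' b by simp
  qed
  then have "short_exact \<A> X f' P g' W" using short_exactI[OF ker] f' g' by simp
  moreover have "h' \<in> Hom \<A> P Y" using h' by (simp add: Hom_def)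
  ultimately show thesis using sq f'(4) up jm by (rule that)
qed

lemma short_exact_pullback_short_exact:
  assumes "short_exact \<A> X f Y g Z" "short_exact \<A> K k W h Z"
  obtains f' Y' g' k' h' where "short_exact \<A> X f' Y' g' W" "short_exact \<A> K k' Y' h' Y"
    "g \<odot> h' = h \<odot> g'" "h' \<odot> f' = f"
proof -
  note s = short_exactD[OF assms(1)] and t = short_exactD[OF assms(2)]
  have hH: "h \<in> Hom \<A> W Z" and gH: "g \<in> Hom \<A> Y Z" using s t by (auto simp: Hom_def)
  obtain f' Y' g' h' where P: "short_exact \<A> X f' Y' g' W" "h' \<in> Hom \<A> Y' Y"
    "g \<odot> h' = h \<odot> g'" "h' \<odot> f' = f"
    and up: "\<And>a b T. \<lbrakk>a \<in> Hom \<A> T Y; b \<in> Hom \<A> T W; g \<odot> a = h \<odot> b\<rbrakk>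
      \<Longrightarrow> \<exists>u. u \<in> Hom \<A> T Y' \<and> h' \<odot> u = a \<and> g' \<odot> u = b"
    and jm: "\<And>u v T. \<lbrakk>u \<in> Hom \<A> T Y'; v \<in> Hom \<A> T Y'; h' \<odot> u = h' \<odot> v; g' \<odot> u = g' \<odot> v\<rbrakk> \<Longrightarrow> u = v"
    by (rule short_exact_pullback[OF assms(1) hH]) blast
  note p = short_exactD[OF P(1)] and h' = HomD[OF P(2)]
  \<comment> \<open>A second pullback, with the roles of the rows exchanged, has an epimorphism onto
    \<open>Y\<close>. It factors through \<open>h'\<close> by the universal property of the first,
    so \<open>h'\<close> is epic too.\<close>
  obtain k2 Y2 h2 g2 where Q: "short_exact \<A> K k2 Y2 h2 Y" "g2 \<in> Hom \<A> Y2 W" "h \<odot> g2 = g \<odot> h2"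
    by (rule short_exact_pullback[OF assms(2) gH])
  note q = short_exactD[OF Q(1)] and g2 = HomD[OF Q(2)]
  obtain u where u: "u \<in> Hom \<A> Y2 Y'" "h' \<odot> u = h2"
    using up[of h2 Y2 g2] Q q by (auto simp: Hom_def)
  have eh': "epic \<A> h'"
  proof (rule epicI[OF h'(1)])
    fix x assume x: "x \<in> Mor \<A>" "Dom \<A> x = Cod \<A> h'" "x \<odot> h' = Zero \<A> (Dom \<A> h') (Cod \<A> x)"
    have "x \<odot> (h' \<odot> u) = Zero \<A> Y2 (Cod \<A> x)"
      by (subst Comp_reassoc[OF x(3)]) (use x h' HomD[OF u(1)] in auto)
    then show "x = Zero \<A> (Cod \<A> h') (Cod \<A> x)"
      using epic_Zero[OF q(12), of x] x u h' q by auto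
  qed
  obtain k' where k': "k' \<in> Mor \<A>" "Dom \<A> k' = K" "Cod \<A> k' = Y'" "h' \<odot> k' = Zero \<A> K Y" "g' \<odot> k' = k"
    using up[of "Zero \<A> K Y" K k] s t by (auto simp: Hom_def)
  have "is_kernel \<A> k' h'"
  proof (rule is_kernelI)
    show "monic \<A> k'"
    proof (rule monicI[OF k'(1)])
      fix x assume x: "x \<in> Mor \<A>" "Cod \<A> x = Dom \<A> k'" "k' \<odot> x = Zero \<A> (Dom \<A> x) (Cod \<A> k')"
      have "k \<odot> x = g' \<odot> (k' \<odot> x)"
        by (rule Comp_reassoc[OF k'(5), symmetric]) (use x k' p in auto)
      also have "\<dots> = Zero \<A> (Dom \<A> x) W" using x k' p by simp
      finally have "k \<odot> x = Zero \<A> (Dom \<A> x) W" .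
      then show "x = Zero \<A> (Dom \<A> x) (Dom \<A> k')"
        using monic_Zero[OF t(11), of x] x k' t by simp
    qed
    fix x assume x: "x \<in> Mor \<A>" "Cod \<A> x = Dom \<A> h'" "h' \<odot> x = Zero \<A> (Dom \<A> x) (Cod \<A> h')"
    have "h \<odot> (g' \<odot> x) = g \<odot> (h' \<odot> x)"
      by (subst Comp_reassoc[OF P(3)[symmetric]]) (use x s t p h' in auto)
    then have "h \<odot> (g' \<odot> x) = Zero \<A> (Dom \<A> x) Z" using x h' s by simp
    then obtain y where y: "y \<in> Mor \<A>" "Dom \<A> y = Dom \<A> x" "Cod \<A> y = K" "k \<odot> y = g' \<odot> x"
      using short_exact_lift[OF assms(2), of "g' \<odot> x" "Dom \<A> x"] x p h' by auto
    have "k' \<odot> y = x"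
      by (rule jm[of _ "Dom \<A> x"])
        (use y x h' p k' k'(4,5)[THEN Comp_reassoc] in \<open>auto simp: Hom_def\<close>)
    then show "\<exists>y. y \<in> Mor \<A> \<and> Dom \<A> y = Dom \<A> x \<and> Cod \<A> y = Dom \<A> k' \<and> k' \<odot> y = x"
      using y k' by auto
  qed (use k' h' in auto)
  then have "short_exact \<A> K k' Y' h' Y" using short_exactI[OF _ eh'] k' h' by metis
  with P(1) show thesis using P(3,4) by (rule that)
qed

text \<open>The kernel of \<open>c \<odot> g\<close> is the preimage of \<open>W\<close> under
  \<open>g\<close>, hence an extension of the kernel of \<open>c\<close> by the kernel of
  \<open>g\<close>.\<close>

lemma short_exact_Comp_epic:
  assumes "short_exact \<A> X f Y g Z" "short_exact \<A> W h Z c V"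
  obtains f' Y' g' h' where "short_exact \<A> X f' Y' g' W" "short_exact \<A> Y' h' Y (c \<odot> g) V"
    "g \<odot> h' = h \<odot> g'" "h' \<odot> f' = f"
proof -
  note s = short_exactD[OF assms(1)] and t = short_exactD[OF assms(2)]
  have hH: "h \<in> Hom \<A> W Z" using t by (auto simp: Hom_def)
  obtain f' Y' g' h' where P: "short_exact \<A> X f' Y' g' W" "h' \<in> Hom \<A> Y' Y"
    "g \<odot> h' = h \<odot> g'" "h' \<odot> f' = f"
    and up: "\<And>a b T. \<lbrakk>a \<in> Hom \<A> T Y; b \<in> Hom \<A> T W; g \<odot> a = h \<odot> b\<rbrakk>
      \<Longrightarrow> \<exists>u. u \<in> Hom \<A> T Y' \<and> h' \<odot> u = a \<and> g' \<odot> u = b"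
    and jm: "\<And>u v T. \<lbrakk>u \<in> Hom \<A> T Y'; v \<in> Hom \<A> T Y'; h' \<odot> u = h' \<odot> v; g' \<odot> u = g' \<odot> v\<rbrakk> \<Longrightarrow> u = v"
    by (rule short_exact_pullback[OF assms(1) hH]) blast
  note p = short_exactD[OF P(1)] and h' = HomD[OF P(2)]
  have ec: "epic \<A> (c \<odot> g)"
    using epic_Comp s t by simp
  have ker: "is_kernel \<A> h' (c \<odot> g)"
  proof (rule is_kernelI)
    show "monic \<A> h'"
    proof (rule monicI[OF h'(1)])
      fix x assume x: "x \<in> Mor \<A>" "Cod \<A> x = Dom \<A> h'" "h' \<odot> x = Zero \<A> (Dom \<A> x) (Cod \<A> h')"
      have "h \<odot> (g' \<odot> x) = g \<odot> (h' \<odot> x)"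
        by (subst Comp_reassoc[OF P(3)[symmetric]]) (use x s t p h' in auto)
      then have "h \<odot> (g' \<odot> x) = Zero \<A> (Dom \<A> x) Z" using x h' s by simp
      then have "g' \<odot> x = Zero \<A> (Dom \<A> x) W"
        using monic_Zero[OF t(11), of "g' \<odot> x"] x h' p t by simp
      with x show "x = Zero \<A> (Dom \<A> x) (Dom \<A> h')"
        by - (rule jm[of _ "Dom \<A> x"], use h' p in \<open>auto simp: Hom_def\<close>)
    qed
    have "(c \<odot> g) \<odot> h' = c \<odot> (h \<odot> g')" using P(3) h' s t by simp
    also have "\<dots> = Zero \<A> Y' V" using Comp_reassoc[OF t(10)] t p by simp
    finally show "(c \<odot> g) \<odot> h' = Zero \<A> (Dom \<A> h') (Cod \<A> (c \<odot> g))" using s t h' by simp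
    fix x assume x: "x \<in> Mor \<A>" "Cod \<A> x = Dom \<A> (c \<odot> g)"
      "(c \<odot> g) \<odot> x = Zero \<A> (Dom \<A> x) (Cod \<A> (c \<odot> g))"
    have "c \<odot> (g \<odot> x) = Zero \<A> (Dom \<A> x) V" using x s t by simp
    then obtain b where b: "b \<in> Mor \<A>" "Dom \<A> b = Dom \<A> x" "Cod \<A> b = W" "h \<odot> b = g \<odot> x"
      using short_exact_lift[OF assms(2), of "g \<odot> x" "Dom \<A> x"] x s t by auto
    then obtain u where "u \<in> Hom \<A> (Dom \<A> x) Y'" "h' \<odot> u = x"
      using up[of x "Dom \<A> x" b] x s t by (auto simp: Hom_def)
    then show "\<exists>y. y \<in> Mor \<A> \<and> Dom \<A> y = Dom \<A> x \<and> Cod \<A> y = Dom \<A> h' \<and> h' \<odot> y = x"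
      using h' by auto
  qed (use h' s t in auto)
  then have "short_exact \<A> Y' h' Y (c \<odot> g) V" using short_exactI[OF ker ec] h' s t by simp
  with P(1) show thesis using P(3,4) by (rule that)
qed

text \<open>Dual to \<open>short_exact_Comp_epic\<close>: the cokernel of a composite of
  monomorphisms is an extension of the second cokernel by the first.\<close>

lemma short_exact_Comp_monic:
  assumes "short_exact \<A> M a E b N" "short_exact \<A> E u F v L"
  obtains c N' d e where "short_exact \<A> M (u \<odot> a) F c N'" "short_exact \<A> N d N' e L"
    "c \<odot> u = d \<odot> b" "e \<odot> c = v"
proof (rule abelian_category.short_exact_Comp_epic[OF abelian_opp, of L v F u E N b a M, simplified])
  fix f' Y' g' h'
  assume "short_exact \<A> N g' Y' f' L" "short_exact \<A> M (u \<odot> a) F h' Y'" "h' \<odot> u = g' \<odot> b" "f' \<odot> h' = v"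
  then show thesis using that[of h' Y' g' f'] by simp
qed (use assms in auto)

lemma short_exact_pushout:
  assumes "short_exact \<A> X f Y g Z" "h \<in> Hom \<A> X W"
  obtains f' Y' g' h' where "short_exact \<A> W f' Y' g' Z" "h' \<in> Hom \<A> Y Y'"
    "h' \<odot> f = f' \<odot> h" "g' \<odot> h' = g"
    "\<And>a b T. \<lbrakk>a \<in> Hom \<A> Y T; b \<in> Hom \<A> W T; a \<odot> f = b \<odot> h\<rbrakk>
      \<Longrightarrow> \<exists>u. u \<in> Hom \<A> Y' T \<and> u \<odot> h' = a \<and> u \<odot> f' = b"
    "\<And>u v T. \<lbrakk>u \<in> Hom \<A> Y' T; v \<in> Hom \<A> Y' T; u \<odot> h' = v \<odot> h'; u \<odot> f' = v \<odot> f'\<rbrakk> \<Longrightarrow> u = v"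
proof (rule abelian_category.short_exact_pullback[OF abelian_opp, of Z g Y f X h W, simplified])
  fix f' Y' g' h'
  assume "short_exact \<A> W g' Y' f' Z" "h' \<in> Hom \<A> Y Y'" "h' \<odot> f = g' \<odot> h" "f' \<odot> h' = g"
    "\<And>a b T. \<lbrakk>a \<in> Hom \<A> Y T; b \<in> Hom \<A> W T; a \<odot> f = b \<odot> h\<rbrakk>
      \<Longrightarrow> \<exists>u. u \<in> Hom \<A> Y' T \<and> u \<odot> h' = a \<and> u \<odot> g' = b"
    "\<And>u v T. \<lbrakk>u \<in> Hom \<A> Y' T; v \<in> Hom \<A> Y' T; u \<odot> h' = v \<odot> h'; u \<odot> g' = v \<odot> g'\<rbrakk> \<Longrightarrow> u = v"
  then show thesis by (rule that)
qed (use assms in auto)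

end

section \<open>Vanishing of first extension groups\<close>

text \<open>Stands for \<open>Ext^1(X, Y) = 0\<close>, as \<open>Ext_zero_1_iff\<close> justifies;
  \<open>X\<close> is the quotient and \<open>Y\<close> the subobject. No equivalence classes of
  extensions occur, and the notion is self-dual by \<open>ext_split_opp\<close>.\<close>

definition ext_split :: "('o, 'm, 'z) preadd_scheme \<Rightarrow> 'o \<Rightarrow> 'o \<Rightarrow> bool" where
  "ext_split \<A> X Y \<longleftrightarrow>
     (\<forall>f E g. short_exact \<A> Y f E g X \<longrightarrow> (\<exists>s\<in>Hom \<A> X E. g \<odot>\<^bsub>\<A>\<^esub> s = Id \<A> X))"

context abelian_category
begin

lemma monic_if_retraction:
  assumes "f \<in> Mor \<A>" "r \<in> Mor \<A>" "Dom \<A> r = Cod \<A> f" "r \<odot> f = Id \<A> (Dom \<A> f)"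
  shows "monic \<A> f"
proof (rule monicI[OF assms(1)])
  fix x assume x: "x \<in> Mor \<A>" "Cod \<A> x = Dom \<A> f" "f \<odot> x = Zero \<A> (Dom \<A> x) (Cod \<A> f)"
  have "Cod \<A> r = Dom \<A> f" using assms by (metis Comp_simps(3) Id_simps(3) Dom_Cod_Ob(1))
  moreover have "r \<odot> (f \<odot> x) = x" by (subst Comp_reassoc[OF assms(4)]) (use x assms in auto)
  ultimately show "x = Zero \<A> (Dom \<A> x) (Dom \<A> f)" using x assms by simp
qed

lemma epic_if_section:
  assumes "f \<in> Mor \<A>" "s \<in> Mor \<A>" "Cod \<A> s = Dom \<A> f" "f \<odot> s = Id \<A> (Cod \<A> f)"
  shows "epic \<A> f"
  using abelian_category.monic_if_retraction[OF abelian_opp, of f s] assms by simp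

lemma is_biproduct_swap:
  assumes "is_biproduct \<A> X Y S i j p q"
  shows "is_biproduct \<A> Y X S j i q p"
  using is_biproductD[OF assms] assms Add_commute[of "i \<odot> p" "j \<odot> q"] by (simp add: is_biproduct_def)

lemma is_biproduct_short_exact:
  assumes "is_biproduct \<A> X Y S i j p q"
  shows "short_exact \<A> X i S q Y"
proof -
  note b = is_biproductD[OF assms]
  have "is_kernel \<A> i q"
  proof (rule is_kernelI)
    show "monic \<A> i" using monic_if_retraction[of i p] b by simp
    fix u assume u: "u \<in> Mor \<A>" "Cod \<A> u = Dom \<A> q" "q \<odot> u = Zero \<A> (Dom \<A> u) (Cod \<A> q)"
    then have "i \<odot> (p \<odot> u) = u" using is_biproduct_expand(1)[OF assms, of u] b by simp
    then show "\<exists>y. y \<in> Mor \<A> \<and> Dom \<A> y = Dom \<A> u \<and> Cod \<A> y = Dom \<A> i \<and> i \<odot> y = u"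
      using u b by (intro exI[of _ "p \<odot> u"]) simp
  qed (use b in auto)
  moreover have "epic \<A> q" using epic_if_section[of q j] b by simp
  ultimately show ?thesis using short_exactI[of i q] b by simp
qed

lemma section_is_biproduct:
  assumes "short_exact \<A> Y f E g X" "s \<in> Hom \<A> X E" "g \<odot> s = Id \<A> X"
  obtains r where "is_biproduct \<A> Y X E f s r g"
proof -
  note t = short_exactD[OF assms(1)] and s = HomD[OF assms(2)]
  \<comment> \<open>The projector onto the image of \<open>f\<close> along \<open>s\<close>; it is
    killed by \<open>g\<close>, so it factors through the kernel as
    \<open>f \<odot> r\<close>.\<close>
  define e where "e = Sub (Id \<A> E) (s \<odot> g)"
  have e: "e \<in> Mor \<A>" "Dom \<A> e = E" "Cod \<A> e = E" using t s by (simp_all add: e_def)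
  have "g \<odot> (s \<odot> g) = g" by (subst Comp_reassoc[OF assms(3)]) (use s t in auto)
  then have "g \<odot> e = Zero \<A> E X" unfolding e_def using t s by simp
  then obtain r where r: "r \<in> Mor \<A>" "Dom \<A> r = E" "Cod \<A> r = Y" "f \<odot> r = e"
    using short_exact_lift[OF assms(1) e] by auto
  have "f \<odot> (r \<odot> f) = e \<odot> f" by (rule Comp_reassoc[OF r(4)]) (use r t in auto)
  also have "\<dots> = f" unfolding e_def using t s by simp
  finally have "f \<odot> (r \<odot> f) = f" .
  then have "r \<odot> f = Id \<A> Y" using monicD[OF t(11), of "r \<odot> f" "Id \<A> Y"] r t by simp
  moreover have "(f \<odot> r) \<boxplus> (s \<odot> g) = Id \<A> E"
    unfolding r(4) using Add_Sub[of "Id \<A> E" "s \<odot> g"] Add_commute[of "s \<odot> g" e] e s t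
    by (simp add: e_def)
  ultimately show thesis
    using that[of r] r s t assms by (simp add: is_biproduct_def Hom_def)
qed

lemma retraction_is_biproduct:
  assumes "short_exact \<A> Y f E g X" "r \<in> Hom \<A> E Y" "r \<odot> f = Id \<A> Y"
  obtains s where "is_biproduct \<A> Y X E f s r g"
  using abelian_category.section_is_biproduct[OF abelian_opp, of X g E f Y r, simplified, OF assms]
    is_biproduct_swap by metis

section \<open>Fragments of the long exact sequence\<close>

lemma ext_split_imp_opp:
  assumes "ext_split \<A> X Y" shows "ext_split (opp \<A>) Y X"
  unfolding ext_split_def
proof (intro allI impI)
  fix g E f assume "short_exact (opp \<A>) X g E f Y"
  then have s: "short_exact \<A> Y f E g X" by simp
  then obtain t where "t \<in> Hom \<A> X E" "g \<odot> t = Id \<A> X" using assms unfolding ext_split_def by blast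
  then obtain r where "is_biproduct \<A> Y X E f t r g" using section_is_biproduct[OF s] by metis
  then show "\<exists>r\<in>Hom (opp \<A>) Y E. f \<odot>\<^bsub>opp \<A>\<^esub> r = Id (opp \<A>) Y"
    by (auto simp: is_biproduct_def)
qed

lemma opp_opp [simp]: "opp (opp \<A>) = \<A>"
  by (simp add: opp_def)

lemma ext_split_opp [simp]: "ext_split (opp \<A>) Y X = ext_split \<A> X Y"
  using ext_split_imp_opp
    abelian_category.ext_split_imp_opp[OF abelian_opp, of Y X] by auto

text \<open>Surjectivity of \<open>Hom(X, B) \<rightarrow> Hom(X, Q)\<close>: a section of the
  pullback of the row along \<open>h\<close> composes to a lift.\<close>

lemma ext_split_lift:
  assumes "ext_split \<A> X K" "short_exact \<A> K f B g Q" "h \<in> Hom \<A> X Q"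
  obtains k where "k \<in> Hom \<A> X B" "g \<odot> k = h"
proof -
  obtain f' Y' g' h' where P: "short_exact \<A> K f' Y' g' X" "h' \<in> Hom \<A> Y' B" "g \<odot> h' = h \<odot> g'"
    by (rule short_exact_pullback[OF assms(2,3)])
  obtain s where s: "s \<in> Hom \<A> X Y'" "g' \<odot> s = Id \<A> X" using assms(1) P(1) unfolding ext_split_def by blast
  note t = short_exactD[OF P(1)] short_exactD[OF assms(2)] HomD[OF s(1)] HomD[OF P(2)] HomD[OF assms(3)]
  have "g \<odot> (h' \<odot> s) = (h \<odot> g') \<odot> s" by (rule Comp_reassoc[OF P(3)]) (use t in auto)
  also have "\<dots> = h" using t s(2) by simp
  finally show thesis using that[of "h' \<odot> s"] t by (simp add: Hom_def)
qed

lemma ext_split_extend: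
  assumes "ext_split \<A> X K" "short_exact \<A> Y f B g X" "h \<in> Hom \<A> Y K"
  obtains k where "k \<in> Hom \<A> B K" "k \<odot> f = h"
  using abelian_category.ext_split_lift[OF abelian_opp, of K X g B f Y h, simplified, OF assms] .

text \<open>Half-exactness of \<open>Ext^1(X, -)\<close>. Dividing an extension of \<open>X\<close>
  by \<open>B\<close> by the subobject \<open>Y\<close> leaves one by \<open>Z\<close>, which
  splits; its section then lifts through a quotient map with kernel \<open>Y\<close>.\<close>

lemma ext_split_middle_right:
  assumes "ext_split \<A> X Y" "ext_split \<A> X Z" "short_exact \<A> Y f B g Z"
  shows "ext_split \<A> X B"
  unfolding ext_split_def
proof (intro allI impI)
  fix u E v assume E: "short_exact \<A> B u E v X"
  obtain w N a b where P: "short_exact \<A> Y (u \<odot> f) E w N" "short_exact \<A> Z a N b X" "b \<odot> w = v"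
    by (rule short_exact_Comp_monic[OF assms(3) E])
  obtain s where s: "s \<in> Hom \<A> X N" "b \<odot> s = Id \<A> X" using assms(2) P(2) unfolding ext_split_def by blast
  obtain k where k: "k \<in> Hom \<A> X E" "w \<odot> k = s" by (rule ext_split_lift[OF assms(1) P(1) s(1)])
  note t = short_exactD[OF P(1)] short_exactD[OF P(2)] HomD[OF k(1)]
  have "v \<odot> k = b \<odot> (w \<odot> k)" by (rule Comp_reassoc[OF P(3), symmetric]) (use t in auto)
  then show "\<exists>s\<in>Hom \<A> X E. v \<odot> s = Id \<A> X" using k s by auto
qed

lemma ext_split_middle_left:
  assumes "ext_split \<A> Y X" "ext_split \<A> Z X" "short_exact \<A> Y f B g Z"
  shows "ext_split \<A> B X"
  using abelian_category.ext_split_middle_right[OF abelian_opp, of X Z Y g B f] assms by simp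

lemma ext_split_summand_left:
  assumes "is_biproduct \<A> X C S i j p q" "ext_split \<A> S Y"
  shows "ext_split \<A> X Y"
  unfolding ext_split_def
proof (intro allI impI)
  fix u E v assume E: "short_exact \<A> Y u E v X"
  note b = is_biproductD[OF assms(1)] and e = short_exactD[OF E]
  obtain k where k: "k \<in> Hom \<A> S E" "v \<odot> k = p"
    by (rule ext_split_lift[OF assms(2) E, of p]) (use b in \<open>auto simp: Hom_def\<close>)
  note kt = HomD[OF k(1)]
  have "v \<odot> (k \<odot> i) = p \<odot> i" by (rule Comp_reassoc[OF k(2)]) (use b e kt in auto)
  then show "\<exists>s\<in>Hom \<A> X E. v \<odot> s = Id \<A> X" using b kt by (intro bexI[of _ "k \<odot> i"]) (auto simp: Hom_def)
qed

lemma ext_split_summand_right: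
  assumes "is_biproduct \<A> X C S i j p q" "ext_split \<A> Y S"
  shows "ext_split \<A> Y X"
  using abelian_category.ext_split_summand_left[OF abelian_opp, of X C S p q i j Y] assms by simp

text \<open>In the long exact sequence, \<open>Ext^1(X, M)\<close> embeds in
  \<open>Ext^1(X, B)\<close> once \<open>Hom(X, B) \<rightarrow> Hom(X, N)\<close> is onto. The
  chase ends with a retraction of \<open>u\<close>.\<close>

lemma ext_split_kernel:
  assumes "short_exact \<A> M m B e N" "ext_split \<A> X B"
    and surj: "\<And>h. h \<in> Hom \<A> X N \<Longrightarrow> \<exists>k\<in>Hom \<A> X B. e \<odot> k = h"
  shows "ext_split \<A> X M"
  unfolding ext_split_def
proof (intro allI impI)
  fix u E v assume E: "short_exact \<A> M u E v X"
  note s = short_exactD[OF assms(1)] and t = short_exactD[OF E]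
  obtain x where x: "x \<in> Hom \<A> E B" "x \<odot> u = m"
    by (rule ext_split_extend[OF assms(2) E, of m]) (use s in \<open>auto simp: Hom_def\<close>)
  note xt = HomD[OF x(1)]
  have "(e \<odot> x) \<odot> u = Zero \<A> M N" using x s t xt by simp
  then obtain h where h: "h \<in> Mor \<A>" "Dom \<A> h = X" "Cod \<A> h = N" "h \<odot> v = e \<odot> x"
    using short_exact_desc[OF E, of "e \<odot> x" N] s t xt by auto
  obtain k where k: "k \<in> Hom \<A> X B" "e \<odot> k = h" using surj[of h] h by (auto simp: Hom_def)
  note kt = HomD[OF k(1)]
  \<comment> \<open>The extension \<open>x\<close> of \<open>m\<close> to \<open>E\<close> may leave
    the subobject \<open>M\<close>; the defect \<open>e \<odot> x\<close> factors through
    \<open>X\<close>, and subtracting a lift of it corrects \<open>x\<close> without changing it on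
    \<open>M\<close>.\<close>
  define y where "y = Sub x (k \<odot> v)"
  have y: "y \<in> Mor \<A>" "Dom \<A> y = E" "Cod \<A> y = B" using xt kt t by (simp_all add: y_def)
  have "e \<odot> (k \<odot> v) = h \<odot> v" by (rule Comp_reassoc[OF k(2)]) (use s t kt in auto)
  then have "e \<odot> y = Zero \<A> E N" unfolding y_def using h xt kt t s by simp
  then obtain r where r: "r \<in> Mor \<A>" "Dom \<A> r = E" "Cod \<A> r = M" "m \<odot> r = y"
    using short_exact_lift[OF assms(1) y] by auto
  have "m \<odot> (r \<odot> u) = y \<odot> u" by (rule Comp_reassoc[OF r(4)]) (use r s t in auto)
  also have "\<dots> = m" unfolding y_def using x xt kt s t by simp
  finally have "m \<odot> (r \<odot> u) = m" .
  then have "r \<odot> u = Id \<A> M" using monicD[OF s(11), of "r \<odot> u" "Id \<A> M"] r s t by simp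
  then obtain w where "is_biproduct \<A> M X E u w r v"
    using retraction_is_biproduct[OF E, of r] r by (auto simp: Hom_def)
  then show "\<exists>s\<in>Hom \<A> X E. v \<odot> s = Id \<A> X" by (auto simp: is_biproduct_def)
qed

lemma ext_split_cokernel:
  assumes "short_exact \<A> N e B m M" "ext_split \<A> B X"
    and "\<And>h. h \<in> Hom \<A> N X \<Longrightarrow> \<exists>k\<in>Hom \<A> B X. k \<odot> e = h"
  shows "ext_split \<A> M X"
  using abelian_category.ext_split_kernel[OF abelian_opp, of M m B e N X] assms by simp

lemma projective_lift:
  assumes "P \<in> projectives \<A>" "epic \<A> g" "f \<in> Hom \<A> P (Cod \<A> g)"
  obtains h where "h \<in> Hom \<A> P (Dom \<A> g)" "g \<odot> h = f"
  using assms by (auto simp: projectives_def)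

text \<open>Modulo the image of \<open>Ext^1(X, B)\<close>, the group \<open>Ext^1(X, Q)\<close>
  embeds in \<open>Ext^2(X, K)\<close>. The presentation by \<open>P\<close> shifts the latter to
  \<open>Ext^1(X', K)\<close>, and the proof performs this shift on representatives.\<close>

lemma ext_split_quotient:
  assumes "short_exact \<A> K f B g Q" "ext_split \<A> X B"
    and "short_exact \<A> X' a P b X" "P \<in> projectives \<A>" "ext_split \<A> X' K"
  shows "ext_split \<A> X Q"
  unfolding ext_split_def
proof (intro allI impI)
  fix u E v assume E: "short_exact \<A> Q u E v X"
  note s = short_exactD[OF assms(1)] and t = short_exactD[OF assms(3)] and e = short_exactD[OF E]
  \<comment> \<open>The restriction \<open>z\<close> of \<open>w\<close> to \<open>X'\<close>
    represents the class of the extension \<open>E\<close>.\<close>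
  obtain w where w: "w \<in> Hom \<A> P E" "v \<odot> w = b"
    by (rule projective_lift[OF assms(4) e(12), of b]) (use t e in \<open>auto simp: Hom_def\<close>)
  note wt = HomD[OF w(1)]
  have "v \<odot> (w \<odot> a) = b \<odot> a" by (rule Comp_reassoc[OF w(2)]) (use t e wt in auto)
  then obtain z where z: "z \<in> Mor \<A>" "Dom \<A> z = X'" "Cod \<A> z = Q" "u \<odot> z = w \<odot> a"
    using short_exact_lift[OF E, of "w \<odot> a" X'] t e wt by auto
  obtain y where y: "y \<in> Hom \<A> X' B" "g \<odot> y = z"
    by (rule ext_split_lift[OF assms(5,1), of z]) (use z in \<open>auto simp: Hom_def dest: Dom_Cod_Ob\<close>)
  obtain x where x: "x \<in> Hom \<A> P B" "x \<odot> a = y" by (rule ext_split_extend[OF assms(2,3) y(1)])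
  note xt = HomD[OF x(1)] and yt = HomD[OF y(1)]
  \<comment> \<open>Since \<open>u \<odot> (g \<odot> x)\<close> agrees with \<open>w\<close> on
    \<open>X'\<close>, the difference descends to \<open>X\<close>; it still lies over
    \<open>b\<close> because \<open>v \<odot> u\<close> is zero.\<close>
  define d where "d = Sub w (u \<odot> (g \<odot> x))"
  have d: "d \<in> Mor \<A>" "Dom \<A> d = P" "Cod \<A> d = E" using wt xt s e by (simp_all add: d_def)
  have "d \<odot> a = Zero \<A> X' E" unfolding d_def using wt xt s e t x(2) y(2) z by simp
  then obtain k where k: "k \<in> Mor \<A>" "Dom \<A> k = X" "Cod \<A> k = E" "k \<odot> b = d"
    using short_exact_desc[OF assms(3) d] by auto
  have "v \<odot> (u \<odot> (g \<odot> x)) = Zero \<A> P X"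
    by (subst Comp_reassoc[OF e(10)]) (use s e xt in auto)
  then have "v \<odot> d = b" unfolding d_def using wt xt s e t w(2) by simp
  then have "(v \<odot> k) \<odot> b = b" using k e t by simp
  then have "v \<odot> k = Id \<A> X" using epicD[OF t(12), of "v \<odot> k" "Id \<A> X"] k e t by simp
  then show "\<exists>s\<in>Hom \<A> X E. v \<odot> s = Id \<A> X" using k by (intro bexI[of _ k]) (auto simp: Hom_def)
qed

lemma projective_ext_split:
  assumes "P \<in> projectives \<A>"
  shows "ext_split \<A> P Y"
  unfolding ext_split_def
proof (intro allI impI)
  fix u E v assume E: "short_exact \<A> Y u E v P"
  note e = short_exactD[OF E]
  show "\<exists>s\<in>Hom \<A> P E. v \<odot> s = Id \<A> P"
    by (rule projective_lift[OF assms e(12), of "Id \<A> P"]) (use e in \<open>auto simp: Hom_def\<close>)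
qed

section \<open>Comparison with the first Yoneda extension group\<close>

lemma extensions_1_iff:
  "E \<in> extensions \<A> 1 X Y \<longleftrightarrow> (\<exists>f g. E = [f, g] \<and> short_exact \<A> Y f (Cod \<A> f) g X)"
proof
  assume E: "E \<in> extensions \<A> 1 X Y"
  then obtain f g where "E = [f, g]" by (auto simp: extensions_def length_Suc_conv)
  with E show "\<exists>f g. E = [f, g] \<and> short_exact \<A> Y f (Cod \<A> f) g X"
    by (auto simp: extensions_def short_exact_def Hom_def exact_at_def)
next
  assume "\<exists>f g. E = [f, g] \<and> short_exact \<A> Y f (Cod \<A> f) g X"
  then show "E \<in> extensions \<A> 1 X Y"
    by (auto simp: extensions_def short_exact_def Hom_def)
qed

lemma extension_morphs_1_iff:
  "(D, E) \<in> extension_morphs \<A> 1 X Y \<longleftrightarrow> (\<exists>f g f' g' \<phi>. D = [f, g] \<and> E = [f', g'] \<and>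
     short_exact \<A> Y f (Cod \<A> f) g X \<and> short_exact \<A> Y f' (Cod \<A> f') g' X \<and>
     \<phi> \<in> Hom \<A> (Cod \<A> f) (Cod \<A> f') \<and> \<phi> \<odot> f = f' \<and> g' \<odot> \<phi> = g)"
proof
  assume DE: "(D, E) \<in> extension_morphs \<A> 1 X Y"
  then have "D \<in> extensions \<A> 1 X Y" "E \<in> extensions \<A> 1 X Y" by (auto simp: extension_morphs_def)
  then obtain f g f' g' where *: "D = [f, g]" "E = [f', g']"
    "short_exact \<A> Y f (Cod \<A> f) g X" "short_exact \<A> Y f' (Cod \<A> f') g' X"
    unfolding extensions_1_iff by blast
  note t = short_exactD[OF *(3)] short_exactD[OF *(4)]
  obtain \<phi> where \<phi>: "\<phi> 0 = Id \<A> Y" "\<phi> (Suc 1) = Id \<A> X"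
    "\<And>i. i \<le> 1 \<Longrightarrow> \<phi> (Suc i) \<in> Hom \<A> (Cod \<A> (D ! i)) (Cod \<A> (E ! i)) \<and> \<phi> (Suc i) \<odot> D ! i = E ! i \<odot> \<phi> i"
    using DE unfolding extension_morphs_def by blast
  have "\<phi> 1 \<in> Hom \<A> (Cod \<A> f) (Cod \<A> f')" "\<phi> 1 \<odot> f = f'" "g' \<odot> \<phi> 1 = g"
    using \<phi>(3)[of 0] \<phi>(3)[of 1] * t \<phi>(1,2) by auto
  with * show "\<exists>f g f' g' \<phi>. D = [f, g] \<and> E = [f', g'] \<and>
     short_exact \<A> Y f (Cod \<A> f) g X \<and> short_exact \<A> Y f' (Cod \<A> f') g' X \<and>
     \<phi> \<in> Hom \<A> (Cod \<A> f) (Cod \<A> f') \<and> \<phi> \<odot> f = f' \<and> g' \<odot> \<phi> = g" by blast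
next
  assume "\<exists>f g f' g' \<phi>. D = [f, g] \<and> E = [f', g'] \<and>
     short_exact \<A> Y f (Cod \<A> f) g X \<and> short_exact \<A> Y f' (Cod \<A> f') g' X \<and>
     \<phi> \<in> Hom \<A> (Cod \<A> f) (Cod \<A> f') \<and> \<phi> \<odot> f = f' \<and> g' \<odot> \<phi> = g"
  then obtain f g f' g' \<phi> where *: "D = [f, g]" "E = [f', g']"
     "short_exact \<A> Y f (Cod \<A> f) g X" "short_exact \<A> Y f' (Cod \<A> f') g' X"
     "\<phi> \<in> Hom \<A> (Cod \<A> f) (Cod \<A> f')" "\<phi> \<odot> f = f'" "g' \<odot> \<phi> = g" by blast
  note t = short_exactD[OF *(3)] short_exactD[OF *(4)]
  have "D \<in> extensions \<A> 1 X Y" "E \<in> extensions \<A> 1 X Y"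
    unfolding extensions_1_iff using * by blast+
  moreover have "\<exists>\<psi>. \<psi> 0 = Id \<A> Y \<and> \<psi> (Suc 1) = Id \<A> X \<and>
        (\<forall>i\<le>1. \<psi> (Suc i) \<in> Hom \<A> (Cod \<A> (D ! i)) (Cod \<A> (E ! i)) \<and> \<psi> (Suc i) \<odot> D ! i = E ! i \<odot> \<psi> i)"
    using * t
    by (intro exI[of _ "\<lambda>i. if i = 0 then Id \<A> Y else if i = 1 then \<phi> else Id \<A> X"])
      (auto simp: le_Suc_eq Hom_def)
  ultimately show "(D, E) \<in> extension_morphs \<A> 1 X Y" unfolding extension_morphs_def by blast
qed

text \<open>Equivalence of extensions is generated by morphisms in either direction, so splitting is
  carried both ways: sections push forward along \<open>\<phi>\<close>, retractions pull back along
  it.\<close>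

lemma extension_morphs_split_iff:
  assumes "([f, g], [f', g']) \<in> extension_morphs \<A> 1 X Y"
  shows "(\<exists>s\<in>Hom \<A> X (Cod \<A> f). g \<odot> s = Id \<A> X) \<longleftrightarrow> (\<exists>s\<in>Hom \<A> X (Cod \<A> f'). g' \<odot> s = Id \<A> X)"
proof
  obtain \<phi> where s: "short_exact \<A> Y f (Cod \<A> f) g X" "short_exact \<A> Y f' (Cod \<A> f') g' X"
    and \<phi>: "\<phi> \<in> Hom \<A> (Cod \<A> f) (Cod \<A> f')" "\<phi> \<odot> f = f'" "g' \<odot> \<phi> = g"
    using assms unfolding extension_morphs_1_iff by auto
  note t = short_exactD[OF s(1)] short_exactD[OF s(2)] HomD[OF \<phi>(1)]
  {
    assume "\<exists>s\<in>Hom \<A> X (Cod \<A> f). g \<odot> s = Id \<A> X"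
    then obtain s where s: "s \<in> Hom \<A> X (Cod \<A> f)" "g \<odot> s = Id \<A> X" by blast
    have "g' \<odot> (\<phi> \<odot> s) = g \<odot> s" by (rule Comp_reassoc[OF \<phi>(3)]) (use t HomD[OF s(1)] in auto)
    then show "\<exists>s\<in>Hom \<A> X (Cod \<A> f'). g' \<odot> s = Id \<A> X"
      using s(2) HomD[OF s(1)] t by (intro bexI[of _ "\<phi> \<odot> s"]) (auto simp: Hom_def)
  next
    assume "\<exists>s\<in>Hom \<A> X (Cod \<A> f'). g' \<odot> s = Id \<A> X"
    then obtain s' r' where "is_biproduct \<A> Y X (Cod \<A> f') f' s' r' g'"
      using section_is_biproduct[OF s(2)] by metis
    note b = is_biproductD[OF this]
    have "(r' \<odot> \<phi>) \<odot> f = Id \<A> Y" using b t \<phi> by simp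
    then obtain s where "is_biproduct \<A> Y X (Cod \<A> f) f s (r' \<odot> \<phi>) g"
      using retraction_is_biproduct[OF s(1), of "r' \<odot> \<phi>"] b t by (auto simp: Hom_def)
    then show "\<exists>s\<in>Hom \<A> X (Cod \<A> f). g \<odot> s = Id \<A> X" by (auto simp: is_biproduct_def)
  }
qed

text \<open>Everything is compared with the split extension on a biproduct, which also shows that
  the set of classes is nonempty. A single class links every extension to it by a zigzag, along
  which splitting is inherited.\<close>

lemma Ext_zero_1_iff:
  assumes "X \<in> Ob \<A>" "Y \<in> Ob \<A>"
  shows "Ext_zero \<A> 1 X Y \<longleftrightarrow> ext_split \<A> X Y"
proof -
  define A where "A = extensions \<A> 1 X Y"
  define M where "M = extension_morphs \<A> 1 X Y"
  define R where "R = (M \<union> M\<inverse>)\<^sup>*"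
  obtain S i j p q where B: "is_biproduct \<A> Y X S i j p q"
    using ex_direct_sum[of Y X] assms by (auto simp: is_direct_sum_def)
  note b = is_biproductD[OF B]
  have s0: "short_exact \<A> Y i S q X" using is_biproduct_short_exact[OF B] .
  have E0: "[i, q] \<in> A" unfolding A_def extensions_1_iff using s0 b by auto
  have symR: "sym R" unfolding R_def by (intro sym_rtrancl) (auto simp: sym_def)
  have transR: "trans R" unfolding R_def by (rule trans_rtrancl)
  have reflR: "\<And>x. (x, x) \<in> R" unfolding R_def by simp
  have inv: "\<exists>s\<in>Hom \<A> X (Cod \<A> (E ! 0)). E ! 1 \<odot> s = Id \<A> X" if "([i, q], E) \<in> R" for E
    using that unfolding R_def
  proof (induction rule: rtrancl_induct)
    case base
    show ?case using b by (intro bexI[of _ j]) (auto simp: Hom_def)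
  next
    case (step D E)
    have DE: "(D, E) \<in> M \<or> (E, D) \<in> M" using step.hyps by auto
    then obtain f g f' g' where *: "D = [f, g]" "E = [f', g']"
      unfolding M_def extension_morphs_1_iff by blast
    have "(\<exists>s\<in>Hom \<A> X (Cod \<A> f). g \<odot> s = Id \<A> X) \<longleftrightarrow> (\<exists>s\<in>Hom \<A> X (Cod \<A> f'). g' \<odot> s = Id \<A> X)"
      using DE unfolding * M_def
      by (elim disjE) (use extension_morphs_split_iff in blast)+
    then show ?case using step.IH * by simp
  qed
  show ?thesis
  proof
    assume "Ext_zero \<A> 1 X Y"
    then obtain c where c: "A // R = {c}"
      unfolding Ext_zero_def Ext_def A_def R_def M_def by (auto simp: is_singleton_def)
    show "ext_split \<A> X Y"
      unfolding ext_split_def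
    proof (intro allI impI)
      fix f E g assume s: "short_exact \<A> Y f E g X"
      then have "[f, g] \<in> A" unfolding A_def extensions_1_iff using short_exactD(3)[OF s] by auto
      then have "R `` {[f, g]} \<in> A // R" "R `` {[i, q]} \<in> A // R" using E0 by (auto intro: quotientI)
      then have "R `` {[f, g]} = R `` {[i, q]}" unfolding c by simp
      then have "([i, q], [f, g]) \<in> R" using reflR by blast
      then show "\<exists>s\<in>Hom \<A> X E. g \<odot> s = Id \<A> X" using inv[of "[f, g]"] short_exactD(3)[OF s] by simp
    qed
  next
    assume sp: "ext_split \<A> X Y"
    have "R `` {E} = R `` {[i, q]}" if EA: "E \<in> A" for E
    proof -
      obtain f g where E: "E = [f, g]" and s: "short_exact \<A> Y f (Cod \<A> f) g X"
        using EA unfolding A_def extensions_1_iff by blast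
      obtain s where s': "s \<in> Hom \<A> X (Cod \<A> f)" "g \<odot> s = Id \<A> X"
        using sp s unfolding ext_split_def by blast
      note t = short_exactD[OF s] HomD[OF s'(1)]
      \<comment> \<open>The map \<open>f\<close> on \<open>Y\<close> and the section on
        \<open>X\<close> assemble to a morphism from the split extension to
        \<open>E\<close>.\<close>
      define \<phi> where "\<phi> = (f \<odot> p) \<boxplus> (s \<odot> q)"
      have "\<phi> \<in> Hom \<A> S (Cod \<A> f)" unfolding \<phi>_def using t b by (simp add: Hom_def)
      moreover have "\<phi> \<odot> i = f" "g \<odot> \<phi> = q"
        unfolding \<phi>_def using t b Comp_reassoc[OF t(10)] Comp_reassoc[OF s'(2)] by simp_all
      ultimately have "([i, q], E) \<in> M"
        unfolding M_def extension_morphs_1_iff E using s s0 b(3) by blast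
      then have "([i, q], E) \<in> R" unfolding R_def by auto
      with symR have "([i, q], E) \<in> R" "(E, [i, q]) \<in> R" by (auto dest: symD)
      then show ?thesis using transD[OF transR] by blast
    qed
    then have "A // R = {R `` {[i, q]}}" using E0 unfolding quotient_def by blast
    then show "Ext_zero \<A> 1 X Y"
      unfolding Ext_zero_def Ext_def A_def R_def M_def by (auto simp: is_singleton_def)
  qed
qed

end

section \<open>Gorenstein objects\<close>

context abelian_category
begin

section \<open>Images and exactness\<close>

lemma is_kernel_Comp_monic_iff:
  assumes "monic \<A> m" "f \<in> Mor \<A>" "Dom \<A> m = Cod \<A> f"
  shows "is_kernel \<A> k (m \<odot> f) \<longleftrightarrow> is_kernel \<A> k f"
proof -
  have m: "m \<in> Mor \<A>" using assms by (simp add: monic_def)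
  have *: "(m \<odot> f) \<odot> x = Zero \<A> (Dom \<A> x) (Cod \<A> m) \<longleftrightarrow> f \<odot> x = Zero \<A> (Dom \<A> x) (Cod \<A> f)"
    if "x \<in> Mor \<A>" "Cod \<A> x = Dom \<A> f" for x
  proof
    assume "(m \<odot> f) \<odot> x = Zero \<A> (Dom \<A> x) (Cod \<A> m)"
    then show "f \<odot> x = Zero \<A> (Dom \<A> x) (Cod \<A> f)"
      using monic_Zero[OF assms(1), of "f \<odot> x" "Dom \<A> x" "Cod \<A> m"] that assms m by simp
  qed (use that assms m in simp)
  have **: "x \<in> Hom \<A> W (Dom \<A> f) \<Longrightarrow>
      (m \<odot> f) \<odot> x = Zero \<A> W (Cod \<A> m) \<longleftrightarrow> f \<odot> x = Zero \<A> W (Cod \<A> f)" for x W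
    using *[of x] by (auto simp: Hom_def)
  show ?thesis
    unfolding is_kernel_def using m assms * ** by (simp cong: conj_cong imp_cong)
qed

lemma is_cokernel_Comp_epic_iff:
  assumes "epic \<A> e" "f \<in> Mor \<A>" "Dom \<A> f = Cod \<A> e"
  shows "is_cokernel \<A> c (f \<odot> e) \<longleftrightarrow> is_cokernel \<A> c f"
  using abelian_category.is_kernel_Comp_monic_iff[OF abelian_opp, of e f c] assms by simp

lemma is_kernel_Comp_iso:
  assumes "is_kernel \<A> k f" "\<phi> \<in> Hom \<A> M (Dom \<A> k)" "\<psi> \<in> Hom \<A> (Dom \<A> k) M"
    "\<psi> \<odot> \<phi> = Id \<A> M" "\<phi> \<odot> \<psi> = Id \<A> (Dom \<A> k)"
  shows "is_kernel \<A> (k \<odot> \<phi>) f"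
proof -
  note k = is_kernelD[OF assms(1)] and t = HomD[OF assms(2)] HomD[OF assms(3)]
  show ?thesis
  proof (rule is_kernelI)
    have "monic \<A> \<phi>" using monic_if_retraction[of \<phi> \<psi>] t assms by simp
    then show "monic \<A> (k \<odot> \<phi>)" using monic_Comp k t by simp
    show "f \<odot> (k \<odot> \<phi>) = Zero \<A> (Dom \<A> (k \<odot> \<phi>)) (Cod \<A> f)"
      by (subst Comp_reassoc[OF k(4)]) (use k(1-3) t in auto)
    fix h assume "h \<in> Mor \<A>" "Cod \<A> h = Dom \<A> f" "f \<odot> h = Zero \<A> (Dom \<A> h) (Cod \<A> f)"
    then obtain u where u: "u \<in> Mor \<A>" "Dom \<A> u = Dom \<A> h" "Cod \<A> u = Dom \<A> k" "k \<odot> u = h"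
      using k(6) by metis
    then show "\<exists>u. u \<in> Mor \<A> \<and> Dom \<A> u = Dom \<A> h \<and> Cod \<A> u = Dom \<A> (k \<odot> \<phi>) \<and> (k \<odot> \<phi>) \<odot> u = h"
      using k(1) t Comp_reassoc[OF assms(5)] by (intro exI[of _ "\<psi> \<odot> u"]) simp
  qed (use k t in auto)
qed

lemma isomorphic_refl: "X \<in> Ob \<A> \<Longrightarrow> isomorphic \<A> X X"
  unfolding isomorphic_def by (intro bexI[of _ "Id \<A> X"]) (auto simp: Hom_def)

lemma is_image_exists: "f \<in> Mor \<A> \<Longrightarrow> \<exists>m. is_image \<A> m f"
  unfolding is_image_def using ex_cokernel ex_kernel by (metis is_cokernel_def)

text \<open>That the comparison map \<open>e\<close> is epic comes from normality. If
  \<open>t \<odot> e\<close> is zero and \<open>n\<close> is the kernel of \<open>t\<close>, then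
  \<open>m \<odot> n\<close> is the kernel of some \<open>g\<close> that kills \<open>f\<close>, so
  \<open>g\<close> factors through \<open>c\<close> and kills \<open>m\<close>. Hence
  \<open>m\<close> factors through \<open>m \<odot> n\<close>, which makes \<open>n\<close> split
  epic and \<open>t\<close> zero.\<close>

lemma is_image_factor:
  assumes "is_image \<A> m f"
  obtains e where "e \<in> Hom \<A> (Dom \<A> f) (Dom \<A> m)" "epic \<A> e" "m \<odot> e = f" "monic \<A> m"
proof -
  obtain c where c: "is_cokernel \<A> c f" "is_kernel \<A> m c" using assms by (auto simp: is_image_def)
  note m = is_kernelD[OF c(2)]
  have f: "f \<in> Mor \<A>" "Dom \<A> c = Cod \<A> f" "c \<odot> f = Zero \<A> (Dom \<A> f) (Cod \<A> c)"
    using c(1) by (auto simp: is_cokernel_def)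
  obtain e where e: "e \<in> Mor \<A>" "Dom \<A> e = Dom \<A> f" "Cod \<A> e = Dom \<A> m" "m \<odot> e = f"
    using m(6)[of f] f by auto
  have "epic \<A> e"
  proof (rule epicI[OF e(1)])
    fix t assume t: "t \<in> Mor \<A>" "Dom \<A> t = Cod \<A> e" "t \<odot> e = Zero \<A> (Dom \<A> e) (Cod \<A> t)"
    obtain n where "is_kernel \<A> n t" using ex_kernel t by blast
    note n = is_kernelD[OF this]
    obtain e' where e': "e' \<in> Mor \<A>" "Dom \<A> e' = Dom \<A> e" "Cod \<A> e' = Dom \<A> n" "n \<odot> e' = e"
      using n(6)[of e] e t by auto
    have "monic \<A> (m \<odot> n)" using monic_Comp[OF n(5) m(5)] n(3) t e by simp
    then obtain g where "is_kernel \<A> (m \<odot> n) g" using monic_normal by blast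
    note g = is_kernelD[OF this]
    have mn: "Dom \<A> m = Cod \<A> n" using n(3) t e by simp
    have gt: "Dom \<A> g = Cod \<A> m" using g(3) m(1) n(1) mn by simp
    have "g \<odot> ((m \<odot> n) \<odot> e') = Zero \<A> (Dom \<A> f) (Cod \<A> g)"
      by (subst Comp_reassoc[OF g(4)]) (use g(1,2) gt m(1) n(1) mn e e' in auto)
    then have "g \<odot> f = Zero \<A> (Dom \<A> f) (Cod \<A> g)"
      using m(1) n(1) mn e e' by simp
    then obtain w where w: "w \<in> Hom \<A> (Cod \<A> c) (Cod \<A> g)" "w \<odot> c = g"
      using c(1) g(2) gt m(3) f unfolding is_cokernel_def by (metis (mono_tags, lifting) Hom_def mem_Collect_eq)
    note wt = HomD[OF w(1)]
    have "g \<odot> m = w \<odot> (c \<odot> m)"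
      using Comp_reassoc[OF w(2), of m] m(1-3) wt by simp
    also have "\<dots> = Zero \<A> (Dom \<A> m) (Cod \<A> g)" using m(1,2,4) wt by simp
    finally obtain s where s: "s \<in> Mor \<A>" "Dom \<A> s = Dom \<A> m" "Cod \<A> s = Dom \<A> n" "(m \<odot> n) \<odot> s = m"
      using g(6)[of m] gt m(1) n(1) mn by auto
    have ns: "n \<odot> s = Id \<A> (Dom \<A> m)"
      by (rule monicD[OF m(5)]) (use s m(1) n(1) mn in auto)
    have "t \<odot> (n \<odot> s) = Zero \<A> (Dom \<A> m) (Cod \<A> t)"
      by (subst Comp_reassoc[OF n(4)]) (use n(1-3) s in auto)
    then show "t = Zero \<A> (Cod \<A> e) (Cod \<A> t)" using ns t e by simp
  qed
  then show thesis using that[of e] e m(5) by (auto simp: Hom_def)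
qed

text \<open>Cokernels of \<open>f\<close> are unique up to isomorphism, so any two images of
  \<open>f\<close> are kernels of one morphism and \<open>is_kernel_transfer\<close> applies. This
  frees later arguments from the witness hidden in \<open>exact_at\<close>.\<close>

lemma exact_at_is_kernel:
  assumes "exact_at \<A> f g" "is_image \<A> m f"
  shows "is_kernel \<A> m g"
proof -
  obtain l c where l: "is_cokernel \<A> c f" "is_kernel \<A> l c" "is_kernel \<A> l g"
    using assms(1) by (auto simp: exact_at_def is_image_def)
  obtain c' where c': "is_cokernel \<A> c' f" "is_kernel \<A> m c'" using assms(2) by (auto simp: is_image_def)
  obtain u where u: "u \<in> Hom \<A> (Cod \<A> c) (Cod \<A> c')" "u \<odot> c = c'"
    using l(1) c'(1) unfolding is_cokernel_def by (metis (mono_tags, lifting) Hom_def mem_Collect_eq)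
  obtain v where v: "v \<in> Hom \<A> (Cod \<A> c') (Cod \<A> c)" "v \<odot> c' = c"
    using l(1) c'(1) unfolding is_cokernel_def by (metis (mono_tags, lifting) Hom_def mem_Collect_eq)
  note t = HomD[OF u(1)] HomD[OF v(1)]
  have c: "epic \<A> c" "c \<in> Mor \<A>"
    using abelian_category.is_kernelD(1,5)[OF abelian_opp, of c f] l(1) by simp_all
  have "v \<odot> u = Id \<A> (Cod \<A> c)"
    by (rule epicD[OF c(1)]) (use t c u(2) v(2) in auto)
  then have "monic \<A> u" using monic_if_retraction[of u v] t by simp
  then have "is_kernel \<A> m c" using is_kernel_Comp_monic_iff[of u c m] c'(2) u(2) c(2) t by simp
  then show ?thesis using is_kernel_transfer[OF _ l(2,3)] by blast
qed

end

text \<open>The intended members are the cycles of the complexes in the definition of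
  \<open>Gorenstein\<close>. Exactness under the two Hom functors is encoded in the orthogonality of
  the cycles to \<C>. The conditions are monotone in \<W>, so unions of such classes are again such
  classes.\<close>

definition Gorenstein_class :: "('o, 'm, 'z) preadd_scheme \<Rightarrow> 'o set \<Rightarrow> 'o set \<Rightarrow> bool" where
  "Gorenstein_class \<A> \<C> \<W> \<longleftrightarrow> \<W> \<subseteq> Ob \<A> \<and> (\<forall>M\<in>\<W>.
     (\<forall>X\<in>\<C>. ext_split \<A> X M \<and> ext_split \<A> M X) \<and>
     (\<exists>X\<in>\<C>. \<exists>N\<in>\<W>. \<exists>f g. short_exact \<A> M f X g N) \<and>
     (\<exists>X\<in>\<C>. \<exists>N\<in>\<W>. \<exists>f g. short_exact \<A> N f X g M))"

lemma (in abelian_category) Gorenstein_class_opp [simp]: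
  "Gorenstein_class (opp \<A>) \<C> \<W> = Gorenstein_class \<A> \<C> \<W>"
  unfolding Gorenstein_class_def by simp blast

text \<open>The hypotheses collected here are self-dual, so results of this locale can be reused in
  \<open>opp\<close>. The condition on projectives waits for \<open>projectively_generated\<close>,
  since it would dualise to one on injectives.\<close>

locale self_orthogonal = abelian_category +
  fixes \<C>
  assumes subcat: "subcategory \<A> \<C>"
    and orth: "\<lbrakk>X \<in> \<C>; Y \<in> \<C>\<rbrakk> \<Longrightarrow> ext_split \<A> X Y"
begin

lemma C_Ob: "X \<in> \<C> \<Longrightarrow> X \<in> Ob \<A>"
  using subcat unfolding subcategory_def by blast

lemma self_orthogonal_opp: "self_orthogonal (opp \<A>) \<C>"
  using abelian_opp subcat orth
  by (simp add: self_orthogonal_def self_orthogonal_axioms_def)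

text \<open>The class consists of the images of all differentials. Their orthogonality to \<C> on
  either side combines Hom-exactness of the complex with the self-orthogonality of \<C>, through
  \<open>ext_split_kernel\<close> and its dual.\<close>

lemma Gorenstein_imp_class:
  assumes "M \<in> Gorenstein \<A> \<C>"
  shows "\<exists>\<W>. Gorenstein_class \<A> \<C> \<W> \<and> M \<in> \<W>"
proof -
  obtain d m0 where ex: "\<And>n. exact_at \<A> (d n) (d (n + 1))" and dC: "\<And>n. Dom \<A> (d n) \<in> \<C>"
    and le: "Hom_left_exact \<A> \<C> d" and re: "Hom_right_exact \<A> \<C> d"
    and m0: "is_image \<A> m0 (d (-1))" "isomorphic \<A> M (Dom \<A> m0)"
    using assms by (auto simp: Gorenstein_def exact_sequence_def)
  have d: "d n \<in> Mor \<A>" "Cod \<A> (d n) = Dom \<A> (d (n + 1))" for n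
    using ex[of n] by (auto simp: exact_at_def)
  obtain \<phi> \<psi> where \<phi>: "\<phi> \<in> Hom \<A> M (Dom \<A> m0)" "\<psi> \<in> Hom \<A> (Dom \<A> m0) M"
    "\<psi> \<odot> \<phi> = Id \<A> M" "\<phi> \<odot> \<psi> = Id \<A> (Dom \<A> m0)"
    using m0(2) by (auto simp: isomorphic_def)
  \<comment> \<open>Composing with the isomorphism makes \<open>M\<close> itself, and not merely a
    copy of it, the source of an image of \<open>d (-1)\<close>.\<close>
  have im: "is_image \<A> (m0 \<odot> \<phi>) (d (-1))"
    using m0(1) is_kernel_Comp_iso[OF _ \<phi>] unfolding is_image_def by blast
  have "m0 \<in> Mor \<A>" using m0(1) by (auto simp: is_image_def is_kernel_def)
  then have domM: "Dom \<A> (m0 \<odot> \<phi>) = M" using HomD[OF \<phi>(1)] by simp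
  define \<W> where "\<W> = {Dom \<A> m |m n. is_image \<A> m (d n)}"
  have ses: "short_exact \<A> (Dom \<A> m) m (Dom \<A> (d (n + 1))) e (Dom \<A> l)"
    if "is_image \<A> m (d n)" "l \<odot> e = d (n + 1)" "epic \<A> e" "monic \<A> l" "e \<in> Hom \<A> (Dom \<A> (d (n + 1))) (Dom \<A> l)"
    for m l n e
  proof -
    have "is_kernel \<A> m (l \<odot> e)" using exact_at_is_kernel[OF ex that(1)] that(2) by simp
    then have "is_kernel \<A> m e" using is_kernel_Comp_monic_iff[OF that(4), of e m] HomD[OF that(5)] by simp
    from short_exactI[OF this that(3)] show ?thesis using HomD[OF that(5)] by simp
  qed
  have "Gorenstein_class \<A> \<C> \<W>"
    unfolding Gorenstein_class_def
  proof (intro conjI ballI)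
    show "\<W> \<subseteq> Ob \<A>" by (auto simp: \<W>_def is_image_def is_kernel_def)
    fix N assume "N \<in> \<W>"
    then obtain m n where m: "is_image \<A> m (d n)" "N = Dom \<A> m" by (auto simp: \<W>_def)
    obtain l where l: "is_image \<A> l (d (n + 1))" using is_image_exists d by blast
    obtain k where k: "is_image \<A> k (d (n - 1))" using is_image_exists d by blast
    obtain e where e: "e \<in> Hom \<A> (Dom \<A> (d (n + 1))) (Dom \<A> l)" "epic \<A> e" "l \<odot> e = d (n + 1)" "monic \<A> l"
      using is_image_factor[OF l] by blast
    obtain b where b: "b \<in> Hom \<A> (Dom \<A> (d n)) N" "epic \<A> b" "m \<odot> b = d n" "monic \<A> m"
      using is_image_factor[OF m(1)] m(2) by blast
    obtain a where a: "a \<in> Hom \<A> (Dom \<A> (d (n - 1))) (Dom \<A> k)" "epic \<A> a" "k \<odot> a = d (n - 1)" "monic \<A> k"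
      using is_image_factor[OF k] by blast
    have s1: "short_exact \<A> N m (Dom \<A> (d (n + 1))) e (Dom \<A> l)"
      using ses[OF m(1) e(3,2,4,1)] m(2) by simp
    have s2: "short_exact \<A> (Dom \<A> k) k (Dom \<A> (d n)) b N"
      using ses[OF k, of m b] b m(2) by simp
    note t = short_exactD[OF s1] short_exactD[OF s2]
    have "Dom \<A> l \<in> \<W>" "Dom \<A> k \<in> \<W>" unfolding \<W>_def using l k by blast+
    then show "\<exists>X\<in>\<C>. \<exists>N'\<in>\<W>. \<exists>f g. short_exact \<A> N f X g N'"
      and "\<exists>X\<in>\<C>. \<exists>N'\<in>\<W>. \<exists>f g. short_exact \<A> N' f X g N"
      using s1 s2 dC by blast+
    fix X assume X: "X \<in> \<C>"
    have lk: "is_kernel \<A> l (d (n + 1 + 1))" using exact_at_is_kernel[OF ex l] .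
    note lt = is_kernelD[OF lk]
    show "ext_split \<A> X N"
    proof (rule ext_split_kernel[OF s1 orth[OF X dC]])
      fix h assume h: "h \<in> Hom \<A> X (Dom \<A> l)"
      note ht = HomD[OF h]
      \<comment> \<open>\<open>l \<odot> h\<close> is a cycle, hence of the form
        \<open>d (n + 1) \<odot> y\<close>; cancelling the monomorphism \<open>l\<close> shows that
        \<open>e \<odot> y\<close> is \<open>h\<close>.\<close>
      have "d (n + 1 + 1) \<odot> (l \<odot> h) = Zero \<A> X (Cod \<A> (d (n + 1 + 1)))"
        by (subst Comp_reassoc[OF lt(4)]) (use ht lt(1-3) in auto)
      then have "l \<odot> h \<in> {h \<in> Hom \<A> X (Dom \<A> (d (n + 1 + 1))). d (n + 1 + 1) \<odot> h = Zero \<A> X (Cod \<A> (d (n + 1 + 1)))}"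
        using ht lt(1-3) by (auto simp: Hom_def)
      also have "\<dots> = (\<lambda>h. d (n + 1) \<odot> h) ` Hom \<A> X (Dom \<A> (d (n + 1)))"
        using le[unfolded Hom_left_exact_def, rule_format, OF X, of "n + 1"] by (rule sym)
      finally obtain y where y: "y \<in> Hom \<A> X (Dom \<A> (d (n + 1)))" "d (n + 1) \<odot> y = l \<odot> h" by auto
      note yt = HomD[OF y(1)]
      have "l \<odot> (e \<odot> y) = l \<odot> h"
        by (subst Comp_reassoc[OF e(3)]) (use y(2) yt t lt(1) in auto)
      then have "e \<odot> y = h" using monicD[OF e(4), of "e \<odot> y" h] yt t ht by simp
      then show "\<exists>k\<in>Hom \<A> X (Dom \<A> (d (n + 1))). e \<odot> k = h" using y(1) by blast
    qed
    show "ext_split \<A> N X"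
    proof (rule ext_split_cokernel[OF s2 orth[OF dC X]])
      fix h assume h: "h \<in> Hom \<A> (Dom \<A> k) X"
      note ht = HomD[OF h] and at = HomD[OF a(1)]
      \<comment> \<open>The zero composite makes \<open>h \<odot> a\<close> a cocycle on the term in
        position \<open>n - 1\<close>; Hom-exactness there extends \<open>h\<close> along
        \<open>k\<close>.\<close>
      have dd: "d (n - 1) \<odot> d (n - 2) = Zero \<A> (Dom \<A> (d (n - 2))) (Cod \<A> (d (n - 1)))"
      proof -
        obtain l' where l': "is_image \<A> l' (d (n - 2))" using is_image_exists d by blast
        obtain b' where b': "b' \<in> Hom \<A> (Dom \<A> (d (n - 2))) (Dom \<A> l')" "l' \<odot> b' = d (n - 2)"
          using is_image_factor[OF l'] by blast
        have "is_kernel \<A> l' (d (n - 1))" using exact_at_is_kernel[OF ex[of "n - 2"] l'] by simp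
        note l'' = is_kernelD[OF this]
        have "d (n - 1) \<odot> (l' \<odot> b') = Zero \<A> (Dom \<A> (d (n - 2))) (Cod \<A> (d (n - 1)))"
          by (subst Comp_reassoc[OF l''(4)]) (use l''(1-3) HomD[OF b'(1)] in auto)
        then show ?thesis using b'(2) by simp
      qed
      have dc: "Cod \<A> (d (n - 2)) = Dom \<A> (d (n - 1))" using d(2)[of "n - 2"] by simp
      have "k \<odot> (a \<odot> d (n - 2)) = d (n - 1) \<odot> d (n - 2)"
        by (rule Comp_reassoc[OF a(3)]) (use at t d dc in auto)
      then have "a \<odot> d (n - 2) = Zero \<A> (Dom \<A> (d (n - 2))) (Dom \<A> k)"
        using monic_Zero[OF a(4), of "a \<odot> d (n - 2)"] dd dc at t d by simp
      then have "h \<odot> a \<in> {h \<in> Hom \<A> (Cod \<A> (d (n - 2))) X. h \<odot> d (n - 2) = Zero \<A> (Dom \<A> (d (n - 2))) X}"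
        using ht at d dc by (auto simp: Hom_def)
      also have "\<dots> = (\<lambda>h. h \<odot> d (n - 1)) ` Hom \<A> (Cod \<A> (d (n - 1))) X"
        using re[unfolded Hom_right_exact_def, rule_format, OF X, of "n - 2"] by simp
      finally obtain y where y: "y \<in> Hom \<A> (Cod \<A> (d (n - 1))) X" "y \<odot> d (n - 1) = h \<odot> a" by auto
      have dk: "Cod \<A> (d (n - 1)) = Dom \<A> (d n)" using d(2)[of "n - 1"] by simp
      note yt = HomD[OF y(1)]
      have "(y \<odot> k) \<odot> a = h \<odot> a" using y(2) a(3) yt t at dk by simp
      then have "y \<odot> k = h" using epicD[OF a(2), of "y \<odot> k" h] yt t at ht dk by simp
      then show "\<exists>y\<in>Hom \<A> (Dom \<A> (d n)) X. y \<odot> k = h" using y(1) dk by auto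
    qed
  qed
  moreover have "M \<in> \<W>" unfolding \<W>_def using im domM by force
  ultimately show ?thesis by blast
qed

end

text \<open>Adding the identity of \<open>X\<close> to \<open>u\<close> leaves the cokernel
  unchanged. The horseshoe construction uses this to enlarge one summand of a biproduct.\<close>

lemma (in abelian_category) is_biproduct_short_exact_sum:
  assumes S: "is_biproduct \<A> X A S i j p q" and T: "is_biproduct \<A> X B T i' j' p' q'"
    and s: "short_exact \<A> A u B v D"
  shows "short_exact \<A> S ((i' \<odot> p) \<boxplus> (j' \<odot> (u \<odot> q))) T (v \<odot> q') D"
proof -
  note a = is_biproductD[OF S] and b = is_biproductD[OF T] and t = short_exactD[OF s]
  define w where "w = (i' \<odot> p) \<boxplus> (j' \<odot> (u \<odot> q))"
  have w: "w \<in> Mor \<A>" "Dom \<A> w = S" "Cod \<A> w = T" using a b t by (simp_all add: w_def)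
  note r = a(16,17,19,20)[THEN Comp_reassoc] b(16,17,19,20)[THEN Comp_reassoc] t(10)[THEN Comp_reassoc]
  have pw: "p' \<odot> w = p" "q' \<odot> w = u \<odot> q" unfolding w_def using a b t r by simp_all
  note rw = pw[THEN Comp_reassoc]
  have "is_kernel \<A> w (v \<odot> q')"
  proof (rule is_kernelI)
    show "monic \<A> w"
    proof (rule monicI[OF w(1)])
      fix x assume x: "x \<in> Mor \<A>" "Cod \<A> x = Dom \<A> w" "w \<odot> x = Zero \<A> (Dom \<A> x) (Cod \<A> w)"
      have "p \<odot> x = p' \<odot> (w \<odot> x)" by (rule Comp_reassoc[OF pw(1), symmetric]) (use x w b in auto)
      also have "\<dots> = Zero \<A> (Dom \<A> x) X" using x w b by simp
      finally have px: "p \<odot> x = Zero \<A> (Dom \<A> x) X" .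
      have "(u \<odot> q) \<odot> x = q' \<odot> (w \<odot> x)" by (rule Comp_reassoc[OF pw(2), symmetric]) (use x w b in auto)
      also have "\<dots> = Zero \<A> (Dom \<A> x) B" using x w b by simp
      finally have "u \<odot> (q \<odot> x) = Zero \<A> (Dom \<A> x) B" using x w a t by simp
      then have "q \<odot> x = Zero \<A> (Dom \<A> x) A"
        using monic_Zero[OF t(11), of "q \<odot> x"] x w a t by simp
      then show "x = Zero \<A> (Dom \<A> x) (Dom \<A> w)"
        using is_biproduct_expand(1)[OF S x(1)] px x w a by simp
    qed
    have "(v \<odot> q') \<odot> w = v \<odot> (u \<odot> q)" using pw(2) w b t by simp
    also have "\<dots> = Zero \<A> S D" by (subst Comp_reassoc[OF t(10)]) (use a t in auto)
    finally show "(v \<odot> q') \<odot> w = Zero \<A> (Dom \<A> w) (Cod \<A> (v \<odot> q'))" using w b t by simp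
    fix h assume h: "h \<in> Mor \<A>" "Cod \<A> h = Dom \<A> (v \<odot> q')" "(v \<odot> q') \<odot> h = Zero \<A> (Dom \<A> h) (Cod \<A> (v \<odot> q'))"
    have "v \<odot> (q' \<odot> h) = Zero \<A> (Dom \<A> h) D" using h b t by simp
    then obtain k where k: "k \<in> Mor \<A>" "Dom \<A> k = Dom \<A> h" "Cod \<A> k = A" "u \<odot> k = q' \<odot> h"
      using short_exact_lift[OF s, of "q' \<odot> h" "Dom \<A> h"] h b t by auto
    define y where "y = (i \<odot> (p' \<odot> h)) \<boxplus> (j \<odot> k)"
    have hc: "Cod \<A> h = T" using h b t by simp
    have y: "y \<in> Mor \<A>" "Dom \<A> y = Dom \<A> h" "Cod \<A> y = S" using a b k h hc by (simp_all add: y_def)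
    have "p \<odot> y = p' \<odot> h" "q \<odot> y = k" unfolding y_def using a b k h hc r by simp_all
    then have "w \<odot> y = (i' \<odot> (p' \<odot> h)) \<boxplus> (j' \<odot> (q' \<odot> h))"
      unfolding w_def using a b t y k by simp
    then have "w \<odot> y = h" using is_biproduct_expand(1)[OF T h(1) hc] by simp
    then show "\<exists>y. y \<in> Mor \<A> \<and> Dom \<A> y = Dom \<A> h \<and> Cod \<A> y = Dom \<A> w \<and> w \<odot> y = h"
      using y w by auto
  qed (use w b t in auto)
  moreover have "epic \<A> (v \<odot> q')"
  proof (rule epicI)
    fix x assume x: "x \<in> Mor \<A>" "Dom \<A> x = Cod \<A> (v \<odot> q')" "x \<odot> (v \<odot> q') = Zero \<A> (Dom \<A> (v \<odot> q')) (Cod \<A> x)"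
    have "(x \<odot> (v \<odot> q')) \<odot> j' = x \<odot> v" using x(1,2) b t r by simp
    then have "x \<odot> v = Zero \<A> B (Cod \<A> x)" using x b t by simp
    then show "x = Zero \<A> (Cod \<A> (v \<odot> q')) (Cod \<A> x)"
      using epic_Zero[OF t(12), of x B] x b t by simp
  qed (use b t in simp)
  ultimately show ?thesis using short_exactI[of w "v \<odot> q'"] w b t unfolding w_def by simp
qed

lemma (in abelian_category) short_exact_zero_left:
  assumes Z: "is_zero_object \<A> Z" and X: "X \<in> Ob \<A>"
  shows "short_exact \<A> Z (Zero \<A> Z X) X (Id \<A> X) X"
proof -
  have ZO: "Z \<in> Ob \<A>" using Z by (simp add: is_zero_object_def)
  have "monic \<A> (Zero \<A> Z X)"
  proof (rule monicI)
    fix x assume x: "x \<in> Mor \<A>" "Cod \<A> x = Dom \<A> (Zero \<A> Z X)"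
    then have "Cod \<A> x = Z" "Dom \<A> x \<in> Ob \<A>" using X ZO by auto
    then have "x \<in> Hom \<A> (Dom \<A> x) Z" "Zero \<A> (Dom \<A> x) Z \<in> Hom \<A> (Dom \<A> x) Z"
      using x ZO by (auto simp: Hom_def)
    then have "x = Zero \<A> (Dom \<A> x) Z"
      using Z \<open>Dom \<A> x \<in> Ob \<A>\<close> unfolding is_zero_object_def by blast
    then show "x = Zero \<A> (Dom \<A> x) (Dom \<A> (Zero \<A> Z X))" using X ZO by simp
  qed (use X ZO in simp)
  then have "is_kernel \<A> (Zero \<A> Z X) (Id \<A> X)"
  proof (rule is_kernelI)
    fix h assume h: "h \<in> Mor \<A>" "Cod \<A> h = Dom \<A> (Id \<A> X)" "Id \<A> X \<odot> h = Zero \<A> (Dom \<A> h) (Cod \<A> (Id \<A> X))"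
    then show "\<exists>u. u \<in> Mor \<A> \<and> Dom \<A> u = Dom \<A> h \<and> Cod \<A> u = Dom \<A> (Zero \<A> Z X) \<and> Zero \<A> Z X \<odot> u = h"
      using X ZO by (intro exI[of _ "Zero \<A> (Dom \<A> h) Z"]) simp
  qed (use X ZO in auto)
  moreover have "epic \<A> (Id \<A> X)" using X by (intro epicI) auto
  ultimately show ?thesis using short_exactI[of "Zero \<A> Z X" "Id \<A> X"] X ZO by simp
qed

lemma (in abelian_category) short_exact_zero_right:
  assumes "is_zero_object \<A> Z" "X \<in> Ob \<A>"
  shows "short_exact \<A> X (Id \<A> X) X (Zero \<A> X Z) Z"
  using abelian_category.short_exact_zero_left[OF abelian_opp, of Z X] assms by simp

context self_orthogonal
begin

text \<open>Syzygies and cosyzygies of \<open>M\<close> are chosen repeatedly inside \<W> and the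
  short exact sequences spliced. Hom-exactness of the result is the vanishing of
  \<open>Ext^1\<close> between \<C> and the cycles.\<close>

lemma Gorenstein_class_imp:
  assumes W: "Gorenstein_class \<A> \<C> \<W>" and M: "M \<in> \<W>"
  shows "M \<in> Gorenstein \<A> \<C>"
proof -
  have "\<forall>N\<in>\<W>. \<exists>L. L \<in> \<W> \<and> (\<exists>X\<in>\<C>. \<exists>f g. short_exact \<A> N f X g L)"
    and "\<forall>N\<in>\<W>. \<exists>L. L \<in> \<W> \<and> (\<exists>X\<in>\<C>. \<exists>f g. short_exact \<A> L f X g N)"
    using W unfolding Gorenstein_class_def by blast+
  then obtain up dn where up: "\<And>N. N \<in> \<W> \<Longrightarrow> up N \<in> \<W> \<and> (\<exists>X\<in>\<C>. \<exists>f g. short_exact \<A> N f X g (up N))"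
    and dn: "\<And>N. N \<in> \<W> \<Longrightarrow> dn N \<in> \<W> \<and> (\<exists>X\<in>\<C>. \<exists>f g. short_exact \<A> (dn N) f X g N)"
    by (metis (no_types, lifting) bchoice)
  \<comment> \<open>\<open>S n\<close> is the cycle object in position \<open>n\<close>: iterated
    cosyzygies for positive \<open>n\<close>, iterated syzygies for negative \<open>n\<close>, and
    \<open>M\<close> at 0.\<close>
  define S :: "int \<Rightarrow> 'a" where "S n = (if n \<ge> 0 then (up ^^ nat n) M else (dn ^^ nat (- n)) M)" for n
  have upW: "(up ^^ k) M \<in> \<W>" and dnW: "(dn ^^ k) M \<in> \<W>" for k
    by (induction k) (use M up dn in auto)
  have SW: "S n \<in> \<W>" for n using upW dnW by (simp add: S_def)
  have "\<exists>B f g. B \<in> \<C> \<and> short_exact \<A> (S n) f B g (S (n + 1))" for n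
  proof (cases "n \<ge> 0")
    case True
    then have "S (n + 1) = up (S n)" by (simp add: S_def nat_add_distrib)
    then show ?thesis using up[OF SW[of n]] by auto
  next
    case False
    then have "nat (- n) = Suc (nat (- (n + 1)))" by linarith
    then have "S n = dn (S (n + 1))" using False by (auto simp: S_def)
    then show ?thesis using dn[OF SW[of "n + 1"]] by auto
  qed
  then obtain B a b where BC: "\<And>n. B n \<in> \<C>"
    and s: "\<And>n. short_exact \<A> (S n) (a n) (B n) (b n) (S (n + 1))"
    by metis
  note t = s[THEN short_exactD(1)] s[THEN short_exactD(2)] s[THEN short_exactD(3)] s[THEN short_exactD(4)]
    s[THEN short_exactD(5)] s[THEN short_exactD(6)]
  \<comment> \<open>The shift by one makes \<open>S (n + 1)\<close> the image of \<open>d n\<close>,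
    so that \<open>M = S 0\<close> is the image of \<open>d (-1)\<close> as
    \<open>Gorenstein\<close> demands.\<close>
  define d where "d n = a (n + 1) \<odot> b n" for n
  have d: "d n \<in> Mor \<A>" "Dom \<A> (d n) = B n" "Cod \<A> (d n) = B (n + 1)" for n
    using t by (simp_all add: d_def)
  have ker: "is_kernel \<A> (a n) (d n)" for n
    unfolding d_def
    using is_kernel_Comp_monic_iff[OF short_exactD(11)[OF s], of "b n" "n + 1" "a n"]
      short_exactD(13)[OF s, of n] t by simp
  have coker: "is_cokernel \<A> (b (n + 1)) (d n)" for n
    unfolding d_def
    using is_cokernel_Comp_epic_iff[OF short_exactD(12)[OF s], of "a (n + 1)" n "b (n + 1)"]
      short_exactD(14)[OF s, of "n + 1"] t by simp
  have im: "is_image \<A> (a (n + 1)) (d n)" for n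
    unfolding is_image_def using coker short_exactD(13)[OF s] by blast
  have dd: "d (n + 1) \<odot> d n = Zero \<A> (B n) (B (n + 1 + 1))" for n
  proof -
    note k = is_kernelD(4)[OF ker, of "n + 1"]
    have "d (n + 1) \<odot> (a (n + 1) \<odot> b n) = Zero \<A> (B n) (B (n + 1 + 1))"
      by (subst Comp_reassoc[OF k]) (use t d C_Ob[OF BC] in auto)
    then show ?thesis by (simp add: d_def)
  qed
  have le: "Hom_left_exact \<A> \<C> d"
    unfolding Hom_left_exact_def d
  proof (intro ballI allI equalityI subsetI)
    fix X n h assume X: "X \<in> \<C>" and "h \<in> (\<lambda>h. d n \<odot> h) ` Hom \<A> X (B n)"
    then obtain y where y: "y \<in> Hom \<A> X (B n)" "h = d n \<odot> y" by blast
    note yt = HomD[OF y(1)]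
    have "d (n + 1) \<odot> (d n \<odot> y) = Zero \<A> X (B (n + 1 + 1))"
      by (subst Comp_reassoc[OF dd]) (use yt d C_Ob[OF BC] in auto)
    then show "h \<in> {h \<in> Hom \<A> X (B (n + 1)). d (n + 1) \<odot> h = Zero \<A> X (B (n + 1 + 1))}"
      using y yt d by (auto simp: Hom_def)
  next
    fix X n h assume X: "X \<in> \<C>"
      and h: "h \<in> {h \<in> Hom \<A> X (B (n + 1)). d (n + 1) \<odot> h = Zero \<A> X (B (n + 1 + 1))}"
    then have ht: "h \<in> Mor \<A>" "Dom \<A> h = X" "Cod \<A> h = B (n + 1)"
      "d (n + 1) \<odot> h = Zero \<A> X (B (n + 1 + 1))" by (auto simp: Hom_def)
    obtain u where u: "u \<in> Mor \<A>" "Dom \<A> u = X" "Cod \<A> u = S (n + 1)" "a (n + 1) \<odot> u = h"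
      using is_kernelD(6)[OF ker, of h "n + 1"] ht d t by auto
    \<comment> \<open>The cycle \<open>h\<close> factors through \<open>S (n + 1)\<close>, and
      vanishing of \<open>Ext^1(X, S n)\<close> lifts it further to \<open>B n\<close>.\<close>
    have "ext_split \<A> X (S n)" using W SW X unfolding Gorenstein_class_def by blast
    from ext_split_lift[OF this s, of u]
    obtain k where k: "k \<in> Hom \<A> X (B n)" "b n \<odot> k = u" using u by (auto simp: Hom_def)
    have "h = d n \<odot> k" using k(2) u(4) HomD[OF k(1)] t by (simp add: d_def)
    then show "h \<in> (\<lambda>h. d n \<odot> h) ` Hom \<A> X (B n)" using k by blast
  qed
  have re: "Hom_right_exact \<A> \<C> d"
    unfolding Hom_right_exact_def d
  proof (intro ballI allI equalityI subsetI)
    fix X n h assume X: "X \<in> \<C>" and "h \<in> (\<lambda>h. h \<odot> d (n + 1)) ` Hom \<A> (B (n + 1 + 1)) X"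
    then obtain y where y: "y \<in> Hom \<A> (B (n + 1 + 1)) X" "h = y \<odot> d (n + 1)" by blast
    note yt = HomD[OF y(1)]
    have "h \<odot> d n = Zero \<A> (B n) X" using y(2) yt d dd C_Ob[OF BC] by simp
    then show "h \<in> {h \<in> Hom \<A> (B (n + 1)) X. h \<odot> d n = Zero \<A> (B n) X}"
      using y yt d by (auto simp: Hom_def)
  next
    fix X n h assume X: "X \<in> \<C>"
      and h: "h \<in> {h \<in> Hom \<A> (B (n + 1)) X. h \<odot> d n = Zero \<A> (B n) X}"
    then have ht: "h \<in> Mor \<A>" "Cod \<A> h = X" "Dom \<A> h = B (n + 1)" "h \<odot> d n = Zero \<A> (B n) X"
      by (auto simp: Hom_def)
    obtain u where u: "u \<in> Mor \<A>" "Cod \<A> u = X" "Dom \<A> u = S (n + 1 + 1)" "u \<odot> b (n + 1) = h"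
      using abelian_category.is_kernelD(6)[OF abelian_opp, of "b (n + 1)" "d n" h] coker[of n] ht d t by auto
    \<comment> \<open>The map \<open>u\<close> lives on \<open>S (n + 2)\<close>; the obstruction to
      extending it over \<open>B (n + 2)\<close> lies in \<open>Ext^1\<close> of the quotient
      \<open>S (n + 3)\<close>.\<close>
    have "ext_split \<A> (S (n + 1 + 1 + 1)) X" using W SW X unfolding Gorenstein_class_def by blast
    from ext_split_extend[OF this s, of u]
    obtain k where k: "k \<in> Hom \<A> (B (n + 1 + 1)) X" "k \<odot> a (n + 1 + 1) = u" using u by (auto simp: Hom_def)
    have "k \<odot> (a (n + 1 + 1) \<odot> b (n + 1)) = u \<odot> b (n + 1)"
      by (rule Comp_reassoc[OF k(2)]) (use t HomD[OF k(1)] in auto)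
    then have "h = k \<odot> d (n + 1)" using u(4) by (simp add: d_def)
    then show "h \<in> (\<lambda>h. h \<odot> d (n + 1)) ` Hom \<A> (B (n + 1 + 1)) X" using k by blast
  qed
  have ex: "exact_sequence \<A> d"
    unfolding exact_sequence_def exact_at_def
  proof (intro allI conjI)
    fix n
    show "\<exists>m. is_image \<A> m (d n) \<and> is_kernel \<A> m (d (n + 1))" using im ker by blast
  qed (use d in auto)
  have S0: "S 0 = M" by (simp add: S_def)
  have MO: "M \<in> Ob \<A>" using short_exactD(7)[OF s[of 0]] S0 by simp
  have "is_image \<A> (a 0) (d (-1))" "isomorphic \<A> M (Dom \<A> (a 0))"
    using im[of "-1"] S0 isomorphic_refl[OF MO] t(2)[of 0] by simp_all
  then show ?thesis unfolding Gorenstein_def using MO ex le re d BC by auto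
qed

section \<open>Closure properties by coinduction\<close>

lemma Gorenstein_iff_class:
  "M \<in> Gorenstein \<A> \<C> \<longleftrightarrow> (\<exists>\<W>. Gorenstein_class \<A> \<C> \<W> \<and> M \<in> \<W>)"
  using Gorenstein_imp_class Gorenstein_class_imp by blast

lemma Gorenstein_opp [simp]: "Gorenstein (opp \<A>) \<C> = Gorenstein \<A> \<C>"
  using Gorenstein_iff_class self_orthogonal.Gorenstein_iff_class[OF self_orthogonal_opp] by auto

lemma Gorenstein_class_Gorenstein: "Gorenstein_class \<A> \<C> (Gorenstein \<A> \<C>)"
proof -
  have "Gorenstein \<A> \<C> = \<Union> {\<W>. Gorenstein_class \<A> \<C> \<W>}"
    using Gorenstein_iff_class by blast
  then show ?thesis unfolding Gorenstein_class_def by (simp only:) blast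
qed

lemma Gorenstein_Ob: "M \<in> Gorenstein \<A> \<C> \<Longrightarrow> M \<in> Ob \<A>"
  using Gorenstein_class_Gorenstein unfolding Gorenstein_class_def by blast

lemma Gorenstein_orth:
  assumes "M \<in> Gorenstein \<A> \<C>" "X \<in> \<C>"
  shows "ext_split \<A> X M" "ext_split \<A> M X"
  using Gorenstein_class_Gorenstein assms unfolding Gorenstein_class_def by blast+

lemma Gorenstein_right:
  assumes "M \<in> Gorenstein \<A> \<C>"
  obtains X N f g where "X \<in> \<C>" "N \<in> Gorenstein \<A> \<C>" "short_exact \<A> M f X g N"
  using Gorenstein_class_Gorenstein assms unfolding Gorenstein_class_def by blast

lemma Gorenstein_left:
  assumes "M \<in> Gorenstein \<A> \<C>"
  obtains X N f g where "X \<in> \<C>" "N \<in> Gorenstein \<A> \<C>" "short_exact \<A> N f X g M"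
  using Gorenstein_class_Gorenstein assms unfolding Gorenstein_class_def by blast

text \<open>Coinduction up to known Gorenstein objects: syzygies and cosyzygies may leave \<W> for
  \<open>Gorenstein\<close>, since the union of the two is again a class.\<close>

lemma Gorenstein_coinduct:
  assumes "M \<in> \<W>"
    and "\<And>M X. \<lbrakk>M \<in> \<W>; X \<in> \<C>\<rbrakk> \<Longrightarrow> ext_split \<A> X M \<and> ext_split \<A> M X"
    and "\<And>M. M \<in> \<W> \<Longrightarrow> \<exists>X\<in>\<C>. \<exists>N\<in>\<W> \<union> Gorenstein \<A> \<C>. \<exists>f g. short_exact \<A> M f X g N"
    and "\<And>M. M \<in> \<W> \<Longrightarrow> \<exists>X\<in>\<C>. \<exists>N\<in>\<W> \<union> Gorenstein \<A> \<C>. \<exists>f g. short_exact \<A> N f X g M"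
  shows "M \<in> Gorenstein \<A> \<C>"
proof -
  have WO: "\<W> \<subseteq> Ob \<A>"
  proof
    fix M assume "M \<in> \<W>"
    then obtain X N f g where "short_exact \<A> M f X g N" using assms(3) by blast
    then show "M \<in> Ob \<A>" by (rule short_exactD(7))
  qed
  note G = Gorenstein_class_Gorenstein[unfolded Gorenstein_class_def]
  have "Gorenstein_class \<A> \<C> (\<W> \<union> Gorenstein \<A> \<C>)"
    unfolding Gorenstein_class_def
  proof (intro conjI ballI)
    show "\<W> \<union> Gorenstein \<A> \<C> \<subseteq> Ob \<A>" using WO G by blast
    fix M assume M: "M \<in> \<W> \<union> Gorenstein \<A> \<C>"
    show "ext_split \<A> X M" "ext_split \<A> M X" if "X \<in> \<C>" for X
      using M assms(2)[OF _ that] G that by blast+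
    show "\<exists>X\<in>\<C>. \<exists>N\<in>\<W> \<union> Gorenstein \<A> \<C>. \<exists>f g. short_exact \<A> M f X g N"
      using M assms(3) G by (elim UnE) (blast, meson UnI2)
    show "\<exists>X\<in>\<C>. \<exists>N\<in>\<W> \<union> Gorenstein \<A> \<C>. \<exists>f g. short_exact \<A> N f X g M"
      using M assms(4) G by (elim UnE) (blast, meson UnI2)
  qed
  then show ?thesis using Gorenstein_class_imp assms(1) by blast
qed

text \<open>Identities serve as resolutions, with zero as syzygy and cosyzygy, so \<C> itself is a
  class.\<close>

lemma C_subset_Gorenstein: "\<C> \<subseteq> Gorenstein \<A> \<C>"
proof
  obtain Z where Z: "Z \<in> \<C>" "is_zero_object \<A> Z" using subcat unfolding subcategory_def by blast
  fix X assume X: "X \<in> \<C>"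
  have "Gorenstein_class \<A> \<C> \<C>"
    unfolding Gorenstein_class_def
    using orth C_Ob Z(1) short_exact_zero_left[OF Z(2)] short_exact_zero_right[OF Z(2)]
    by (intro conjI ballI) blast+
  then show "X \<in> Gorenstein \<A> \<C>" using Gorenstein_class_imp X by blast
qed

text \<open>One half of the horseshoe. Pushing out along \<open>M' \<rightarrow> C1\<close> gives
  \<open>E\<close>, which contains \<open>M\<close> with cokernel \<open>N1\<close> and is
  \<open>C1 \<oplus> M''\<close> because \<open>Ext^1(M'', C1) = 0\<close>. Then \<open>E\<close>
  embeds in \<open>C1 \<oplus> C2\<close> with cokernel \<open>N2\<close>, and the cokernel
  \<open>N\<close> of the composite is an extension of \<open>N2\<close> by
  \<open>N1\<close>.\<close>

lemma Gorenstein_extension_right: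
  assumes M: "M' \<in> Gorenstein \<A> \<C>" "M'' \<in> Gorenstein \<A> \<C>" and s: "short_exact \<A> M' f M g M''"
  obtains X N N' N'' a b c e where "X \<in> \<C>" "N' \<in> Gorenstein \<A> \<C>" "N'' \<in> Gorenstein \<A> \<C>"
    "short_exact \<A> M a X b N" "short_exact \<A> N' c N e N''"
proof -
  obtain C1 N1 a1 b1 where 1: "C1 \<in> \<C>" "N1 \<in> Gorenstein \<A> \<C>" "short_exact \<A> M' a1 C1 b1 N1"
    using Gorenstein_right[OF M(1)] .
  obtain C2 N2 a2 b2 where 2: "C2 \<in> \<C>" "N2 \<in> Gorenstein \<A> \<C>" "short_exact \<A> M'' a2 C2 b2 N2"
    using Gorenstein_right[OF M(2)] .
  obtain x E y z w where E: "short_exact \<A> C1 x E y M''" "short_exact \<A> M z E w N1"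
    by (rule abelian_category.short_exact_pullback_short_exact[OF abelian_opp, of M'' g M f M' N1 b1 C1 a1])
      (use s 1 in simp_all)
  obtain t where t: "t \<in> Hom \<A> M'' E" "y \<odot> t = Id \<A> M''"
    using Gorenstein_orth(2)[OF M(2) 1(1)] E(1) unfolding ext_split_def by blast
  obtain r where r: "is_biproduct \<A> C1 M'' E x t r y" by (rule section_is_biproduct[OF E(1) t])
  obtain T i j p q where T: "is_biproduct \<A> C1 C2 T i j p q"
    using ex_direct_sum[of C1 C2] 1(1) 2(1) C_Ob unfolding is_direct_sum_def by blast
  have TC: "T \<in> \<C>" using subcat 1(1) 2(1) T unfolding subcategory_def is_direct_sum_def by blast
  obtain c N d e k where "short_exact \<A> M (k \<odot> z) T c N" "short_exact \<A> N1 d N e N2"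
    by (rule short_exact_Comp_monic[OF E(2) is_biproduct_short_exact_sum[OF r T 2(3)]])
  then show thesis using that TC 1(2) 2(2) by blast
qed

lemma Gorenstein_extension_left:
  assumes "M' \<in> Gorenstein \<A> \<C>" "M'' \<in> Gorenstein \<A> \<C>" "short_exact \<A> M' f M g M''"
  obtains X N N' N'' a b c e where "X \<in> \<C>" "N' \<in> Gorenstein \<A> \<C>" "N'' \<in> Gorenstein \<A> \<C>"
    "short_exact \<A> N a X b M" "short_exact \<A> N' c N e N''"
  by (rule self_orthogonal.Gorenstein_extension_right[OF self_orthogonal_opp, of M'' M' g M f])
    (use assms that in simp_all)

text \<open>The class of all extensions of Gorenstein objects reproduces itself, since the horseshoe
  yields syzygies and cosyzygies that are again such extensions.\<close>

lemma Gorenstein_extension_closed: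
  assumes "M' \<in> Gorenstein \<A> \<C>" "M'' \<in> Gorenstein \<A> \<C>" "short_exact \<A> M' f M g M''"
  shows "M \<in> Gorenstein \<A> \<C>"
proof -
  define \<W> where "\<W> = {M. \<exists>M'\<in>Gorenstein \<A> \<C>. \<exists>M''\<in>Gorenstein \<A> \<C>. \<exists>f g. short_exact \<A> M' f M g M''}"
  have MW: "M \<in> \<W>" using assms by (auto simp: \<W>_def)
  show ?thesis
  proof (rule Gorenstein_coinduct[OF MW])
    fix M assume "M \<in> \<W>"
    then obtain M' M'' f g where M: "M' \<in> Gorenstein \<A> \<C>" "M'' \<in> Gorenstein \<A> \<C>" "short_exact \<A> M' f M g M''"
      unfolding \<W>_def by blast
    show "ext_split \<A> X M \<and> ext_split \<A> M X" if "X \<in> \<C>" for X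
      using ext_split_middle_right[OF _ _ M(3), of X] ext_split_middle_left[OF _ _ M(3), of X]
        Gorenstein_orth[OF M(1) that] Gorenstein_orth[OF M(2) that] by blast
    show "\<exists>X\<in>\<C>. \<exists>N\<in>\<W> \<union> Gorenstein \<A> \<C>. \<exists>f g. short_exact \<A> M f X g N"
      using Gorenstein_extension_right[OF M] unfolding \<W>_def by (metis (mono_tags, lifting) UnCI mem_Collect_eq)
    show "\<exists>X\<in>\<C>. \<exists>N\<in>\<W> \<union> Gorenstein \<A> \<C>. \<exists>f g. short_exact \<A> N f X g M"
      using Gorenstein_extension_left[OF M] unfolding \<W>_def by (metis (mono_tags, lifting) UnCI mem_Collect_eq)
  qed
qed

text \<open>The quotient of \<open>G\<close> by \<open>X\<close> is \<open>C\<close>, so the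
  embedding of \<open>X\<close> into \<open>C0\<close> through \<open>G\<close> has as cokernel an
  extension of \<open>N\<close> by \<open>C\<close>, which is Gorenstein.\<close>

lemma Gorenstein_summand_right:
  assumes B: "is_biproduct \<A> X C G i j p q" and C: "C \<in> \<C>" and G: "G \<in> Gorenstein \<A> \<C>"
  obtains Y N f g where "Y \<in> \<C>" "N \<in> Gorenstein \<A> \<C>" "short_exact \<A> X f Y g N"
proof -
  obtain C0 N a b where 0: "C0 \<in> \<C>" "N \<in> Gorenstein \<A> \<C>" "short_exact \<A> G a C0 b N"
    using Gorenstein_right[OF G] .
  obtain c N1 d e where 1: "short_exact \<A> X (a \<odot> i) C0 c N1" "short_exact \<A> C d N1 e N"
    by (rule short_exact_Comp_monic[OF is_biproduct_short_exact[OF B] 0(3)])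
  have "N1 \<in> Gorenstein \<A> \<C>"
    using Gorenstein_extension_closed[OF _ 0(2) 1(2)] C C_subset_Gorenstein by blast
  then show thesis using that[OF 0(1) _ 1(1)] by blast
qed

text \<open>Syzygy and cosyzygy of \<open>X\<close> can be taken Gorenstein, so coinduction on the
  one-element class suffices.\<close>

lemma Gorenstein_stable_summand:
  assumes B: "is_biproduct \<A> X C G i j p q" and C: "C \<in> \<C>" and G: "G \<in> Gorenstein \<A> \<C>"
  shows "X \<in> Gorenstein \<A> \<C>"
proof (rule Gorenstein_coinduct[of X "{X}"])
  obtain Y N f g where 1: "Y \<in> \<C>" "N \<in> Gorenstein \<A> \<C>" "short_exact \<A> X f Y g N"
    using Gorenstein_summand_right[OF assms] .
  obtain Z L h k where 2: "Z \<in> \<C>" "L \<in> Gorenstein \<A> \<C>" "short_exact \<A> L k Z h X"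
    by (rule self_orthogonal.Gorenstein_summand_right[OF self_orthogonal_opp, of X C G p q i j])
      (use assms in simp_all)
  fix M assume "M \<in> {X}"
  then have M: "M = X" by simp
  show "\<exists>Y\<in>\<C>. \<exists>N\<in>{X} \<union> Gorenstein \<A> \<C>. \<exists>f g. short_exact \<A> M f Y g N"
    unfolding M using 1 by blast
  show "\<exists>Y\<in>\<C>. \<exists>N\<in>{X} \<union> Gorenstein \<A> \<C>. \<exists>f g. short_exact \<A> N f Y g M"
    unfolding M using 2 by blast
  show "ext_split \<A> Y M \<and> ext_split \<A> M Y" if "Y \<in> \<C>" for Y
    unfolding M using ext_split_summand_left[OF B Gorenstein_orth(2)[OF G that]]
      ext_split_summand_right[OF B Gorenstein_orth(1)[OF G that]] by blast
qed simp

end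

section \<open>Special Gorenstein precovers\<close>

lemma (in abelian_category) short_exact_iso_right:
  assumes "short_exact \<A> X f Y g Z" "\<phi> \<in> Hom \<A> Z W" "\<psi> \<in> Hom \<A> W Z"
    "\<psi> \<odot> \<phi> = Id \<A> Z" "\<phi> \<odot> \<psi> = Id \<A> W"
  shows "short_exact \<A> X f Y (\<phi> \<odot> g) W"
proof -
  note s = short_exactD[OF assms(1)] and t = HomD[OF assms(2)] HomD[OF assms(3)]
  have m: "monic \<A> \<phi>" using monic_if_retraction[of \<phi> \<psi>] t assms by simp
  have "epic \<A> \<phi>" using epic_if_section[of \<phi> \<psi>] t assms by simp
  then have "epic \<A> (\<phi> \<odot> g)" using epic_Comp s t by simp
  moreover have "is_kernel \<A> f (\<phi> \<odot> g)" using is_kernel_Comp_monic_iff[OF m, of g f] s t by simp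
  ultimately show ?thesis using short_exactI[of f "\<phi> \<odot> g"] s t by simp
qed

text \<open>The snake lemma for a morphism of rows that is the identity on \<open>Z\<close>:
  \<open>r\<close> has the same kernel and cokernel as \<open>m\<close>.\<close>

lemma (in abelian_category) short_exact_morphism_kernel:
  assumes s: "short_exact \<A> X f Y g Z" and t: "short_exact \<A> A u E v Z" and m: "short_exact \<A> K k A m X"
    and r: "r \<in> Hom \<A> E Y" "r \<odot> u = f \<odot> m" "g \<odot> r = v"
  shows "short_exact \<A> K (u \<odot> k) E r Y"
proof -
  note st = short_exactD[OF s] short_exactD[OF t] short_exactD[OF m] HomD[OF r(1)]
  note sm = short_exactD(11)[OF s] short_exactD(11)[OF t] short_exactD(11)[OF m]
  have "is_kernel \<A> (u \<odot> k) r"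
  proof (rule is_kernelI)
    show "monic \<A> (u \<odot> k)" using monic_Comp sm st by simp
    have "r \<odot> (u \<odot> k) = (f \<odot> m) \<odot> k" by (rule Comp_reassoc[OF r(2)]) (use st in auto)
    also have "\<dots> = Zero \<A> K Y" using st by simp
    finally show "r \<odot> (u \<odot> k) = Zero \<A> (Dom \<A> (u \<odot> k)) (Cod \<A> r)" using st by simp
    fix h assume h: "h \<in> Mor \<A>" "Cod \<A> h = Dom \<A> r" "r \<odot> h = Zero \<A> (Dom \<A> h) (Cod \<A> r)"
    have "v \<odot> h = g \<odot> (r \<odot> h)" by (rule Comp_reassoc[OF r(3), symmetric]) (use h st in auto)
    also have "\<dots> = Zero \<A> (Dom \<A> h) Z" using h st by simp
    finally obtain h1 where h1: "h1 \<in> Mor \<A>" "Dom \<A> h1 = Dom \<A> h" "Cod \<A> h1 = A" "u \<odot> h1 = h"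
      using short_exact_lift[OF t, of h "Dom \<A> h"] h st by auto
    have "(f \<odot> m) \<odot> h1 = r \<odot> (u \<odot> h1)" by (rule Comp_reassoc[OF r(2), symmetric]) (use h1 st in auto)
    then have "f \<odot> (m \<odot> h1) = Zero \<A> (Dom \<A> h) Y" using h1 h st by simp
    then have "m \<odot> h1 = Zero \<A> (Dom \<A> h) X"
      using monic_Zero[OF sm(1), of "m \<odot> h1"] h1 st by simp
    then obtain h2 where h2: "h2 \<in> Mor \<A>" "Dom \<A> h2 = Dom \<A> h" "Cod \<A> h2 = K" "k \<odot> h2 = h1"
      using short_exact_lift[OF m, of h1 "Dom \<A> h"] h1 by auto
    then show "\<exists>y. y \<in> Mor \<A> \<and> Dom \<A> y = Dom \<A> h \<and> Cod \<A> y = Dom \<A> (u \<odot> k) \<and> (u \<odot> k) \<odot> y = h"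
      using h1 st by (intro exI[of _ h2]) simp
  qed (use st in auto)
  moreover have "epic \<A> r"
  proof (rule epicI)
    fix x assume x: "x \<in> Mor \<A>" "Dom \<A> x = Cod \<A> r" "x \<odot> r = Zero \<A> (Dom \<A> r) (Cod \<A> x)"
    have "x \<odot> (r \<odot> u) = Zero \<A> A (Cod \<A> x)"
      by (subst Comp_reassoc[OF x(3)]) (use x st in auto)
    then have "(x \<odot> f) \<odot> m = Zero \<A> A (Cod \<A> x)" using r(2) x st by simp
    then have "x \<odot> f = Zero \<A> X (Cod \<A> x)"
      using epic_Zero[OF short_exactD(12)[OF m], of "x \<odot> f" A] x st by simp
    then obtain y where y: "y \<in> Mor \<A>" "Dom \<A> y = Z" "Cod \<A> y = Cod \<A> x" "y \<odot> g = x"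
      using short_exact_desc[OF s, of x "Cod \<A> x"] x st by auto
    have "y \<odot> v = x \<odot> r" using Comp_reassoc[OF y(4), of r] r(3) y st by simp
    then have "y = Zero \<A> Z (Cod \<A> x)"
      using epic_Zero[OF short_exactD(12)[OF t], of y E] x y st by simp
    then show "x = Zero \<A> (Cod \<A> r) (Cod \<A> x)" using y(4) x st by auto
  qed (use st in simp)
  ultimately show ?thesis using short_exactI[of "u \<odot> k" r] st by simp
qed

locale projectively_generated = self_orthogonal +
  assumes generator: "generator_for \<A> (projectives \<A>) \<C>"
begin

abbreviation "\<G> \<equiv> Gorenstein \<A> \<C>"
abbreviation "\<K> \<equiv> right_perp1 \<A> \<G>"

lemma perp_iff: "K \<in> \<K> \<longleftrightarrow> K \<in> Ob \<A> \<and> (\<forall>G\<in>\<G>. ext_split \<A> G K)"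
  using Ext_zero_1_iff Gorenstein_Ob unfolding right_perp1_def by blast

lemma C_subset_perp: "\<C> \<subseteq> \<K>"
  using perp_iff C_Ob Gorenstein_orth by blast

text \<open>Lifting Gorenstein objects along \<open>e\<close> is automatic when its kernel lies in
  \<open>\<K>\<close>, so the precover condition is absorbed and only a short exact sequence
  remains.\<close>

lemma SPC_iff: "M \<in> SPC \<A> \<G> \<longleftrightarrow> (\<exists>K\<in>\<K>. \<exists>G\<in>\<G>. \<exists>k e. short_exact \<A> K k G e M)"
proof
  assume "M \<in> SPC \<A> \<G>"
  then obtain e k where e: "Dom \<A> e \<in> \<G>" "Cod \<A> e = M" "epic \<A> e" "is_kernel \<A> k e" "Dom \<A> k \<in> \<K>"
    unfolding SPC_def is_special_precover_def is_precover_def by blast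
  then show "\<exists>K\<in>\<K>. \<exists>G\<in>\<G>. \<exists>k e. short_exact \<A> K k G e M" using short_exactI[OF e(4,3)] by blast
next
  assume "\<exists>K\<in>\<K>. \<exists>G\<in>\<G>. \<exists>k e. short_exact \<A> K k G e M"
  then obtain K G k e where K: "K \<in> \<K>" and G: "G \<in> \<G>" and s: "short_exact \<A> K k G e M" by blast
  note t = short_exactD[OF s]
  have "(\<lambda>h. e \<odot> h) ` Hom \<A> X G = Hom \<A> X M" if X: "X \<in> \<G>" for X
  proof (intro equalityI subsetI)
    fix h assume "h \<in> (\<lambda>h. e \<odot> h) ` Hom \<A> X G"
    then show "h \<in> Hom \<A> X M" using t by (auto simp: Hom_def)
  next
    fix h assume h: "h \<in> Hom \<A> X M"
    obtain y where "y \<in> Hom \<A> X G" "e \<odot> y = h"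
      by (rule ext_split_lift[OF _ s h]) (use K X perp_iff in blast)+
    then show "h \<in> (\<lambda>h. e \<odot> h) ` Hom \<A> X G" by blast
  qed
  then have "is_precover \<A> \<G> e M" unfolding is_precover_def using t G by simp
  then have "is_special_precover \<A> \<G> e M"
    unfolding is_special_precover_def using t(2,12,13) K by blast
  then show "M \<in> SPC \<A> \<G>" unfolding SPC_def using t(9) by blast
qed

lemma projectives_subset: "projectives \<A> \<subseteq> \<C>"
  using generator unfolding generator_for_def by blast

text \<open>\<open>G\<close> is presented by an object \<open>X\<close> of \<C>, and
  \<open>X\<close> by a projective. The kernel of the composite is an extension of a Gorenstein
  object by one of \<C>, because the generator condition keeps the kernel of
  \<open>P \<rightarrow> X\<close> in \<C>.\<close>

lemma Gorenstein_projective: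
  assumes "G \<in> \<G>"
  obtains G' P a b where "G' \<in> \<G>" "P \<in> projectives \<A>" "short_exact \<A> G' a P b G"
proof -
  obtain X N f g where X: "X \<in> \<C>" "N \<in> \<G>" "short_exact \<A> N f X g G" using Gorenstein_left[OF assms] .
  obtain C P u v where P: "C \<in> \<C>" "P \<in> projectives \<A>" "short_exact \<A> C u P v X"
    using generator X(1) unfolding generator_for_def by blast
  obtain f' Y g' h where Y: "short_exact \<A> C f' Y g' N" "short_exact \<A> Y h P (g \<odot> v) G"
    by (rule short_exact_Comp_epic[OF P(3) X(3)])
  have "Y \<in> \<G>" using Gorenstein_extension_closed[OF _ X(2) Y(1)] P(1) C_subset_Gorenstein by blast
  then show thesis using that P(2) Y(2) by blast
qed

text \<open>The obstruction lies in \<open>Ext^2(G, K)\<close>, which the projective presentation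
  turns into \<open>Ext^1(G', K)\<close> with \<open>G'\<close> Gorenstein.\<close>

lemma perp_quotient:
  assumes "short_exact \<A> K f B g Q" "K \<in> \<K>" "B \<in> \<K>"
  shows "Q \<in> \<K>"
  unfolding perp_iff
proof (intro conjI ballI)
  show "Q \<in> Ob \<A>" using short_exactD(9)[OF assms(1)] .
  fix G assume G: "G \<in> \<G>"
  obtain G' P a b where P: "G' \<in> \<G>" "P \<in> projectives \<A>" "short_exact \<A> G' a P b G"
    using Gorenstein_projective[OF G] .
  show "ext_split \<A> G Q"
    by (rule ext_split_quotient[OF assms(1) _ P(3,2)]) (use assms perp_iff G P(1) in blast)+
qed

lemma perp_extension_closed:
  assumes "short_exact \<A> X f Y g Z" "X \<in> \<K>" "Z \<in> \<K>"
  shows "Y \<in> \<K>"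
  using ext_split_middle_right[OF _ _ assms(1)] assms short_exactD(8)[OF assms(1)]
  unfolding perp_iff by blast

text \<open>After pulling back to \<open>GZ\<close>, the extension of \<open>GZ\<close> by
  \<open>X\<close> has to come from one by \<open>GX\<close>. The obstruction lies in
  \<open>Ext^2(GZ, KX) = Ext^1(G', KX) = 0\<close>. The lifted extension \<open>E\<close> is
  Gorenstein and maps onto \<open>Y\<close> with kernel an extension of \<open>KZ\<close> by
  \<open>KX\<close>.\<close>

lemma SPC_extension_closed: "extension_closed \<A> (SPC \<A> \<G>)"
  unfolding extension_closed_def
proof (intro ballI allI impI)
  fix X Z Y f g assume "X \<in> SPC \<A> \<G>" "Z \<in> SPC \<A> \<G>" and s: "short_exact \<A> X f Y g Z"
  then obtain KX GX kx ex KZ GZ kz ez where X: "KX \<in> \<K>" "GX \<in> \<G>" "short_exact \<A> KX kx GX ex X"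
    and Z: "KZ \<in> \<K>" "GZ \<in> \<G>" "short_exact \<A> KZ kz GZ ez Z" unfolding SPC_iff by blast
  obtain f' Y' g' k' h' where Y: "short_exact \<A> X f' Y' g' GZ" "short_exact \<A> KZ k' Y' h' Y"
    by (rule short_exact_pullback_short_exact[OF s Z(3)])
  obtain G' P a b where P: "G' \<in> \<G>" "P \<in> projectives \<A>" "short_exact \<A> G' a P b GZ"
    using Gorenstein_projective[OF Z(2)] .
  note t = short_exactD[OF Y(1)] short_exactD[OF P(3)] short_exactD[OF X(3)]
  \<comment> \<open>The restriction \<open>z\<close> of \<open>w\<close> to \<open>G'\<close>
    represents the extension \<open>Y'\<close>; its lift \<open>y\<close> through \<open>ex\<close>
    represents the extension sought.\<close>
  obtain w where w: "w \<in> Hom \<A> P Y'" "g' \<odot> w = b"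
    by (rule projective_lift[OF P(2) short_exactD(12)[OF Y(1)], of b]) (use t in \<open>auto simp: Hom_def\<close>)
  note wt = HomD[OF w(1)]
  have "g' \<odot> (w \<odot> a) = b \<odot> a" by (rule Comp_reassoc[OF w(2)]) (use t wt in auto)
  then obtain z where z: "z \<in> Mor \<A>" "Dom \<A> z = G'" "Cod \<A> z = X" "f' \<odot> z = w \<odot> a"
    using short_exact_lift[OF Y(1), of "w \<odot> a" G'] t wt by auto
  obtain y where y: "y \<in> Hom \<A> G' GX" "ex \<odot> y = z"
    by (rule ext_split_lift[OF _ X(3), of G' z]) (use z X(1) P(1) perp_iff in \<open>auto simp: Hom_def\<close>)
  note yt = HomD[OF y(1)]
  \<comment> \<open>The pushout along \<open>y\<close> realises the lifted class. Its universal
    property supplies the map \<open>r\<close> to \<open>Y'\<close>, and its uniqueness part the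
    compatibility of \<open>r\<close> with the maps to \<open>GZ\<close>.\<close>
  obtain u E v c where E: "short_exact \<A> GX u E v GZ" "c \<in> Hom \<A> P E" "c \<odot> a = u \<odot> y" "v \<odot> c = b"
    and up: "\<And>p q T. \<lbrakk>p \<in> Hom \<A> P T; q \<in> Hom \<A> GX T; p \<odot> a = q \<odot> y\<rbrakk>
      \<Longrightarrow> \<exists>r. r \<in> Hom \<A> E T \<and> r \<odot> c = p \<and> r \<odot> u = q"
    and je: "\<And>p q T. \<lbrakk>p \<in> Hom \<A> E T; q \<in> Hom \<A> E T; p \<odot> c = q \<odot> c; p \<odot> u = q \<odot> u\<rbrakk> \<Longrightarrow> p = q"
    by (rule short_exact_pushout[OF P(3) y(1)]) blast
  note et = short_exactD[OF E(1)] HomD[OF E(2)]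
  have "w \<odot> a = (f' \<odot> ex) \<odot> y" using y(2) z(4) t yt by simp
  then obtain r where r: "r \<in> Hom \<A> E Y'" "r \<odot> c = w" "r \<odot> u = f' \<odot> ex"
    using up[OF w(1), of "f' \<odot> ex"] t by (auto simp: Hom_def)
  note rt = HomD[OF r(1)]
  have "g' \<odot> r = v"
  proof (rule je[of _ GZ])
    show "(g' \<odot> r) \<odot> c = v \<odot> c" using r(2) w(2) E(4) rt et t by simp
    have "g' \<odot> (f' \<odot> ex) = Zero \<A> GX GZ" by (subst Comp_reassoc[OF t(10)]) (use t in auto)
    then show "(g' \<odot> r) \<odot> u = v \<odot> u" using r(3) rt et t by simp
  qed (use rt et t in \<open>auto simp: Hom_def\<close>)
  from short_exact_morphism_kernel[OF Y(1) E(1) X(3) r(1) r(3) this]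
  have "short_exact \<A> KX (u \<odot> kx) E r Y'" .
  then obtain f2 K g2 k2 where K: "short_exact \<A> KX f2 K g2 KZ" "short_exact \<A> K k2 E (h' \<odot> r) Y"
    using short_exact_Comp_epic[OF _ Y(2)] by metis
  have "K \<in> \<K>" using perp_extension_closed[OF K(1) X(1) Z(1)] .
  moreover have "E \<in> \<G>" using Gorenstein_extension_closed[OF X(2) Z(2) E(1)] .
  ultimately show "Y \<in> SPC \<A> \<G>" unfolding SPC_iff using K(2) by blast
qed

text \<open>Let \<open>G1\<close> be the preimage of \<open>M\<close> in \<open>G\<close>. It maps
  onto \<open>M\<close> with kernel \<open>K\<close>, and it is the kernel of
  \<open>G \<rightarrow> C\<close>, which splits because \<open>C\<close> is Gorenstein and so
  \<open>Ext^1(C, K) = 0\<close>. Thus \<open>G1\<close> is a \<C>-stable summand of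
  \<open>G\<close>.\<close>

lemma SPC_stable_summand_closed: "stable_summand_closed \<A> \<C> (SPC \<A> \<G>)"
  unfolding stable_summand_closed_def
proof (intro ballI impI)
  fix M C S assume M: "M \<in> Ob \<A>" and C: "C \<in> \<C>" and "S \<in> SPC \<A> \<G>" "is_direct_sum \<A> M C S"
  then obtain K G k e i j p q where K: "K \<in> \<K>" "G \<in> \<G>" "short_exact \<A> K k G e S"
    and B: "is_biproduct \<A> M C S i j p q" unfolding SPC_iff is_direct_sum_def by blast
  note b = is_biproductD[OF B] and t = short_exactD[OF K(3)]
  obtain f' G1 g' h' where G1: "short_exact \<A> K f' G1 g' M" "short_exact \<A> G1 h' G (q \<odot> e) C"
    by (rule short_exact_Comp_epic[OF K(3) is_biproduct_short_exact[OF B]])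
  have "ext_split \<A> C K" using K(1) C C_subset_Gorenstein perp_iff by blast
  from ext_split_lift[OF this K(3), of j]
  obtain l where l: "l \<in> Hom \<A> C G" "e \<odot> l = j" using b by (auto simp: Hom_def)
  then have "(q \<odot> e) \<odot> l = Id \<A> C" using b t HomD[OF l(1)] by simp
  from section_is_biproduct[OF G1(2) l(1) this]
  obtain r where "is_biproduct \<A> G1 C G h' l r (q \<odot> e)" .
  then have "G1 \<in> \<G>" using Gorenstein_stable_summand C K(2) by blast
  then show "M \<in> SPC \<A> \<G>" unfolding SPC_iff using K(1) G1(1) by blast
qed

section \<open>Containments and minimality\<close>

lemma Gorenstein_subset_SPC: "\<G> \<subseteq> SPC \<A> \<G>"
proof
  fix M assume M: "M \<in> \<G>"
  obtain Z where Z: "Z \<in> \<C>" "is_zero_object \<A> Z" using subcat unfolding subcategory_def by blast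
  then have "Z \<in> \<K>" using C_subset_perp by blast
  then show "M \<in> SPC \<A> \<G>"
    unfolding SPC_iff using short_exact_zero_left[OF Z(2) Gorenstein_Ob[OF M]] M by blast
qed

lemma subcategory_SPC: "subcategory \<A> (SPC \<A> \<G>)"
  unfolding subcategory_def
proof (intro conjI ballI allI impI subsetI)
  show "X \<in> Ob \<A>" if "X \<in> SPC \<A> \<G>" for X using that unfolding SPC_def by blast
  show "\<exists>Z\<in>SPC \<A> \<G>. is_zero_object \<A> Z"
    using subcat C_subset_Gorenstein Gorenstein_subset_SPC unfolding subcategory_def by blast
  show "Y \<in> SPC \<A> \<G>" if "X \<in> SPC \<A> \<G>" "isomorphic \<A> X Y" for X Y
  proof -
    obtain K G k e where K: "K \<in> \<K>" "G \<in> \<G>" "short_exact \<A> K k G e X"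
      using \<open>X \<in> SPC \<A> \<G>\<close> unfolding SPC_iff by blast
    obtain \<phi> where "short_exact \<A> K k G (\<phi> \<odot> e) Y"
      using \<open>isomorphic \<A> X Y\<close> short_exact_iso_right[OF K(3)] unfolding isomorphic_def by blast
    then show ?thesis unfolding SPC_iff using K by blast
  qed
  show "S \<in> SPC \<A> \<G>" if "X \<in> SPC \<A> \<G>" "Y \<in> SPC \<A> \<G>" "is_direct_sum \<A> X Y S" for X Y S
    using that SPC_extension_closed is_biproduct_short_exact
    unfolding extension_closed_def is_direct_sum_def by blast
qed

text \<open>The row given by the generator condition has its middle term in \<C>, hence Gorenstein,
  and so is already a special precover.\<close>

lemma perp_subset_SPC:
  assumes "generator_for \<A> \<C> \<K>"
  shows "\<K> \<subseteq> SPC \<A> \<G>"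
proof
  fix M assume "M \<in> \<K>"
  then obtain K C k e where "K \<in> \<K>" "C \<in> \<C>" "short_exact \<A> K k C e M"
    using assms unfolding generator_for_def by blast
  then show "M \<in> SPC \<A> \<G>" unfolding SPC_iff using C_subset_Gorenstein by blast
qed

text \<open>\<open>M\<close> is first reached as the kernel of \<open>Q \<rightarrow> G'\<close>,
  but \<X> is not assumed closed under kernels. Over the projective \<open>P\<close> the row splits,
  which turns the kernel into a summand whose complement \<open>P\<close> lies in \<C>.\<close>

lemma SPC_minimal:
  assumes sub: "\<K> \<union> \<G> \<subseteq> \<X>" and ext: "extension_closed \<A> \<X>" and stable: "stable_summand_closed \<A> \<C> \<X>"
  shows "SPC \<A> \<G> \<subseteq> \<X>"
proof
  fix M assume "M \<in> SPC \<A> \<G>"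
  then obtain K G k e where K: "K \<in> \<K>" "G \<in> \<G>" "short_exact \<A> K k G e M" unfolding SPC_iff by blast
  obtain C G' a b where C: "C \<in> \<C>" "G' \<in> \<G>" "short_exact \<A> G a C b G'" using Gorenstein_right[OF K(2)] .
  obtain c Q m n where Q: "short_exact \<A> K (a \<odot> k) C c Q" "short_exact \<A> M m Q n G'"
    by (rule short_exact_Comp_monic[OF K(3) C(3)])
  \<comment> \<open>Besides \<open>K\<close>, also \<open>C\<close> lies in \<open>\<K>\<close>,
    since Gorenstein objects are left orthogonal to \<C>.\<close>
  have QK: "Q \<in> \<K>" using perp_quotient[OF Q(1) K(1)] C(1) C_subset_perp by blast
  obtain G'' P u v where P: "G'' \<in> \<G>" "P \<in> projectives \<A>" "short_exact \<A> G'' u P v G'"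
    using Gorenstein_projective[OF C(2)] .
  obtain f' E g' k' h' where E: "short_exact \<A> M f' E g' P" "short_exact \<A> G'' k' E h' Q"
    by (rule short_exact_pullback_short_exact[OF Q(2) P(3)])
  have "E \<in> \<X>" using ext E(2) P(1) QK sub unfolding extension_closed_def by blast
  moreover obtain s where s: "s \<in> Hom \<A> P E" "g' \<odot> s = Id \<A> P"
    using projective_ext_split[OF P(2)] E(1) unfolding ext_split_def by blast
  from section_is_biproduct[OF E(1) s] obtain r where "is_biproduct \<A> M P E f' s r g'" .
  ultimately show "M \<in> \<X>"
    using stable P(2) projectives_subset short_exactD(7)[OF E(1)]
    unfolding stable_summand_closed_def is_direct_sum_def by blast
qed

end

theorem theorem4p5:
  fixes \<A> :: "('o, 'm, 'z) preadd_scheme" and \<C> :: "'o set"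
  assumes "abelian_category \<A>"
    and "subcategory \<A> \<C>"
    and "Ext_orthogonal \<A> \<C> \<C>"
    and "generator_for \<A> (projectives \<A>) \<C>"
    and "generator_for \<A> \<C> (right_perp1 \<A> (Gorenstein \<A> \<C>))"
  shows
    "(subcategory \<A> (SPC \<A> (Gorenstein \<A> \<C>)) \<and>
      right_perp1 \<A> (Gorenstein \<A> \<C>) \<union> Gorenstein \<A> \<C> \<subseteq> SPC \<A> (Gorenstein \<A> \<C>) \<and>
      extension_closed \<A> (SPC \<A> (Gorenstein \<A> \<C>)) \<and>
      stable_summand_closed \<A> \<C> (SPC \<A> (Gorenstein \<A> \<C>))) \<and>
     (\<forall>\<X>. subcategory \<A> \<X> \<and>
        right_perp1 \<A> (Gorenstein \<A> \<C>) \<union> Gorenstein \<A> \<C> \<subseteq> \<X> \<and>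
        extension_closed \<A> \<X> \<and> stable_summand_closed \<A> \<C> \<X> \<longrightarrow>
        SPC \<A> (Gorenstein \<A> \<C>) \<subseteq> \<X>)"
proof -
  interpret abelian_category \<A> by (rule assms(1))
  have C_Ob: "\<C> \<subseteq> Ob \<A>" using assms(2) unfolding subcategory_def by blast
  have "ext_split \<A> X Y" if "X \<in> \<C>" "Y \<in> \<C>" for X Y
    using Ext_zero_1_iff[of X Y] assms(3) that C_Ob unfolding Ext_orthogonal_def by blast
  then interpret projectively_generated \<A> \<C>
    using assms(2,4) by unfold_locales blast+
  show ?thesis
    using subcategory_SPC Gorenstein_subset_SPC perp_subset_SPC[OF assms(5)] SPC_extension_closed
      SPC_stable_summand_closed SPC_minimal by blast
qed

end
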